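(* Let $\mathbb K$ and $\mathbb L$ be two octonion algebras over $\mathbb R$, each being either the division algebra $\mathbb O$ or the split octonions $\mathbb O'$. Let $\mathcal V$ be the real vector space spanned by the off-diagonal matrices $X_{aA},Y_{aA},Z_{aA}$ and the diagonal matrices $D_p,D_{p,q},E_p,E_{p,q},F_p,F_{p,q}$ and $D_P,D_{P,Q},E_P,E_{P,Q},F_P,F_{P,Q}$ described in the context (with $a,p,q\in\mathbb K$ and $A,P,Q\in\mathbb L$ basic units, $p,q$ distinct imaginary, $P,Q$ distinct imaginary), modulo the linear triality relations (T) for $\mathbb K$ and for $\mathbb L$ given in the context. Then $\dim_{\mathbb R}\mathcal V=248$. Define an antisymmetric bilinear product on $\mathcal V$ by $[V,W]=VW-WV$ (matrix commutator), where commutators of diagonal matrices are computed, in each of the two copies (one for $\mathbb K$, one for $\mathbb L$) of the 28-dimensional diagonal algebra, in any one of the three languages $D,E,F$ (but not mixed), and where octonion operations are extended to nested octonions $p\circ q$ via $$[p\circ q,a]=p\circ q\circ a-a\circ p\circ q\ (=0\text{ unless }a=p\text{ or }a=q),\qquad (p\circ q)a=p(qa),\qquad a(p\circ q)=(ap)q,$$ as spelled out in the context. Then this product is well-defined, i.e. does not depend on the matrices $V,W$ chosen to represent elements of $\mathcal V$. Moreover it satisfies the Jacobi identity, and makes $\mathcal V$ into a Lie algebra isomorphic to: (a) the compact real form of the Lie algebra $\mathfrak e_8$, if both $\mathbb K$ and $\mathbb L$ are division algebras; (b) the split real form of $\mathfrak e_8$, if both $\mathbb K$ and $\mathbb L$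 are split octonions; (c) the real form $\mathfrak e_{8(-24)}$, if one of $\mathbb K,\mathbb L$ is a division algebra and the other is split.
   Context: **Octonions.** An octonion algebra here is the real algebra with basis (the "basic units") $1,i,j,k,\ell,i\ell,j\ell,k\ell$, where $1,i,j,k$ span the quaternions ($i^2=j^2=k^2=-1$, $ij=k$) and, for quaternions $x,y$, $x(y\ell)=(yx)\ell$, $(x\ell)y=(x\overline y)\ell$, $(x\ell)(y\ell)=\ell^2\,\overline y x$, with $\ell^2=-1$ for the division algebra $\mathbb O$ and $\ell^2=+1$ for the split octonions $\mathbb O'$. Conjugation $x\mapsto\overline x$ fixes $1$ and negates the seven imaginary basic units. The algebra $\mathbb L$ is a second copy, with basic units denoted by capital letters $1,I,J,K,L,IL,JL,KL$. $L_x$ denotes left multiplication by $x$. **Nested octonions.** For distinct imaginary basic units $p,q$ of the same algebra, $p\circ q=-q\circ p$ is a formal symbol standing for the operator $L_pL_q$ ($L_q$ first). "Evaluating as left multiplications" means replacing each octonion $x$ by $L_x$ and each $p\circ q$ by $L_pL_q$, and composing. In particular $L_pL_q=-L_qL_p$ and $L_pL_p=p^2$. **Matrices.** For basic units $a\in\mathbb K$, $A\in\mathbb L$, with $\otimes$ over $\mathbb R$: $$X_{aA}=\begin{pmatrix}0&a\otimes A&0\\ -\overline a\otimes\overline A&0&0\\ 0&0&0\end{pmatrix},\quad Y_{aA}=\begin{pmatrix}0&0&0\\ 0&0&a\otimes A\\ 0&-\overline a\otimes\overline A&0\end{pmatrix},\quad Z_{aA}=\begin{pmatrix}0&0&-\overline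 a\otimes\overline A\\ 0&0&0\\ a\otimes A&0&0\end{pmatrix}.$$ For distinct imaginary basic units $p,q$ of $\mathbb K$: $D_p=\mathrm{diag}(p,-p,0)$, $E_p=\mathrm{diag}(0,p,-p)$, $F_p=\mathrm{diag}(-p,0,p)$, $D_{p,q}=\mathrm{diag}(p\circ q,p\circ q,0)$, $E_{p,q}=\mathrm{diag}(0,p\circ q,p\circ q)$, $F_{p,q}=\mathrm{diag}(p\circ q,0,p\circ q)$; and likewise $D_P,\dots,F_{P,Q}$ for imaginary basic units $P,Q$ of $\mathbb L$. Notation is extended linearly in the subscripts. **Triality relations (T).** For an imaginary basic unit $r$ of $\mathbb K$, the other six imaginary basic units form three pairs with product $\pm r$; order each pair as $(p_s,q_s)$, $s=1,2,3$, so that $p_sq_s=-r$. The relations imposed are $$E_r\equiv\tfrac12\Big(-D_r-\sum_{s=1}^3D_{p_s,q_s}\Big),\qquad F_r\equiv\tfrac12\Big(-D_r+\sum_{s=1}^3D_{p_s,q_s}\Big),$$ and, for each $s$, with $\{s,t,u\}=\{1,2,3\}$, $$E_{p_s,q_s}\equiv\tfrac12\big(D_r+D_{p_s,q_s}-D_{p_t,q_t}-D_{p_u,q_u}\big),\qquad F_{p_s,q_s}\equiv\tfrac12\big(-D_r+D_{p_s,q_s}-D_{p_t,q_t}-D_{p_u,q_u}\big).$$ (For $\mathbb K=\mathbb O$, $r=\ell$ the pairs are $(i,i\ell),(j,j\ell),(k,k\ell)$.) The same relations are imposed for $\mathbb L$. Thus the spans of the $D$'s, of the $E$'s and of the $F$'s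 over $\mathbb K$ are identified to a single 28-dimensional space, and similarly over $\mathbb L$. **Evaluation of the matrix commutator $VW-WV$ on generators.** (i) Two diagonal matrices over the same algebra: write both in the same language ($D$, $E$ or $F$) and evaluate the entries as left multiplications (the result is again in that language). A diagonal matrix over $\mathbb K$ commutes with every diagonal matrix over $\mathbb L$. (ii) Two off-diagonal matrices of the same type (both $X$, both $Y$ or both $Z$): the diagonal entries are evaluated as left multiplications on $\mathbb K\otimes\mathbb L$ (with $a\otimes A\mapsto L_a\otimes L_A$); so for orthogonal imaginary $p,q$, $pq-qp$ is evaluated as $2\,p\circ q$, and the result is a diagonal matrix in language $D$, $E$ or $F$ respectively. (iii) Two off-diagonal matrices of different types: entries are multiplied in $\mathbb K\otimes\mathbb L$ by $(a\otimes A)(b\otimes B)=ab\otimes AB$. (iv) A diagonal and an off-diagonal matrix: products of an octonion with an entry $a\otimes A$ are octonion products in the relevant tensor factor; a one-sided product with a nested octonion is $(p\circ q)a=p(qa)$ or $a(p\circ q)=(ap)q$; an entry of the form $(p\circ q)a-a(p\circ q)$ (occurring for $D_{p,q}$ with $X$, $E_{p,q}$ with $Y$, $F_{p,q}$ with $Z$) is evaluated as $[p\circ q,a]$, meaning the octonion $c$ with $L_c=L_pL_qL_a-L_aL_pL_q$; thus it is $-2p^2q$ if $a=p$, $2q^2p$ if $a=q$, and $0$ for every other basic unit $a$ (including $a=1$). The other tensor factor is carried along. The same rules apply to $\mathbb L$. *)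

theory Defs
  imports "HOL-Analysis.Analysis"
begin

section \<open>Octonion algebras\<close>

text \<open>
  The two octonion algebras differ only in the sign of the square of the unit written
  \<open>\<ell>\<close>.  That sign is carried by a type parameter: \<open>-1\<close> gives the division
  algebra, \<open>1\<close> the split octonions.
\<close>

class oct_alg =
  fixes ell_sq :: "'a itself \<Rightarrow> real"
  assumes ell_sq_cases: "ell_sq TYPE('a) = - 1 \<or> ell_sq TYPE('a) = 1"

datatype division = Division
datatype split = Split

instantiation division :: oct_alg
begin
definition "ell_sq (_ :: division itself) = (- 1 :: real)"
instance by standard (simp add: ell_sq_division_def)
end

instantiation split :: oct_alg
begin
definition "ell_sq (_ :: split itself) = (1 :: real)"
instance by standard (simp add: ell_sq_split_def)
end

datatype qunit = Q1 | Qi | Qj | Qk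

text \<open>A product of basic units is a sign times a basic unit, returned as a pair.\<close>

fun qmul :: "qunit \<Rightarrow> qunit \<Rightarrow> real \<times> qunit" where
  "qmul Q1 y = (1, y)"
| "qmul x Q1 = (1, x)"
| "qmul Qi Qi = (- 1, Q1)"
| "qmul Qj Qj = (- 1, Q1)"
| "qmul Qk Qk = (- 1, Q1)"
| "qmul Qi Qj = (1, Qk)"
| "qmul Qj Qi = (- 1, Qk)"
| "qmul Qj Qk = (1, Qi)"
| "qmul Qk Qj = (- 1, Qi)"
| "qmul Qk Qi = (1, Qj)"
| "qmul Qi Qk = (- 1, Qj)"

definition qconj :: "qunit \<Rightarrow> real" where
  "qconj x = (if x = Q1 then 1 else - 1)"

text \<open>\<open>Quat x\<close> is the basic unit \<open>x\<close>, and \<open>Ell x\<close> the basic unit \<open>x\<ell>\<close>.\<close>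

datatype 'k ounit = Quat qunit | Ell qunit

fun umul :: "'k::oct_alg ounit \<Rightarrow> 'k ounit \<Rightarrow> real \<times> 'k ounit" where
  "umul (Quat x) (Quat y) = (fst (qmul x y), Quat (snd (qmul x y)))"
| "umul (Quat x) (Ell y) = (fst (qmul y x), Ell (snd (qmul y x)))"
| "umul (Ell x) (Quat y) = (qconj y * fst (qmul x y), Ell (snd (qmul x y)))"
| "umul (Ell x) (Ell y) = (ell_sq TYPE('k) * qconj y * fst (qmul y x), Quat (snd (qmul y x)))"

abbreviation uone :: "'k ounit" where
  "uone \<equiv> Quat Q1"

definition imag_units :: "'k ounit set" where
  "imag_units = UNIV - {uone}"

definition uconj :: "'k ounit \<Rightarrow> real" where
  "uconj a = (if a = uone then 1 else - 1)"

instance qunit :: finite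
proof
  have "(UNIV :: qunit set) = {Q1, Qi, Qj, Qk}"
    using qunit.exhaust by auto
  then show "finite (UNIV :: qunit set)"
    by (metis finite.emptyI finite.insertI)
qed

instance ounit :: (type) finite
proof
  have "a \<in> range Quat \<union> range Ell" for a :: "'a ounit"
    by (cases a) auto
  then have "(UNIV :: 'a ounit set) = range Quat \<union> range Ell"
    by blast
  then show "finite (UNIV :: 'a ounit set)"
    by (metis finite_UnI finite_imageI finite)
qed

section \<open>Tensor products, nested octonions and matrix entries\<close>

text \<open>The tensor product of the two algebras, with basis the pairs \<open>(a, A)\<close> of basic units.\<close>

type_synonym ('k, 'l) tensor = "real ^ ('k ounit \<times> 'l ounit)"

definition tens :: "'k ounit \<Rightarrow> 'l ounit \<Rightarrow> ('k, 'l) tensor" where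
  "tens a A = axis (a, A) 1"

definition tmul ::
  "('k::oct_alg, 'l::oct_alg) tensor \<Rightarrow> ('k, 'l) tensor \<Rightarrow> ('k, 'l) tensor" where
  "tmul s t = (\<Sum>(a, A)\<in>UNIV. \<Sum>(b, B)\<in>UNIV.
     (s $ (a, A) * t $ (b, B) * fst (umul a b) * fst (umul A B))
       *\<^sub>R tens (snd (umul a b)) (snd (umul A B)))"

definition tconj :: "('k, 'l) tensor \<Rightarrow> ('k, 'l) tensor" where
  "tconj t = (\<chi> u. uconj (fst u) * uconj (snd u) * t $ u)"

text \<open>
  Formal nested octonions form the exterior square, realised by antisymmetric arrays.
  With the normalisation chosen here an array \<open>n\<close> stands for the operator
  \<open>\<Sum>p q. n (p, q) L\<^sub>p L\<^sub>q\<close>, so \<open>circ p q\<close> stands for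
  \<open>(L\<^sub>p L\<^sub>q - L\<^sub>q L\<^sub>p) / 2\<close>, which is \<open>L\<^sub>p L\<^sub>q\<close> for distinct imaginary units.
\<close>

type_synonym 'k nested = "real ^ ('k ounit \<times> 'k ounit)"

definition circ :: "'k ounit \<Rightarrow> 'k ounit \<Rightarrow> 'k nested" where
  "circ p q = (1/2) *\<^sub>R (axis (p, q) 1 - axis (q, p) 1)"

text \<open>
  A matrix entry is the formal sum of a tensor, a nested octonion of the first algebra and
  one of the second.
\<close>

type_synonym ('k, 'l) entry = "('k, 'l) tensor \<times> 'k nested \<times> 'l nested"

definition ten_entry :: "('k, 'l) tensor \<Rightarrow> ('k, 'l) entry" where
  "ten_entry t = (t, 0, 0)"

definition octK :: "'k ounit \<Rightarrow> ('k, 'l) entry" where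
  "octK p = ten_entry (tens p uone)"

definition octL :: "'l ounit \<Rightarrow> ('k, 'l) entry" where
  "octL P = ten_entry (tens uone P)"

definition nestK :: "'k ounit \<Rightarrow> 'k ounit \<Rightarrow> ('k, 'l) entry" where
  "nestK p q = (0, circ p q, 0)"

definition nestL :: "'l ounit \<Rightarrow> 'l ounit \<Rightarrow> ('k, 'l) entry" where
  "nestL P Q = (0, 0, circ P Q)"

text \<open>
  \<open>lact e\<close> is the entry \<open>e\<close> evaluated as a left multiplication on the tensor product; on a
  tensor \<open>t\<close> it is also the one-sided product \<open>e t\<close>, in particular \<open>(p \<circ> q) a = p (q a)\<close>.
  \<open>ract t e\<close> is the one-sided product \<open>t e\<close>, with \<open>a (p \<circ> q) = (a p) q\<close>.
\<close>

definition lact ::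
  "('k::oct_alg, 'l::oct_alg) entry \<Rightarrow> ('k, 'l) tensor \<Rightarrow> ('k, 'l) tensor" where
  "lact e t = (case e of (s, n, m) \<Rightarrow>
     tmul s t
     + (\<Sum>(p, q)\<in>UNIV. n $ (p, q) *\<^sub>R tmul (tens p uone) (tmul (tens q uone) t))
     + (\<Sum>(P, Q)\<in>UNIV. m $ (P, Q) *\<^sub>R tmul (tens uone P) (tmul (tens uone Q) t)))"

definition ract ::
  "('k::oct_alg, 'l::oct_alg) tensor \<Rightarrow> ('k, 'l) entry \<Rightarrow> ('k, 'l) tensor" where
  "ract t e = (case e of (s, n, m) \<Rightarrow>
     tmul t s
     + (\<Sum>(p, q)\<in>UNIV. n $ (p, q) *\<^sub>R tmul (tmul t (tens p uone)) (tens q uone))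
     + (\<Sum>(P, Q)\<in>UNIV. m $ (P, Q) *\<^sub>R tmul (tmul t (tens uone P)) (tens uone Q)))"

section \<open>The matrices and the triality relations\<close>

type_synonym ('k, 'l) mat = "('k, 'l) entry ^ 3 ^ 3"

abbreviation mat3 :: "'a::zero \<Rightarrow> 'a \<Rightarrow> 'a \<Rightarrow> 'a \<Rightarrow> 'a \<Rightarrow> 'a \<Rightarrow> 'a \<Rightarrow> 'a \<Rightarrow> 'a \<Rightarrow> 'a ^ 3 ^ 3" where
  "mat3 a b c d e f g h i \<equiv> vector [vector [a, b, c], vector [d, e, f], vector [g, h, i]]"

text \<open>
  The language \<open>LD\<close> goes with the off-diagonal type X, \<open>LE\<close> with Y and \<open>LF\<close> with Z.
\<close>

datatype lang = LD | LE | LF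

fun off :: "lang \<Rightarrow> ('k, 'l) tensor \<Rightarrow> ('k, 'l) mat" where
  "off LD t = mat3 0 (ten_entry t) 0
                   (- ten_entry (tconj t)) 0 0
                   0 0 0"
| "off LE t = mat3 0 0 0
                   0 0 (ten_entry t)
                   0 (- ten_entry (tconj t)) 0"
| "off LF t = mat3 0 0 (- ten_entry (tconj t))
                   0 0 0
                   (ten_entry t) 0 0"

abbreviation diag3 :: "'a::zero \<Rightarrow> 'a \<Rightarrow> 'a \<Rightarrow> 'a ^ 3 ^ 3" where
  "diag3 x y z \<equiv> mat3 x 0 0  0 y 0  0 0 z"

text \<open>
  \<open>sdiag\<close> has the sign pattern of the diagonal matrices with octonion entries (one subscript),
  \<open>ndiag\<close> that of the ones with nested entries (two subscripts).
\<close>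

fun sdiag :: "lang \<Rightarrow> ('k, 'l) entry \<Rightarrow> ('k, 'l) mat" where
  "sdiag LD x = diag3 x (- x) 0"
| "sdiag LE x = diag3 0 x (- x)"
| "sdiag LF x = diag3 (- x) 0 x"

fun ndiag :: "lang \<Rightarrow> ('k, 'l) entry \<Rightarrow> ('k, 'l) mat" where
  "ndiag LD x = diag3 x x 0"
| "ndiag LE x = diag3 0 x x"
| "ndiag LF x = diag3 x 0 x"

text \<open>
  The definitions below serve both algebras: \<open>oct\<close> and \<open>nest\<close> are \<open>octK\<close>, \<open>nestK\<close> or
  \<open>octL\<close>, \<open>nestL\<close>.
\<close>

definition diag_gens ::
  "('u ounit \<Rightarrow> ('k, 'l) entry) \<Rightarrow> ('u ounit \<Rightarrow> 'u ounit \<Rightarrow> ('k, 'l) entry)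
    \<Rightarrow> lang \<Rightarrow> ('k, 'l) mat set" where
  "diag_gens oct nest l =
     {sdiag l (oct p) |p. p \<in> imag_units}
     \<union> {ndiag l (nest p q) |p q. p \<in> imag_units \<and> q \<in> imag_units \<and> p \<noteq> q}"

definition off_gens :: "('k, 'l) mat set" where
  "off_gens = {off l (tens a A) |l a A. True}"

definition mats :: "('k, 'l) mat set" where
  "mats = span (off_gens \<union> (\<Union>l. diag_gens octK nestK l) \<union> (\<Union>l. diag_gens octL nestL l))"

text \<open>
  The pairs \<open>(p, q)\<close> with \<open>p q = - r\<close>: for an imaginary unit \<open>r\<close> there are exactly three, one for
  each unordered pair with product \<open>\<plusminus>r\<close>.
\<close>

definition tri_pairs :: "'u::oct_alg ounit \<Rightarrow> ('u ounit \<times> 'u ounit) set" where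
  "tri_pairs r = {(p, q). p \<in> imag_units \<and> q \<in> imag_units \<and> umul p q = (- 1, r)}"

definition tri_rels ::
  "('u::oct_alg ounit \<Rightarrow> ('k, 'l) entry) \<Rightarrow> ('u ounit \<Rightarrow> 'u ounit \<Rightarrow> ('k, 'l) entry)
    \<Rightarrow> ('k, 'l) mat set" where
  "tri_rels oct nest =
     {sdiag LE (oct r)
        - (1/2) *\<^sub>R (- sdiag LD (oct r) - (\<Sum>(p, q)\<in>tri_pairs r. ndiag LD (nest p q)))
      |r. r \<in> imag_units}
   \<union> {sdiag LF (oct r)
        - (1/2) *\<^sub>R (- sdiag LD (oct r) + (\<Sum>(p, q)\<in>tri_pairs r. ndiag LD (nest p q)))
      |r. r \<in> imag_units}
   \<union> {ndiag LE (nest p q)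
        - (1/2) *\<^sub>R (sdiag LD (oct r) + ndiag LD (nest p q)
            - (\<Sum>(p', q')\<in>tri_pairs r - {(p, q)}. ndiag LD (nest p' q')))
      |r p q. r \<in> imag_units \<and> (p, q) \<in> tri_pairs r}
   \<union> {ndiag LF (nest p q)
        - (1/2) *\<^sub>R (- sdiag LD (oct r) + ndiag LD (nest p q)
            - (\<Sum>(p', q')\<in>tri_pairs r - {(p, q)}. ndiag LD (nest p' q')))
      |r p q. r \<in> imag_units \<and> (p, q) \<in> tri_pairs r}"

definition triality :: "('k::oct_alg, 'l::oct_alg) mat set" where
  "triality = span (tri_rels octK nestK \<union> tri_rels octL nestL)"

definition mat_eq :: "('k::oct_alg, 'l::oct_alg) mat \<Rightarrow> ('k, 'l) mat \<Rightarrow> bool" where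
  "mat_eq V W \<longleftrightarrow> V \<in> mats \<and> W \<in> mats \<and> V - W \<in> triality"

lemma part_equivp_mat_eq:
  "part_equivp (mat_eq :: ('k::oct_alg, 'l::oct_alg) mat \<Rightarrow> ('k, 'l) mat \<Rightarrow> bool)"
proof (rule part_equivpI)
  show "\<exists>V :: ('k, 'l) mat. mat_eq V V"
    by (rule exI [of _ 0]) (simp add: mat_eq_def mats_def triality_def span_zero)
  show "symp (mat_eq :: ('k, 'l) mat \<Rightarrow> ('k, 'l) mat \<Rightarrow> bool)"
  proof (rule sympI)
    fix V W :: "('k, 'l) mat"
    assume h: "mat_eq V W"
    then have "- (V - W) \<in> triality"
      unfolding mat_eq_def triality_def by (blast intro: span_neg)
    with h show "mat_eq W V"
      by (simp add: mat_eq_def)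
  qed
  show "transp (mat_eq :: ('k, 'l) mat \<Rightarrow> ('k, 'l) mat \<Rightarrow> bool)"
  proof (rule transpI)
    fix U V W :: "('k, 'l) mat"
    assume h: "mat_eq U V" "mat_eq V W"
    then have "(U - V) + (V - W) \<in> triality"
      unfolding mat_eq_def triality_def by (blast intro: span_add)
    with h show "mat_eq U W"
      by (simp add: mat_eq_def)
  qed
qed

lemma mat_eq_zero: "mat_eq 0 0"
  by (simp add: mat_eq_def mats_def triality_def span_zero)

lemma mat_eq_add:
  assumes "mat_eq V V'" "mat_eq W W'"
  shows "mat_eq (V + W) (V' + W')"
proof -
  have "(V - V') + (W - W') \<in> triality"
    using assms unfolding mat_eq_def triality_def by (blast intro: span_add)
  then show ?thesis
    using assms by (simp add: mat_eq_def mats_def span_add add_diff_add)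
qed

lemma mat_eq_scaleR:
  assumes "mat_eq V V'"
  shows "mat_eq (x *\<^sub>R V) (x *\<^sub>R V')"
proof -
  have "x *\<^sub>R (V - V') \<in> triality"
    using assms unfolding mat_eq_def triality_def by (blast intro: span_scale)
  then show ?thesis
    using assms by (simp add: mat_eq_def mats_def span_scale scaleR_diff_right)
qed

lemma mat_eq_uminus:
  assumes "mat_eq V V'"
  shows "mat_eq (- V) (- V')"
  using mat_eq_scaleR [OF assms, of "- 1"] by simp

lemma mat_eq_diff:
  assumes "mat_eq V V'" "mat_eq W W'"
  shows "mat_eq (V - W) (V' - W')"
  using mat_eq_add [OF assms(1) mat_eq_uminus [OF assms(2)]] by simp

text \<open>The space of matrices modulo the triality relations.\<close>

quotient_type (overloaded) ('k, 'l) tri_mat = "('k::oct_alg, 'l::oct_alg) mat" / partial: mat_eq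
  by (rule part_equivp_mat_eq)

lemma tri_mat_obtain:
  obtains V where "V \<in> mats" "x = abs_tri_mat V"
  using Quotient3_rep_reflp [OF Quotient3_tri_mat, of x]
    Quotient3_abs_rep [OF Quotient3_tri_mat, of x]
  unfolding mat_eq_def by metis

lemma mat_eq_refl: "V \<in> mats \<Longrightarrow> mat_eq V V"
  by (simp add: mat_eq_def triality_def span_zero)

lemma abs_tri_mat_eqI: "mat_eq V W \<Longrightarrow> abs_tri_mat V = abs_tri_mat W"
  by (rule Quotient3_rel_abs [OF Quotient3_tri_mat])

lemma mat_eq_rep_abs: "V \<in> mats \<Longrightarrow> mat_eq (rep_tri_mat (abs_tri_mat V)) V"
  by (rule rep_abs_rsp_left [OF Quotient3_tri_mat]) (rule mat_eq_refl)

instantiation tri_mat :: (oct_alg, oct_alg) real_vector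
begin

definition zero_tri_mat :: "('a, 'b) tri_mat" where
  "0 = abs_tri_mat 0"

definition plus_tri_mat :: "('a, 'b) tri_mat \<Rightarrow> ('a, 'b) tri_mat \<Rightarrow> ('a, 'b) tri_mat" where
  "x + y = abs_tri_mat (rep_tri_mat x + rep_tri_mat y)"

definition uminus_tri_mat :: "('a, 'b) tri_mat \<Rightarrow> ('a, 'b) tri_mat" where
  "- x = abs_tri_mat (- rep_tri_mat x)"

definition minus_tri_mat :: "('a, 'b) tri_mat \<Rightarrow> ('a, 'b) tri_mat \<Rightarrow> ('a, 'b) tri_mat" where
  "x - y = abs_tri_mat (rep_tri_mat x - rep_tri_mat y)"

definition scaleR_tri_mat :: "real \<Rightarrow> ('a, 'b) tri_mat \<Rightarrow> ('a, 'b) tri_mat" where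
  "c *\<^sub>R x = abs_tri_mat (c *\<^sub>R rep_tri_mat x)"

lemma mats_closed:
  fixes V W :: "('k, 'l) mat"
  shows "(0 :: ('k, 'l) mat) \<in> mats" "V \<in> mats \<Longrightarrow> W \<in> mats \<Longrightarrow> V + W \<in> mats"
    "V \<in> mats \<Longrightarrow> W \<in> mats \<Longrightarrow> V - W \<in> mats" "V \<in> mats \<Longrightarrow> - V \<in> mats"
    "V \<in> mats \<Longrightarrow> c *\<^sub>R V \<in> mats"
  unfolding mats_def by (auto intro: span_zero span_add span_diff span_neg span_scale)

lemma abs_tri_mat_simps:
  fixes V W :: "('a, 'b) mat"
  assumes "V \<in> mats"
  shows "W \<in> mats \<Longrightarrow> abs_tri_mat V + abs_tri_mat W = abs_tri_mat (V + W)"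
    and "W \<in> mats \<Longrightarrow> abs_tri_mat V - abs_tri_mat W = abs_tri_mat (V - W)"
    and "- abs_tri_mat V = abs_tri_mat (- V)"
    and "c *\<^sub>R abs_tri_mat V = abs_tri_mat (c *\<^sub>R V)"
  unfolding plus_tri_mat_def minus_tri_mat_def uminus_tri_mat_def scaleR_tri_mat_def
  using assms by (auto intro!: abs_tri_mat_eqI mat_eq_add mat_eq_diff mat_eq_uminus
      mat_eq_scaleR mat_eq_rep_abs)

instance
proof
  fix x y z :: "('a, 'b) tri_mat" and c d :: real
  obtain U where U: "U \<in> mats" "x = abs_tri_mat U" by (rule tri_mat_obtain)
  obtain V where V: "V \<in> mats" "y = abs_tri_mat V" by (rule tri_mat_obtain)
  obtain W where W: "W \<in> mats" "z = abs_tri_mat W" by (rule tri_mat_obtain)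
  note [simp] = U V W mats_closed abs_tri_mat_simps zero_tri_mat_def
  show "x + y + z = x + (y + z)" by (simp add: add.assoc)
  show "x + y = y + x" by (simp add: add.commute)
  show "0 + x = x" by simp
  show "- x + x = 0" by simp
  show "x - y = x + - y" by simp
  show "c *\<^sub>R (x + y) = c *\<^sub>R x + c *\<^sub>R y" by (simp add: scaleR_add_right)
  show "(c + d) *\<^sub>R x = c *\<^sub>R x + d *\<^sub>R x" by (simp add: scaleR_add_left)
  show "c *\<^sub>R d *\<^sub>R x = (c * d) *\<^sub>R x" by simp
  show "1 *\<^sub>R x = x" by simp
qed

end

section \<open>The product\<close>

text \<open>
  Two ways of evaluating \<open>V W - W V\<close> entrywise.  In \<open>left_comm\<close> every entry is read as a left
  multiplication, and \<open>U\<close> is a matrix whose entries evaluate to the entries of the commutator.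
  In \<open>oct_comm\<close> the products of entries are octonion products and one-sided products with
  nested octonions; it is applied only to an off-diagonal matrix together with a diagonal matrix
  or with an off-diagonal matrix of another type, where in each product of entries at
  least one factor is a tensor.
\<close>

definition left_comm ::
  "('k::oct_alg, 'l::oct_alg) mat \<Rightarrow> ('k, 'l) mat \<Rightarrow> ('k, 'l) mat \<Rightarrow> bool" where
  "left_comm V W U \<longleftrightarrow> (\<forall>r c t. lact (U $ r $ c) t =
     (\<Sum>k\<in>UNIV. lact (V $ r $ k) (lact (W $ k $ c) t) - lact (W $ r $ k) (lact (V $ k $ c) t)))"

definition emul ::
  "('k::oct_alg, 'l::oct_alg) entry \<Rightarrow> ('k, 'l) entry \<Rightarrow> ('k, 'l) entry" where
  "emul x y = ten_entry (if snd x = 0 then ract (fst x) y else lact x (fst y))"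

definition oct_comm ::
  "('k::oct_alg, 'l::oct_alg) mat \<Rightarrow> ('k, 'l) mat \<Rightarrow> ('k, 'l) mat" where
  "oct_comm V W = (\<chi> r c. \<Sum>k\<in>UNIV.
     emul (V $ r $ k) (W $ k $ c) - emul (W $ r $ k) (V $ k $ c))"

text \<open>
  \<open>commutator V W U\<close>: the commutator of the matrices \<open>V\<close> and \<open>W\<close> can be evaluated to \<open>U\<close>.
  Commutators of diagonal matrices over the same algebra are only evaluated in a common language.
  In \<open>nest_off_same\<close> the nonzero entries of the commutator have the form
  \<open>(p \<circ> q) a - a (p \<circ> q)\<close> and evaluate to the \<open>c\<close> with
  \<open>L\<^sub>c = L\<^sub>p L\<^sub>q L\<^sub>a - L\<^sub>a L\<^sub>p L\<^sub>q\<close>.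
\<close>

inductive commutator ::
  "('k::oct_alg, 'l::oct_alg) mat \<Rightarrow> ('k, 'l) mat \<Rightarrow> ('k, 'l) mat \<Rightarrow> bool" where
  diag_K: "V \<in> diag_gens octK nestK l \<Longrightarrow> W \<in> diag_gens octK nestK l \<Longrightarrow>
    U \<in> span (diag_gens octK nestK l) \<Longrightarrow> left_comm V W U \<Longrightarrow> commutator V W U"
| diag_L: "V \<in> diag_gens octL nestL l \<Longrightarrow> W \<in> diag_gens octL nestL l \<Longrightarrow>
    U \<in> span (diag_gens octL nestL l) \<Longrightarrow> left_comm V W U \<Longrightarrow> commutator V W U"
| diag_K_L: "V \<in> diag_gens octK nestK l \<Longrightarrow> W \<in> diag_gens octL nestL m \<Longrightarrow>
    commutator V W 0"
| off_same: "U \<in> span (diag_gens octK nestK l \<union> diag_gens octL nestL l) \<Longrightarrow>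
    left_comm (off l (tens a A)) (off l (tens b B)) U \<Longrightarrow>
    commutator (off l (tens a A)) (off l (tens b B)) U"
| off_other: "l \<noteq> m \<Longrightarrow>
    commutator (off l (tens a A)) (off m (tens b B))
      (oct_comm (off l (tens a A)) (off m (tens b B)))"
| oct_off: "V \<in> {sdiag l (octK p) |p. p \<in> imag_units} \<union> {sdiag l (octL P) |P. P \<in> imag_units} \<Longrightarrow>
    commutator V (off m (tens a A)) (oct_comm V (off m (tens a A)))"
| nest_off_other: "V \<in> {ndiag l (nestK p q) |p q. p \<in> imag_units \<and> q \<in> imag_units \<and> p \<noteq> q}
      \<union> {ndiag l (nestL P Q) |P Q. P \<in> imag_units \<and> Q \<in> imag_units \<and> P \<noteq> Q} \<Longrightarrow> l \<noteq> m \<Longrightarrow>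
    commutator V (off m (tens a A)) (oct_comm V (off m (tens a A)))"
| nest_off_same: "V \<in> {ndiag l (nestK p q) |p q. p \<in> imag_units \<and> q \<in> imag_units \<and> p \<noteq> q}
      \<union> {ndiag l (nestL P Q) |P Q. P \<in> imag_units \<and> Q \<in> imag_units \<and> P \<noteq> Q} \<Longrightarrow>
    U \<in> range (off l) \<Longrightarrow> left_comm V (off l (tens a A)) U \<Longrightarrow>
    commutator V (off l (tens a A)) U"
| antisym: "commutator V W U \<Longrightarrow> commutator W V (- U)"
| scale: "commutator V W U \<Longrightarrow> commutator (x *\<^sub>R V) W (x *\<^sub>R U)"
| add: "commutator V W U \<Longrightarrow> commutator V' W U' \<Longrightarrow> commutator (V + V') W (U + U')"

text \<open>
  \<open>product_value v w u\<close>: for some matrices representing \<open>v\<close> and \<open>w\<close>, some evaluation of their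
  commutator represents \<open>u\<close>.  The product is well defined if \<open>u\<close> is determined by \<open>v\<close> and \<open>w\<close>.
\<close>

definition product_value ::
  "('k::oct_alg, 'l::oct_alg) tri_mat \<Rightarrow> ('k, 'l) tri_mat \<Rightarrow> ('k, 'l) tri_mat \<Rightarrow> bool" where
  "product_value v w u \<longleftrightarrow> (\<exists>V\<in>mats. \<exists>W\<in>mats. \<exists>U\<in>mats. commutator V W U \<and>
     v = abs_tri_mat V \<and> w = abs_tri_mat W \<and> u = abs_tri_mat U)"

definition tri_bracket ::
  "('k::oct_alg, 'l::oct_alg) tri_mat \<Rightarrow> ('k, 'l) tri_mat \<Rightarrow> ('k, 'l) tri_mat" where
  "tri_bracket v w = (THE u. product_value v w u)"

section \<open>Lie algebras\<close>

definition lie_algebra :: "('v::real_vector \<Rightarrow> 'v \<Rightarrow> 'v) \<Rightarrow> bool" where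
  "lie_algebra br \<longleftrightarrow> bilinear br \<and> (\<forall>x. br x x = 0) \<and>
     (\<forall>x y z. br x (br y z) + br y (br z x) + br z (br x y) = 0)"

text \<open>Isomorphism of algebras over a field, given by their scalar multiplications and products.\<close>

definition lie_isomorphic ::
  "('f::field \<Rightarrow> 'v::ab_group_add \<Rightarrow> 'v) \<Rightarrow> ('v \<Rightarrow> 'v \<Rightarrow> 'v)
    \<Rightarrow> ('f \<Rightarrow> 'w::ab_group_add \<Rightarrow> 'w) \<Rightarrow> ('w \<Rightarrow> 'w \<Rightarrow> 'w) \<Rightarrow> bool" where
  "lie_isomorphic s1 br1 s2 br2 \<longleftrightarrow>
     (\<exists>\<phi>. Vector_Spaces.linear s1 s2 \<phi> \<and> bij \<phi> \<and> (\<forall>x y. \<phi> (br1 x y) = br2 (\<phi> x) (\<phi> y)))"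

text \<open>Complexification, with \<open>(x, y)\<close> standing for \<open>x + \<i> y\<close>.\<close>

definition cplx_scale :: "complex \<Rightarrow> 'v::real_vector \<times> 'v \<Rightarrow> 'v \<times> 'v" where
  "cplx_scale c z = (Re c *\<^sub>R fst z - Im c *\<^sub>R snd z, Re c *\<^sub>R snd z + Im c *\<^sub>R fst z)"

definition cplx_bracket ::
  "('v::real_vector \<Rightarrow> 'v \<Rightarrow> 'v) \<Rightarrow> 'v \<times> 'v \<Rightarrow> 'v \<times> 'v \<Rightarrow> 'v \<times> 'v" where
  "cplx_bracket br z w =
     (br (fst z) (fst w) - br (snd z) (snd w), br (fst z) (snd w) + br (snd z) (fst w))"

definition endo_trace :: "('v::real_vector \<Rightarrow> 'v) \<Rightarrow> real" where
  "endo_trace f = (let B = extend_basis {} in \<Sum>b\<in>B. representation B (f b) b)"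

definition killing :: "('v::real_vector \<Rightarrow> 'v \<Rightarrow> 'v) \<Rightarrow> 'v \<Rightarrow> 'v \<Rightarrow> real" where
  "killing br x y = endo_trace (\<lambda>z. br x (br y z))"

text \<open>
  The character of a real semisimple Lie algebra is the signature of its Killing form: the number
  of positive minus the number of negative squares.
\<close>

definition has_character :: "('v::real_vector \<Rightarrow> 'v \<Rightarrow> 'v) \<Rightarrow> int \<Rightarrow> bool" where
  "has_character br k \<longleftrightarrow> (\<exists>P N. subspace P \<and> subspace N \<and> P \<inter> N = {0} \<and>
     {x + y |x y. x \<in> P \<and> y \<in> N} = UNIV \<and>
     (\<forall>x\<in>P. \<forall>y\<in>N. killing br x y = 0) \<and>
     (\<forall>x\<in>P. x \<noteq> 0 \<longrightarrow> killing br x x > 0) \<and>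
     (\<forall>x\<in>N. x \<noteq> 0 \<longrightarrow> killing br x x < 0) \<and>
     int (dim P) - int (dim N) = k)"

section \<open>The Lie algebra of type E8 and its real forms\<close>

text \<open>
  Elements of the root lattice are given by their coordinates with respect to the simple roots
  \<open>\<alpha>\<^sub>1, \<dots>, \<alpha>\<^sub>8\<close>, numbered as in Bourbaki; the edges of the Dynkin diagram are 1-3, 3-4, 2-4,
  4-5, 5-6, 6-7, 7-8.  The bilinear form \<open>e8_half\<close> comes from orienting these edges:
  its symmetrisation \<open>e8_form\<close> has the Cartan matrix as Gram matrix, and
  \<open>(-1) ^ e8_half a b\<close> is the corresponding bimultiplicative cocycle.
\<close>

type_synonym root_lattice = "int ^ 8"

definition e8_half :: "root_lattice \<Rightarrow> root_lattice \<Rightarrow> int" where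
  "e8_half a b = (\<Sum>i\<in>UNIV. a $ i * b $ i)
     - (a $ 1 * b $ 3 + a $ 3 * b $ 4 + a $ 2 * b $ 4 + a $ 4 * b $ 5
        + a $ 5 * b $ 6 + a $ 6 * b $ 7 + a $ 7 * b $ 8)"

definition e8_form :: "root_lattice \<Rightarrow> root_lattice \<Rightarrow> int" where
  "e8_form a b = e8_half a b + e8_half b a"

definition e8_cocycle :: "root_lattice \<Rightarrow> root_lattice \<Rightarrow> int" where
  "e8_cocycle a b = (if even (e8_half a b) then 1 else - 1)"

lemma UNIV_8: "(UNIV :: 8 set) = {1, 2, 3, 4, 5, 6, 7, 8}"
proof -
  have "card {1, 2, 3, 4, 5, 6, 7, 8 :: 8} = CARD(8)"
    by simp
  then show ?thesis
    by (metis card_subset_eq finite subset_UNIV)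
qed

lemma e8_form_bounded:
  assumes "e8_form a a = 2"
  shows "\<bar>a $ i\<bar> \<le> 12"
proof -
  define x where "x = (\<lambda>k :: 8. a $ k)"
  have half: "e8_half a a = 1"
    using assms by (simp add: e8_form_def)
  have bnd: "\<bar>y\<bar> < c" if "y * y < c * c" "0 < c" for y c :: int
  proof (rule ccontr)
    assume "\<not> \<bar>y\<bar> < c"
    then have "c * c \<le> \<bar>y\<bar> * \<bar>y\<bar>"
      using that(2) by (intro mult_mono) auto
    with that(1) show False
      by (simp add: abs_mult_self_eq)
  qed
  have sq: "30 * ((2 * x 1 - x 3) * (2 * x 1 - x 3)) + 30 * ((2 * x 2 - x 4) * (2 * x 2 - x 4))
      + 10 * ((3 * x 3 - 2 * x 4) * (3 * x 3 - 2 * x 4))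
      + 2 * ((5 * x 4 - 6 * x 5) * (5 * x 4 - 6 * x 5))
      + 3 * ((4 * x 5 - 5 * x 6) * (4 * x 5 - 5 * x 6))
      + 5 * ((3 * x 6 - 4 * x 7) * (3 * x 6 - 4 * x 7))
      + 10 * ((2 * x 7 - 3 * x 8) * (2 * x 7 - 3 * x 8)) + 30 * (x 8 * x 8) = 120"
    using half unfolding e8_half_def UNIV_8 x_def by (simp add: algebra_simps)
  have nn: "0 \<le> y * y" for y :: int
    by simp
  note nns = nn [of "2 * x 1 - x 3"] nn [of "2 * x 2 - x 4"] nn [of "3 * x 3 - 2 * x 4"]
    nn [of "5 * x 4 - 6 * x 5"] nn [of "4 * x 5 - 5 * x 6"] nn [of "3 * x 6 - 4 * x 7"]
    nn [of "2 * x 7 - 3 * x 8"] nn [of "x 8"]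
  have c8: "\<bar>x 8\<bar> < 3" by (rule bnd) (use sq nns in linarith)+
  have c7: "\<bar>2 * x 7 - 3 * x 8\<bar> < 4" by (rule bnd) (use sq nns in linarith)+
  have c6: "\<bar>3 * x 6 - 4 * x 7\<bar> < 5" by (rule bnd) (use sq nns in linarith)+
  have c5: "\<bar>4 * x 5 - 5 * x 6\<bar> < 7" by (rule bnd) (use sq nns in linarith)+
  have c4: "\<bar>5 * x 4 - 6 * x 5\<bar> < 8" by (rule bnd) (use sq nns in linarith)+
  have c3: "\<bar>3 * x 3 - 2 * x 4\<bar> < 4" by (rule bnd) (use sq nns in linarith)+
  have c2: "\<bar>2 * x 2 - x 4\<bar> < 3" by (rule bnd) (use sq nns in linarith)+
  have c1: "\<bar>2 * x 1 - x 3\<bar> < 3" by (rule bnd) (use sq nns in linarith)+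
  have b8: "\<bar>x 8\<bar> \<le> 2" using c8 by linarith
  have b7: "\<bar>x 7\<bar> \<le> 4" using c7 b8 by linarith
  have b6: "\<bar>x 6\<bar> \<le> 6" using c6 b7 by linarith
  have b5: "\<bar>x 5\<bar> \<le> 9" using c5 b6 by linarith
  have b4: "\<bar>x 4\<bar> \<le> 12" using c4 b5 by linarith
  have b3: "\<bar>x 3\<bar> \<le> 9" using c3 b4 by linarith
  have b2: "\<bar>x 2\<bar> \<le> 7" using c2 b4 by linarith
  have b1: "\<bar>x 1\<bar> \<le> 5" using c1 b3 by linarith
  have "i \<in> {1, 2, 3, 4, 5, 6, 7, 8}"
    using UNIV_8 by blast
  then show ?thesis
    using b1 b2 b3 b4 b5 b6 b7 b8 unfolding x_def by auto
qed

typedef e8_root = "{a :: root_lattice. e8_form a a = 2}" morphisms rt Abs_e8_root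
proof
  show "axis 1 1 \<in> {a :: root_lattice. e8_form a a = 2}"
    by (simp add: e8_form_def e8_half_def axis_def if_distrib cong: if_cong)
qed

instance e8_root :: finite
proof
  have "range rt \<subseteq> vec_lambda ` (UNIV \<rightarrow>\<^sub>E {-12..12})"
  proof
    fix a assume "a \<in> range rt"
    then have "\<bar>a $ i\<bar> \<le> 12" for i
      using rt e8_form_bounded by blast
    then have "vec_nth a \<in> UNIV \<rightarrow>\<^sub>E {-12..12}"
      by (auto simp: PiE_def abs_le_iff) (metis minus_le_iff)
    then show "a \<in> vec_lambda ` (UNIV \<rightarrow>\<^sub>E {-12..12})"
      by (metis image_eqI vec_nth_inverse)
  qed
  then have "finite (range rt)"
    by (rule finite_subset) (intro finite_imageI finite_PiE; simp)
  then show "finite (UNIV :: e8_root set)"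
    by (rule finite_imageD) (simp add: inj_on_def rt_inject)
qed

text \<open>
  The Chevalley construction for the simply laced root system E8 over a field: the direct sum
  of the Cartan subalgebra, with basis the simple roots, and of the lines spanned by root
  vectors \<open>E\<^sub>\<alpha>\<close>, with
  \<open>[h, E\<^sub>\<alpha>] = (\<alpha>|h) E\<^sub>\<alpha>\<close>, \<open>[E\<^sub>\<alpha>, E\<^sub>-\<^sub>\<alpha>] = -\<alpha>\<close>, and \<open>[E\<^sub>\<alpha>, E\<^sub>\<beta>] = \<epsilon>(\<alpha>, \<beta>) E\<^sub>\<alpha>\<^sub>+\<^sub>\<beta>\<close>
  if \<open>\<alpha> + \<beta>\<close> is a root (Kac, Infinite dimensional Lie algebras, section 7.8).  Over the complex
  numbers this is the complex simple Lie algebra of type E8, over the reals its split real form.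
\<close>

type_synonym 'f e8_alg = "('f ^ 8) \<times> ('f ^ e8_root)"

definition e8_scale :: "'f::field \<Rightarrow> 'f e8_alg \<Rightarrow> 'f e8_alg" where
  "e8_scale c x = (c *s fst x, c *s snd x)"

definition e8_eval :: "'f::field ^ 8 \<Rightarrow> e8_root \<Rightarrow> 'f" where
  "e8_eval h \<alpha> = (\<Sum>i\<in>UNIV. h $ i * of_int (e8_form (axis i 1) (rt \<alpha>)))"

definition e8_bracket :: "'f::field e8_alg \<Rightarrow> 'f e8_alg \<Rightarrow> 'f e8_alg" where
  "e8_bracket x y =
     (\<chi> i. - (\<Sum>(\<alpha>, \<beta>)\<in>{(\<alpha>, \<beta>). rt \<alpha> + rt \<beta> = 0}.
           snd x $ \<alpha> * snd y $ \<beta> * of_int (rt \<alpha> $ i)),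
      \<chi> \<gamma>. e8_eval (fst x) \<gamma> * snd y $ \<gamma> - e8_eval (fst y) \<gamma> * snd x $ \<gamma>
        + (\<Sum>(\<alpha>, \<beta>)\<in>{(\<alpha>, \<beta>). rt \<alpha> + rt \<beta> = rt \<gamma>}.
             of_int (e8_cocycle (rt \<alpha>) (rt \<beta>)) * snd x $ \<alpha> * snd y $ \<beta>))"

definition real_form_e8 :: "('v::real_vector \<Rightarrow> 'v \<Rightarrow> 'v) \<Rightarrow> bool" where
  "real_form_e8 br \<longleftrightarrow> lie_algebra br \<and>
     lie_isomorphic cplx_scale (cplx_bracket br)
       e8_scale (e8_bracket :: complex e8_alg \<Rightarrow> complex e8_alg \<Rightarrow> complex e8_alg)"

text \<open>
  A real form of \<open>e\<^sub>8\<close> is determined up to isomorphism by being compact, split, or of a given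
  character, so the following predicates describe the isomorphism classes of the
  compact form, the split form, and the form \<open>e\<^sub>8\<^sub>(\<^sub>-\<^sub>2\<^sub>4\<^sub>)\<close>.
\<close>

definition compact_e8 :: "('v::real_vector \<Rightarrow> 'v \<Rightarrow> 'v) \<Rightarrow> bool" where
  "compact_e8 br \<longleftrightarrow> real_form_e8 br \<and> (\<forall>x. x \<noteq> 0 \<longrightarrow> killing br x x < 0)"

definition split_e8 :: "('v::real_vector \<Rightarrow> 'v \<Rightarrow> 'v) \<Rightarrow> bool" where
  "split_e8 br \<longleftrightarrow> lie_algebra br \<and>
     lie_isomorphic (*\<^sub>R) br
       e8_scale (e8_bracket :: real e8_alg \<Rightarrow> real e8_alg \<Rightarrow> real e8_alg)"

definition e8_minus24 :: "('v::real_vector \<Rightarrow> 'v \<Rightarrow> 'v) \<Rightarrow> bool" where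
  "e8_minus24 br \<longleftrightarrow> real_form_e8 br \<and> has_character br (- 24)"

end

theory Submission
  imports Defs
begin

text \<open>
  Over a field containing square roots \<open>w\<close>, \<open>v\<close> of the two values of \<open>\<ell>\<^sup>2\<close>, each octonion algebra has a
  basis of null elements \<open>(x \<plusminus> x\<ell>/w)/2\<close>.  In this basis the matrices of types X, Y and Z become root
  vectors for the 192 roots of \<open>e\<^sub>8\<close> outside \<open>d\<^sub>4 + d\<^sub>4\<close>, with octonion multiplication giving the
  structure constants between different types.  Products of two matrices of the same type give the
  diagonal matrices, and an element of \<open>e\<^sub>8\<close> that centralizes all matrices of one type is zero.  Hence
  the triality relations hold in \<open>e\<^sub>8\<close>, and every evaluation of a commutator, being determined by its
  action on one type, is mapped to the bracket of \<open>e\<^sub>8\<close>.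

  A basis of 248 matrices is mapped to elements that are orthogonal for the invariant form, so that the map is
  injective on the quotient space, whence well-definedness and the Jacobi identity.  The image contains
  combinations of the simple root vectors over the field of \<open>w\<close> and \<open>v\<close> and so generates \<open>e\<^sub>8\<close>: over the
  complex numbers this identifies the complexification, and in the split case one may take \<open>w = v = 1\<close> over
  the reals.

  Replacing \<open>w\<close> and \<open>v\<close> by \<open>- \<ell>\<^sup>2 w\<close> and \<open>- \<ell>\<^sup>2 v\<close> multiplies every basis element by its norm, which is \<open>\<plusminus>1\<close>.
  This is an involutive automorphism under which the invariant form becomes definite, so it is a Cartan involution,
  and the character is obtained by counting basis elements of norm \<open>-1\<close>: there are 112 in the mixed case.
\<close>

subsection \<open>The root lattice\<close>

text \<open>The obstacle is that \<open>product_value\<close> ranges over all representatives and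
  all evaluations, so that uniqueness is not a matter of checking a basis; it needs an injective
  linear map under which every evaluation becomes one and the same bracket. The algebra
  \<open>e8_alg\<close> is a suitable target because its Jacobi identity has an independent proof by
  cocycle computations.

  No diagonal matrix has to be located in E8 by hand: the image of a diagonal generator is half a
  bracket of two matrices of one type, and the Jacobi identity reduces its action on the other types
  to brackets between different types, the only ones that depend on the tables of roots and signs.
  Identities between diagonal elements then become octonion identities for left and right
  multiplications.

  The sign of \<ell>^2 stays a parameter and the field stays abstract, so that one computation
  covers all the real forms. Surjectivity onto E8 comes from generation by simple roots, in place of
  a count of the 240 roots. Existence of an evaluation is a separate matter, settled after all
  diagonal matrices have been rewritten in language D.\<close>

lemma e8_half_add: "e8_half (a + b) c = e8_half a c + e8_half b c"
    "e8_half c (a + b) = e8_half c a + e8_half c b"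
  by (simp_all add: e8_half_def algebra_simps sum.distrib)

lemma e8_half_minus: "e8_half (- a) c = - e8_half a c" "e8_half c (- a) = - e8_half c a"
  by (simp_all add: e8_half_def sum_negf)

lemma e8_form_add: "e8_form (a + b) c = e8_form a c + e8_form b c"
    "e8_form c (a + b) = e8_form c a + e8_form c b"
  by (simp_all add: e8_form_def e8_half_add)

lemma e8_form_minus: "e8_form (- a) c = - e8_form a c" "e8_form c (- a) = - e8_form c a"
  by (simp_all add: e8_form_def e8_half_minus)

lemma e8_form_diff: "e8_form (a - b) c = e8_form a c - e8_form b c"
    "e8_form c (a - b) = e8_form c a - e8_form c b"
  by (simp_all add: e8_form_add e8_form_minus flip: add_uminus_conv_diff)

lemma e8_form_sym: "e8_form a b = e8_form b a"
  by (simp add: e8_form_def)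

lemma e8_form_zero [simp]: "e8_form 0 a = 0" "e8_form a 0 = 0"
  by (simp_all add: e8_form_def e8_half_def)

text \<open>Completing squares along the Dynkin diagram, eliminating the coordinates in the order 1,
  ..., 8. The pivots are 1, 1, 3/4, 5/12, 2/5, 3/8, 1/3, 1/4, whence the common factor 120.\<close>

lemma e8_half_sum_squares:
  fixes a :: root_lattice
  shows "120 * e8_half a a = 30 * (2 * a $ 1 - a $ 3)\<^sup>2 + 30 * (2 * a $ 2 - a $ 4)\<^sup>2
      + 10 * (3 * a $ 3 - 2 * a $ 4)\<^sup>2 + 2 * (5 * a $ 4 - 6 * a $ 5)\<^sup>2
      + 3 * (4 * a $ 5 - 5 * a $ 6)\<^sup>2 + 5 * (3 * a $ 6 - 4 * a $ 7)\<^sup>2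
      + 10 * (2 * a $ 7 - 3 * a $ 8)\<^sup>2 + 30 * (a $ 8)\<^sup>2"
  unfolding e8_half_def UNIV_8 by (simp add: power2_eq_square algebra_simps)

lemma e8_form_pos:
  assumes "a \<noteq> 0"
  shows "e8_form a a > 0"
proof (rule ccontr)
  assume "\<not> ?thesis"
  then have *: "120 * e8_half a a \<le> 0"
    by (simp add: e8_form_def)
  note nn = zero_le_power2 [of "2 * a $ 1 - a $ 3"] zero_le_power2 [of "2 * a $ 2 - a $ 4"]
    zero_le_power2 [of "3 * a $ 3 - 2 * a $ 4"] zero_le_power2 [of "5 * a $ 4 - 6 * a $ 5"]
    zero_le_power2 [of "4 * a $ 5 - 5 * a $ 6"] zero_le_power2 [of "3 * a $ 6 - 4 * a $ 7"]
    zero_le_power2 [of "2 * a $ 7 - 3 * a $ 8"] zero_le_power2 [of "a $ 8"]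
  have z: "(2 * a $ 1 - a $ 3)\<^sup>2 = 0" "(2 * a $ 2 - a $ 4)\<^sup>2 = 0" "(3 * a $ 3 - 2 * a $ 4)\<^sup>2 = 0"
    "(5 * a $ 4 - 6 * a $ 5)\<^sup>2 = 0" "(4 * a $ 5 - 5 * a $ 6)\<^sup>2 = 0" "(3 * a $ 6 - 4 * a $ 7)\<^sup>2 = 0"
    "(2 * a $ 7 - 3 * a $ 8)\<^sup>2 = 0" "(a $ 8)\<^sup>2 = 0"
    using * nn unfolding e8_half_sum_squares by linarith+
  then have "a $ 8 = 0" "a $ 7 = 0" "a $ 6 = 0" "a $ 5 = 0" "a $ 4 = 0" "a $ 3 = 0" "a $ 2 = 0" "a $ 1 = 0"
    by simp_all
  then have "\<forall>i\<in>{1,2,3,4,5,6,7,8}. a $ i = 0"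
    by simp
  then have "a = 0"
    unfolding UNIV_8 [symmetric] by (simp add: vec_eq_iff)
  with assms show False by simp
qed

lemma e8_form_rt [simp]: "e8_form (rt \<alpha>) (rt \<alpha>) = 2"
  using rt [of \<alpha>] by simp

lemma e8_half_rt [simp]: "e8_half (rt \<alpha>) (rt \<alpha>) = 1"
  using e8_form_rt [of \<alpha>] unfolding e8_form_def by simp

lemma rt_nonzero [simp]: "rt \<alpha> \<noteq> 0"
  using e8_form_rt [of \<alpha>] by (intro notI) simp

lemma rt_Abs: "e8_form a a = 2 \<Longrightarrow> rt (Abs_e8_root a) = a"
  by (simp add: Abs_e8_root_inverse)

text \<open>Cauchy-Schwarz with its cases of equality: the vectors
  \<open>rt \<alpha> + rt \<beta>\<close> and \<open>rt \<alpha> - rt \<beta>\<close> have norm 4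
  plus or minus twice the product, and positive definiteness applies to both.\<close>

lemma e8_form_rt_le:
  shows "e8_form (rt \<alpha>) (rt \<beta>) \<le> 2" "- 2 \<le> e8_form (rt \<alpha>) (rt \<beta>)"
    and e8_form_eq_2: "e8_form (rt \<alpha>) (rt \<beta>) = 2 \<longleftrightarrow> \<alpha> = \<beta>"
    and e8_form_eq_minus_2: "e8_form (rt \<alpha>) (rt \<beta>) = - 2 \<longleftrightarrow> rt \<alpha> + rt \<beta> = 0"
proof -
  have d: "e8_form (rt \<alpha> - rt \<beta>) (rt \<alpha> - rt \<beta>) = 4 - 2 * e8_form (rt \<alpha>) (rt \<beta>)"
    by (simp add: e8_form_diff e8_form_sym [of "rt \<beta>"])
  have s: "e8_form (rt \<alpha> + rt \<beta>) (rt \<alpha> + rt \<beta>) = 4 + 2 * e8_form (rt \<alpha>) (rt \<beta>)"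
    by (simp add: e8_form_add e8_form_sym [of "rt \<beta>"])
  show "e8_form (rt \<alpha>) (rt \<beta>) \<le> 2"
    using e8_form_pos [of "rt \<alpha> - rt \<beta>"] d by (cases "rt \<alpha> - rt \<beta> = 0") auto
  show "- 2 \<le> e8_form (rt \<alpha>) (rt \<beta>)"
    using e8_form_pos [of "rt \<alpha> + rt \<beta>"] s by (cases "rt \<alpha> + rt \<beta> = 0") auto
  show "e8_form (rt \<alpha>) (rt \<beta>) = 2 \<longleftrightarrow> \<alpha> = \<beta>"
    using e8_form_pos [of "rt \<alpha> - rt \<beta>"] d
    by (cases "rt \<alpha> - rt \<beta> = 0") (auto simp: rt_inject)
  show "e8_form (rt \<alpha>) (rt \<beta>) = - 2 \<longleftrightarrow> rt \<alpha> + rt \<beta> = 0"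
    using e8_form_pos [of "rt \<alpha> + rt \<beta>"] s
    by (cases "rt \<alpha> + rt \<beta> = 0") auto
qed

lemma root_add_iff:
  "e8_form (rt \<alpha> + rt \<beta>) (rt \<alpha> + rt \<beta>) = 2 \<longleftrightarrow> e8_form (rt \<alpha>) (rt \<beta>) = - 1"
  by (auto simp: e8_form_add e8_form_sym [of "rt \<beta>"])

lemma e8_cocycle_add:
  "e8_cocycle (a + b) c = e8_cocycle a c * e8_cocycle b c"
  "e8_cocycle c (a + b) = e8_cocycle c a * e8_cocycle c b"
  by (auto simp: e8_cocycle_def e8_half_add)

lemma e8_cocycle_minus:
  "e8_cocycle (- a) b = e8_cocycle a b" "e8_cocycle a (- b) = e8_cocycle a b"
  by (auto simp: e8_cocycle_def e8_half_minus)

lemma e8_cocycle_diff: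
  "e8_cocycle (a - b) c = e8_cocycle a c * e8_cocycle b c"
  "e8_cocycle c (a - b) = e8_cocycle c a * e8_cocycle c b"
  using e8_cocycle_add [of a "- b" c] e8_cocycle_add [of c a "- b"]
  by (simp_all add: e8_cocycle_minus)

lemma e8_cocycle_square [simp]: "e8_cocycle a b * e8_cocycle a b = 1"
  by (simp add: e8_cocycle_def)

lemma e8_cocycle_rt [simp]: "e8_cocycle (rt \<alpha>) (rt \<alpha>) = - 1"
  by (simp add: e8_cocycle_def)

text \<open>The exponents for the two orders add up to \<open>e8_form a b\<close>. For two roots
  whose sum is a root this number is -1, so the cocycle changes sign, which is the antisymmetry of
  the bracket.\<close>

lemma e8_cocycle_swap:
  "e8_cocycle b a = (if even (e8_form a b) then 1 else - 1) * e8_cocycle a b"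
  by (auto simp: e8_cocycle_def e8_form_def)

lemma e8_form_expand: "e8_form a b = (\<Sum>i\<in>UNIV. a $ i * e8_form (axis i 1) b)"
proof -
  have "(\<Sum>i\<in>UNIV. a $ i * e8_form (axis i 1) b) = e8_form (\<Sum>i\<in>UNIV. a $ i *s axis i 1) b"
  proof -
    have scale: "e8_form (c *s x) b = c * e8_form x b" for c x
      by (simp add: e8_form_def e8_half_def algebra_simps sum_distrib_left)
    have "finite S \<Longrightarrow> e8_form (sum f S) b = (\<Sum>i\<in>S. e8_form (f i) b)" for f and S :: "8 set"
      by (induction S rule: finite_induct) (auto simp: e8_form_add)
    then show ?thesis
      by (simp add: scale)
  qed
  also have "(\<Sum>i\<in>UNIV. a $ i *s axis i 1) = a"
    by (rule basis_expansion)
  finally show ?thesis ..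
qed

subsection \<open>The Lie algebra of type E8\<close>

interpretation e8: vector_space "e8_scale :: 'f::field \<Rightarrow> 'f e8_alg \<Rightarrow> _"
  by unfold_locales
    (simp_all add: e8_scale_def prod_eq_iff vec_eq_iff algebra_simps)

lemma fst_e8_scale [simp]: "fst (e8_scale c x) = c *s fst x"
  and snd_e8_scale [simp]: "snd (e8_scale c x) = c *s snd x"
  by (simp_all add: e8_scale_def)

definition e8_cartan :: "'f::field ^ 8 \<Rightarrow> 'f e8_alg" where
  "e8_cartan h = (h, 0)"

text \<open>Extended by zero to lattice vectors that are not roots, so that the bracket of root
  vectors needs a case distinction only for opposite roots.\<close>

definition e8_vec :: "root_lattice \<Rightarrow> 'f::field e8_alg" where
  "e8_vec a = (if e8_form a a = 2 then (0, axis (Abs_e8_root a) 1) else 0)"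

text \<open>All roots have norm 2, so a root and its coroot have the same coordinates.\<close>

definition coroot :: "root_lattice \<Rightarrow> 'f::field e8_alg" where
  "coroot a = e8_cartan (\<chi> i. of_int (a $ i))"

lemma e8_vec_rt: "e8_vec (rt \<alpha>) = (0, axis \<alpha> 1)"
  by (simp add: e8_vec_def rt_inverse)

lemma coroot_add: "coroot (a + b) = coroot a + coroot b"
  and coroot_minus: "coroot (- a) = - coroot a"
  and coroot_zero [simp]: "coroot 0 = 0"
  by (simp_all add: coroot_def e8_cartan_def prod_eq_iff vec_eq_iff)

lemma e8_expand:
  fixes x :: "'f::field e8_alg"
  shows "x = e8_cartan (fst x) + (\<Sum>\<alpha>\<in>UNIV. e8_scale (snd x $ \<alpha>) (e8_vec (rt \<alpha>)))"
  by (simp add: prod_eq_iff e8_cartan_def fst_sum snd_sum e8_vec_rt vec_eq_iff axis_def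
      if_distrib [where f = "\<lambda>t. _ * t"] cong: if_cong)

text \<open>Multilinear identities are proved with this rule one argument at a time, which leaves
  Cartan elements and root vectors.\<close>

lemma e8_induct [case_names add scale cartan root]:
  fixes x :: "'f::field e8_alg"
  assumes add: "\<And>x y. P x \<Longrightarrow> P y \<Longrightarrow> P (x + y)"
    and scale: "\<And>c x. P x \<Longrightarrow> P (e8_scale c x)"
    and cartan: "\<And>h. P (e8_cartan h)"
    and root: "\<And>\<alpha>. P (e8_vec (rt \<alpha>))"
  shows "P x"
proof -
  have 0: "P 0"
    using scale [OF cartan, of 0] by simp
  have "P (\<Sum>\<alpha>\<in>S. e8_scale (snd x $ \<alpha>) (e8_vec (rt \<alpha>)))" if "finite S" for S
    using that by (induction S rule: finite_induct) (auto intro: 0 add scale root)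
  then show ?thesis
    by (subst e8_expand) (intro add cartan, simp)
qed

lemma e8_eval_add: "e8_eval (h + h') \<alpha> = e8_eval h \<alpha> + e8_eval h' \<alpha>"
  and e8_eval_scale: "e8_eval (c *s h) \<alpha> = c * e8_eval h \<alpha>"
  and e8_eval_zero [simp]: "e8_eval 0 \<alpha> = 0"
  by (simp_all add: e8_eval_def algebra_simps sum.distrib sum_distrib_left)

lemma e8_eval_of_int: "e8_eval (\<chi> i. of_int (a $ i)) \<alpha> = of_int (e8_form a (rt \<alpha>))"
  unfolding e8_eval_def e8_form_expand [of a] by simp

lemma e8_bracket_add_left: "e8_bracket (x + y) z = e8_bracket x z + e8_bracket y z"
  unfolding e8_bracket_def
  by (simp add: vec_eq_iff e8_eval_add distrib_left distrib_right sum.distrib case_prod_unfold)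

lemma e8_bracket_add_right: "e8_bracket z (x + y) = e8_bracket z x + e8_bracket z y"
  unfolding e8_bracket_def
  by (simp add: vec_eq_iff e8_eval_add distrib_left distrib_right sum.distrib case_prod_unfold)

lemma e8_bracket_scale_left: "e8_bracket (e8_scale c x) z = e8_scale c (e8_bracket x z)"
  unfolding e8_bracket_def e8_scale_def
  by (simp add: vec_eq_iff e8_eval_scale algebra_simps sum_distrib_left case_prod_unfold)

lemma e8_bracket_scale_right: "e8_bracket z (e8_scale c x) = e8_scale c (e8_bracket z x)"
  unfolding e8_bracket_def e8_scale_def
  by (simp add: vec_eq_iff e8_eval_scale algebra_simps sum_distrib_left case_prod_unfold)

lemma e8_bracket_zero [simp]: "e8_bracket 0 x = 0" "e8_bracket x 0 = 0"
  using e8_bracket_scale_left [of 0 0 x] e8_bracket_scale_right [of x 0 0] by simp_all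

lemma e8_bracket_minus_left: "e8_bracket (- x) z = - e8_bracket x z"
  using e8_bracket_scale_left [of "- 1"] by simp

lemma e8_bracket_minus_right: "e8_bracket z (- x) = - e8_bracket z x"
  using e8_bracket_scale_right [of _ "- 1"] by simp

lemma e8_bracket_diff_left: "e8_bracket (x - y) z = e8_bracket x z - e8_bracket y z"
  by (simp add: e8_bracket_add_left e8_bracket_minus_left flip: add_uminus_conv_diff)

lemma e8_bracket_sum_left: "e8_bracket (sum f S) z = (\<Sum>i\<in>S. e8_bracket (f i) z)"
  by (induction S rule: infinite_finite_induct) (auto simp: e8_bracket_add_left)

lemma e8_bracket_sum_right: "e8_bracket z (sum f S) = (\<Sum>i\<in>S. e8_bracket z (f i))"
  by (induction S rule: infinite_finite_induct) (auto simp: e8_bracket_add_right)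

text \<open>Exchanging the two summation indices leaves two facts: opposite roots have opposite
  coordinates, and roots whose sum is a root have product -1, so that \<open>e8_cocycle_swap\<close>
  yields a minus sign.\<close>

lemma e8_bracket_swap: "e8_bracket y x = - e8_bracket x y"
proof -
  have s1: "(\<Sum>(\<alpha>, \<beta>)\<in>{(\<alpha>, \<beta>). rt \<alpha> + rt \<beta> = 0}. snd y $ \<alpha> * snd x $ \<beta> * of_int (rt \<alpha> $ i))
    = - (\<Sum>(\<alpha>, \<beta>)\<in>{(\<alpha>, \<beta>). rt \<alpha> + rt \<beta> = 0}. snd x $ \<alpha> * snd y $ \<beta> * of_int (rt \<alpha> $ i))" for i
    unfolding sum_negf [symmetric]
  proof (rule sum.reindex_bij_witness [where i = prod.swap and j = prod.swap]; clarsimp)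
    fix \<alpha> \<beta> :: e8_root
    show "rt \<alpha> + rt \<beta> = 0 \<Longrightarrow> rt \<beta> + rt \<alpha> = 0"
      by (simp add: add.commute)
    then show "rt \<alpha> + rt \<beta> = 0 \<Longrightarrow> rt \<beta> + rt \<alpha> = 0" .
    assume "rt \<alpha> + rt \<beta> = 0"
    then have "rt \<beta> = - rt \<alpha>"
      by (simp add: eq_neg_iff_add_eq_0 add.commute)
    then show "- (snd x $ \<beta> * snd y $ \<alpha> * of_int (rt \<beta> $ i)) = snd y $ \<alpha> * snd x $ \<beta> * of_int (rt \<alpha> $ i)"
      by simp
  qed
  have s2: "(\<Sum>(\<alpha>, \<beta>)\<in>{(\<alpha>, \<beta>). rt \<alpha> + rt \<beta> = rt \<gamma>}.
       of_int (e8_cocycle (rt \<alpha>) (rt \<beta>)) * snd y $ \<alpha> * snd x $ \<beta>)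
    = - (\<Sum>(\<alpha>, \<beta>)\<in>{(\<alpha>, \<beta>). rt \<alpha> + rt \<beta> = rt \<gamma>}.
       of_int (e8_cocycle (rt \<alpha>) (rt \<beta>)) * snd x $ \<alpha> * snd y $ \<beta>)" for \<gamma>
    unfolding sum_negf [symmetric]
  proof (rule sum.reindex_bij_witness [where i = prod.swap and j = prod.swap]; clarsimp)
    fix \<alpha> \<beta> :: e8_root
    show "rt \<alpha> + rt \<beta> = rt \<gamma> \<Longrightarrow> rt \<beta> + rt \<alpha> = rt \<gamma>"
      by (simp add: add.commute)
    then show "rt \<alpha> + rt \<beta> = rt \<gamma> \<Longrightarrow> rt \<beta> + rt \<alpha> = rt \<gamma>" .
    assume "rt \<alpha> + rt \<beta> = rt \<gamma>"
    then have "e8_form (rt \<alpha>) (rt \<beta>) = - 1"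
      using root_add_iff [of \<alpha> \<beta>] by simp
    then show "- (of_int (e8_cocycle (rt \<beta>) (rt \<alpha>)) * snd x $ \<beta> * snd y $ \<alpha>)
      = of_int (e8_cocycle (rt \<alpha>) (rt \<beta>)) * snd y $ \<alpha> * snd x $ \<beta>"
      by (simp add: e8_cocycle_swap [of "rt \<beta>" "rt \<alpha>"])
  qed
  show ?thesis
    unfolding e8_bracket_def s1 s2 by (simp add: prod_eq_iff vec_eq_iff)
qed

lemma e8_bracket_self: "e8_bracket x x = (0 :: 'f::{field,ring_char_0} e8_alg)"
proof -
  have "e8_bracket x x + e8_bracket x x = 0"
    using e8_bracket_swap [of x x] by (simp add: eq_neg_iff_add_eq_0)
  then show ?thesis
    by (simp add: prod_eq_iff vec_eq_iff flip: mult_2)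
qed

lemma e8_bracket_cartan_cartan [simp]: "e8_bracket (e8_cartan h) (e8_cartan h') = 0"
  by (simp add: e8_bracket_def e8_cartan_def prod_eq_iff vec_eq_iff)

lemma e8_bracket_cartan_vec [simp]:
  "e8_bracket (e8_cartan h) (e8_vec (rt \<alpha>)) = e8_scale (e8_eval h \<alpha>) (e8_vec (rt \<alpha>))"
  by (simp add: e8_bracket_def e8_cartan_def e8_vec_rt prod_eq_iff vec_eq_iff axis_def)

lemma e8_bracket_coroot_vec [simp]:
  "e8_bracket (coroot a) (e8_vec (rt \<alpha>)) = e8_scale (of_int (e8_form a (rt \<alpha>))) (e8_vec (rt \<alpha>))"
  by (simp add: coroot_def e8_eval_of_int)

lemma e8_bracket_vec_vec:
  "e8_bracket (e8_vec (rt \<alpha>)) (e8_vec (rt \<beta>)) =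
     (if rt \<alpha> + rt \<beta> = 0 then - coroot (rt \<alpha>)
      else e8_scale (of_int (e8_cocycle (rt \<alpha>) (rt \<beta>))) (e8_vec (rt \<alpha> + rt \<beta>)) :: 'f::field e8_alg)"
proof -
  have delta: "(\<Sum>(\<alpha>', \<beta>')\<in>S. f \<alpha>' \<beta>' * (axis \<alpha> (1::'f) $ \<alpha>' * axis \<beta> 1 $ \<beta>'))
      = (if (\<alpha>, \<beta>) \<in> S then f \<alpha> \<beta> else 0)" for S :: "(e8_root \<times> e8_root) set" and f
  proof -
    have "(\<Sum>(\<alpha>', \<beta>')\<in>S. f \<alpha>' \<beta>' * (axis \<alpha> (1::'f) $ \<alpha>' * axis \<beta> 1 $ \<beta>'))
        = (\<Sum>p\<in>S. if p = (\<alpha>, \<beta>) then f \<alpha> \<beta> else 0)"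
      by (rule sum.cong) (auto simp: axis_def split: if_splits)
    then show ?thesis
      by simp
  qed
  have c1: "fst (e8_bracket (e8_vec (rt \<alpha>)) (e8_vec (rt \<beta>)) :: 'f e8_alg) $ i
      = (if rt \<alpha> + rt \<beta> = 0 then - of_int (rt \<alpha> $ i) else 0)" for i
    using delta [where f = "\<lambda>\<alpha>' \<beta>'. of_int (rt \<alpha>' $ i)" and S = "{(\<alpha>, \<beta>). rt \<alpha> + rt \<beta> = 0}"]
    by (simp add: e8_bracket_def e8_vec_rt mult_ac)
  have c2: "snd (e8_bracket (e8_vec (rt \<alpha>)) (e8_vec (rt \<beta>)) :: 'f e8_alg) $ \<gamma>
      = (if rt \<alpha> + rt \<beta> = rt \<gamma> then of_int (e8_cocycle (rt \<alpha>) (rt \<beta>)) else 0)" for \<gamma>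
    using delta [where f = "\<lambda>\<alpha>' \<beta>'. of_int (e8_cocycle (rt \<alpha>') (rt \<beta>'))"
        and S = "{(\<alpha>, \<beta>). rt \<alpha> + rt \<beta> = rt \<gamma>}"]
    by (simp add: e8_bracket_def e8_vec_rt mult_ac)
  consider "rt \<alpha> + rt \<beta> = 0" | \<gamma> where "rt \<alpha> + rt \<beta> = rt \<gamma>"
    | "e8_form (rt \<alpha> + rt \<beta>) (rt \<alpha> + rt \<beta>) \<noteq> 2"
    by (metis rt_Abs)
  then show ?thesis
  proof cases
    case 1
    then show ?thesis
      unfolding prod_eq_iff vec_eq_iff [of "fst _"] vec_eq_iff [of "snd _"] c1 c2 using rt_nonzero [symmetric] by (simp add: coroot_def e8_cartan_def)
  next
    case (2 \<gamma>)
    then show ?thesis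
      unfolding prod_eq_iff vec_eq_iff [of "fst _"] vec_eq_iff [of "snd _"] c1 c2 by (simp add: e8_vec_rt axis_def rt_inject)
  next
    case 3
    then have "rt \<alpha> + rt \<beta> \<noteq> rt \<gamma>" for \<gamma>
      using e8_form_rt [of \<gamma>] by metis
    with 3 show ?thesis
      unfolding prod_eq_iff vec_eq_iff [of "fst _"] vec_eq_iff [of "snd _"] c1 c2 by (auto simp: e8_vec_def coroot_def e8_cartan_def)
  qed
qed


section \<open>The Jacobi identity in E8\<close>

lemma e8_vec_bracket:
  assumes "e8_form a a = 2" "e8_form b b = 2"
  shows "e8_bracket (e8_vec a) (e8_vec b) = (if a + b = 0 then - coroot a
      else e8_scale (of_int (e8_cocycle a b)) (e8_vec (a + b)) :: 'f::field e8_alg)"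
  using e8_bracket_vec_vec [of "Abs_e8_root a" "Abs_e8_root b", where ?'f = 'f]
  by (simp add: rt_Abs [OF assms(1)] rt_Abs [OF assms(2)])

lemma e8_coroot_bracket:
  assumes "e8_form b b = 2"
  shows "e8_bracket (coroot a) (e8_vec b) = (e8_scale (of_int (e8_form a b)) (e8_vec b) :: 'f::field e8_alg)"
  using e8_bracket_coroot_vec [of a "Abs_e8_root b", where ?'a = 'f] by (simp add: rt_Abs [OF assms])

lemma e8_bracket_coroot:
  assumes "e8_form b b = 2"
  shows "e8_bracket (e8_vec b) (coroot a) = (- e8_scale (of_int (e8_form a b)) (e8_vec b) :: 'f::field e8_alg)"
  using e8_coroot_bracket [OF assms, of a] e8_bracket_swap by metis

lemma norm2_form:
  assumes "e8_form a a = 2" "e8_form b b = 2"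
  shows "e8_form a b \<le> 2" "- 2 \<le> e8_form a b" "e8_form a b = 2 \<longleftrightarrow> a = b"
    "e8_form a b = - 2 \<longleftrightarrow> a + b = 0" "e8_form (a + b) (a + b) = 2 \<longleftrightarrow> e8_form a b = - 1"
  using e8_form_rt_le [of "Abs_e8_root a" "Abs_e8_root b"] e8_form_eq_2 [of "Abs_e8_root a" "Abs_e8_root b"]
    e8_form_eq_minus_2 [of "Abs_e8_root a" "Abs_e8_root b"] root_add_iff [of "Abs_e8_root a" "Abs_e8_root b"]
  by (simp_all add: rt_Abs [OF assms(1)] rt_Abs [OF assms(2)] Abs_e8_root_inject assms)

lemma e8_vec_not_root: "e8_form a a \<noteq> 2 \<Longrightarrow> e8_vec a = 0"
  by (simp add: e8_vec_def)

lemma e8_cocycle_norm2: "e8_form a a = 2 \<Longrightarrow> e8_cocycle a a = - 1"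
  using e8_cocycle_rt [of "Abs_e8_root a"] by (simp add: rt_Abs)

text \<open>The bracket of \<open>e8_vec b\<close> and \<open>e8_vec c\<close> is minus a coroot,
  which acts on \<open>e8_vec a\<close> by the product of a and b up to sign. For product 1 only a -
  b is a root, for product -1 only a + b, for product 0 neither, so at most one of the other two
  terms survives; products 2 and -2 mean a = b and a = -b.\<close>

lemma e8_jacobi_opposite:
  assumes a: "e8_form a a = 2" and b: "e8_form b b = 2" and c: "b + c = 0"
  shows "e8_bracket (e8_vec a) (e8_bracket (e8_vec b) (e8_vec c))
    + e8_bracket (e8_vec b) (e8_bracket (e8_vec c) (e8_vec a))
    + e8_bracket (e8_vec c) (e8_bracket (e8_vec a) (e8_vec b)) = (0 :: 'f::field_char_0 e8_alg)"
proof -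
  have [simp]: "c = - b"
    using c by (simp add: eq_neg_iff_add_eq_0 add.commute)
  have c2: "e8_form (- b) (- b) = 2"
    using b by (simp add: e8_form_minus)
  note n = norm2_form [OF a b] norm2_form [OF a c2]
  have t1: "e8_bracket (e8_vec a) (e8_bracket (e8_vec b) (e8_vec (- b)))
      = (e8_scale (of_int (e8_form a b)) (e8_vec a) :: 'f e8_alg)"
    using a b c2
    by (simp add: e8_vec_bracket e8_bracket_minus_right e8_bracket_coroot e8_form_sym)
  consider "e8_form a b = 2" | "e8_form a b = 1" | "e8_form a b = 0" | "e8_form a b = - 1"
    | "e8_form a b = - 2"
    using n(1,2) by linarith
  then show ?thesis
  proof cases
    case 1
    then have "a = b" using n by simp
    moreover have "e8_bracket (e8_vec b) (e8_vec b) = (0 :: 'f e8_alg)"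
      by (rule e8_bracket_self)
    ultimately show ?thesis
      using b c2 t1 by (simp add: e8_vec_bracket e8_bracket_coroot coroot_minus e8_form_minus)
  next
    case 2
    then have r: "e8_form (a - b) (a - b) = 2" "e8_form (a + b) (a + b) = 6" "a + b \<noteq> 0" "a - b \<noteq> 0" "a \<noteq> 0"
      using n a b by (auto simp: e8_form_add e8_form_diff e8_form_sym)
    have "e8_cocycle (- b) a * e8_cocycle b (- b + a) = - 1"
      using e8_cocycle_norm2 [OF b] by (simp add: e8_cocycle_diff e8_cocycle_minus)
    then have "of_int (e8_cocycle (- b) a) * of_int (e8_cocycle b (- b + a)) = (- 1 :: 'f)"
      by (metis of_int_minus of_int_mult of_int_1)
    then show ?thesis
      using 2 a b c2 t1 r
      by (simp add: e8_vec_bracket e8_bracket_scale_right e8_vec_not_root e8.scale_minus_left)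
  next
    case 3
    then have r: "e8_form (- b + a) (- b + a) = 4" "e8_form (a + b) (a + b) = 4" "a + b \<noteq> 0" "a - b \<noteq> 0"
      using n a b by (auto simp: e8_form_diff e8_form_add e8_form_minus e8_form_sym)
    then show ?thesis
      using 3 a b c2 t1
      by (simp add: e8_vec_bracket e8_bracket_scale_right e8_vec_not_root)
  next
    case 4
    then have r: "e8_form (- b + a) (- b + a) = 6" "e8_form (a + b) (a + b) = 2" "a + b \<noteq> 0" "a - b \<noteq> 0" "a \<noteq> 0"
      using n a b by (auto simp: e8_form_diff e8_form_add e8_form_minus e8_form_sym)
    have "e8_cocycle a b * e8_cocycle (- b) (a + b) = 1"
      using e8_cocycle_norm2 [OF b] e8_cocycle_swap [of a b] 4 e8_form_sym [of a b]
      by (simp add: e8_cocycle_add e8_cocycle_minus)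
    then have "of_int (e8_cocycle a b) * of_int (e8_cocycle (- b) (a + b)) = (1 :: 'f)"
      by (metis of_int_mult of_int_1)
    then show ?thesis
      using 4 a b c2 t1 r
      by (simp add: e8_vec_bracket e8_bracket_scale_right e8_vec_not_root e8.scale_minus_left)
  next
    case 5
    then have "b = - a" using n by (simp add: eq_neg_iff_add_eq_0 add.commute)
    moreover have "e8_bracket (e8_vec a) (e8_vec a) = (0 :: 'f e8_alg)"
      by (rule e8_bracket_self)
    ultimately show ?thesis
      using a b t1 by (simp add: e8_vec_bracket e8_bracket_coroot e8_bracket_minus_right e8_form_minus)
  qed
qed

text \<open>If no two of a, b, c are opposite, the double brackets are multiples of
  \<open>e8_vec (a + b + c)\<close>, or of coroots when the sum is 0. The norm 6 + 2s of a + b + c,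
  with s the sum of the three products, separates the cases: sum 0, where the three cocycle values
  agree and the coroots add up to 0; a root, where s = -2 forces the products -1, -1, 0 in some
  order; no root, where everything vanishes.\<close>

lemma e8_jacobi_vec:
  assumes a: "e8_form a a = 2" and b: "e8_form b b = 2" and c: "e8_form c c = 2"
  shows "e8_bracket (e8_vec a) (e8_bracket (e8_vec b) (e8_vec c))
    + e8_bracket (e8_vec b) (e8_bracket (e8_vec c) (e8_vec a))
    + e8_bracket (e8_vec c) (e8_bracket (e8_vec a) (e8_vec b)) = (0 :: 'f::field_char_0 e8_alg)"
proof -
  consider "b + c = 0" | "c + a = 0" | "a + b = 0" | "b + c \<noteq> 0" "c + a \<noteq> 0" "a + b \<noteq> 0"
    by blast
  then show ?thesis
  proof cases
    case 1
    then show ?thesis by (rule e8_jacobi_opposite [OF a b])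
  next
    case 2
    then show ?thesis using e8_jacobi_opposite [OF b c 2, where ?'f = 'f] by (simp add: add_ac)
  next
    case 3
    then show ?thesis using e8_jacobi_opposite [OF c a 3, where ?'f = 'f] by (simp add: add_ac)
  next
    case 4
    note n = norm2_form [OF a b] norm2_form [OF b c] norm2_form [OF c a]
    have s: "e8_form (a + b + c) (a + b + c) = 6 + 2 * (e8_form a b + e8_form b c + e8_form c a)"
      using a b c by (simp add: e8_form_add e8_form_sym)
    have t: "e8_bracket (e8_vec x) (e8_bracket (e8_vec y) (e8_vec z))
        = (if e8_form y z = - 1 then if x + (y + z) = 0 then - e8_scale (of_int (e8_cocycle y z)) (coroot x)
            else e8_scale (of_int (e8_cocycle y z * e8_cocycle x (y + z))) (e8_vec (x + (y + z)))
           else 0 :: 'f e8_alg)"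
      if "e8_form x x = 2" "e8_form y y = 2" "e8_form z z = 2" "y + z \<noteq> 0" for x y z
      using that norm2_form [OF that(2,3)]
      by (cases "e8_form y z = - 1")
        (simp_all add: e8_vec_bracket e8_bracket_scale_right e8_vec_not_root e8.scale_minus_right)
    note t = t [OF a b c 4(1)] t [OF b c a 4(2)] t [OF c a b 4(3)]
    have perm: "b + (c + a) = a + (b + c)" "c + (a + b) = a + (b + c)"
      by (simp_all add: add_ac)
    show ?thesis
    proof (cases "a + (b + c) = 0")
      case True
      have c': "c = - a - b"
      proof -
        have "c = a + (b + c) - a - b" by simp
        then show ?thesis unfolding True by simp
      qed
      have f: "e8_form a b = - 1" "e8_form b c = - 1" "e8_form c a = - 1"
        using a b c unfolding c' by (auto simp: e8_form_diff e8_form_minus e8_form_sym)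
      have "e8_cocycle b c = e8_cocycle a b" "e8_cocycle c a = e8_cocycle a b"
        using e8_cocycle_norm2 [OF b] e8_cocycle_norm2 [OF a] e8_cocycle_swap [of a b] f(1)
          e8_form_sym [of a b]
        unfolding c' by (simp_all add: e8_cocycle_diff e8_cocycle_minus)
      moreover have "coroot a + (coroot b + coroot c) = (0 :: 'f e8_alg)"
        by (metis True coroot_add coroot_zero)
      then have "e8_scale (of_int (e8_cocycle a b)) (coroot a) + (e8_scale (of_int (e8_cocycle a b)) (coroot b)
          + e8_scale (of_int (e8_cocycle a b)) (coroot c)) = (0 :: 'f e8_alg)"
        by (metis e8.scale_right_distrib e8.scale_zero_right)
      then have "- e8_scale (of_int (e8_cocycle a b)) (coroot a) + - e8_scale (of_int (e8_cocycle a b)) (coroot b)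
          + - e8_scale (of_int (e8_cocycle a b)) (coroot c) = (0 :: 'f e8_alg)"
        by (metis add.assoc minus_add_distrib neg_equal_0_iff_equal)
      ultimately show ?thesis
        unfolding t perm True f by simp
    next
      case False
      show ?thesis
      proof (cases "e8_form (a + (b + c)) (a + (b + c)) = 2")
        case nr: False
        then show ?thesis
          unfolding t perm by (simp add: False e8_vec_not_root)
      next
        case True
        then have sum: "e8_form a b + e8_form b c + e8_form c a = - 2"
          using s by (simp add: add.assoc)
        have lo: "e8_form a b \<ge> - 1" "e8_form b c \<ge> - 1" "e8_form c a \<ge> - 1"
          using norm2_form(2,4) [OF a b] norm2_form(2,4) [OF b c] norm2_form(2,4) [OF c a] 4
          by (simp_all add: le_less [of "- 2"])
        \<comment> \<open>Both products equal \<epsilon>(y,z) \<epsilon>(x,y) \<epsilon>(x,z) up to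
          sign: exchanging x and z costs a sign, exchanging x and y does not.\<close>
        have key: "e8_cocycle y z * e8_cocycle x (y + z) + e8_cocycle z x * e8_cocycle y (z + x) = 0"
          if "e8_form y z = - 1" "e8_form z x = - 1" "e8_form x y = 0" for x y z
          using e8_cocycle_swap [of x y] e8_cocycle_swap [of x z] e8_cocycle_swap [of z y] that
            e8_form_sym [of x z] e8_form_sym [of y z] e8_form_sym [of x y]
          by (simp add: e8_cocycle_add)
        have key': "e8_scale (of_int p) v + e8_scale (of_int q) v = 0"
          if "p + q = 0" for p q and v :: "'f e8_alg"
          using that by (metis e8.scale_left_distrib e8.scale_zero_left of_int_0 of_int_add)
        consider "e8_form a b = - 1" "e8_form b c = - 1" "e8_form c a = 0"
          | "e8_form b c = - 1" "e8_form c a = - 1" "e8_form a b = 0"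
          | "e8_form c a = - 1" "e8_form a b = - 1" "e8_form b c = 0"
          using sum lo by linarith
        then show ?thesis
        proof cases
          case 1
          then show ?thesis
            unfolding t perm using key' [OF key [OF 1]] by (simp add: False add.commute)
        next
          case 2
          then show ?thesis
            unfolding t perm using key' [OF key [OF 2]] by (simp add: False)
        next
          case 3
          then show ?thesis
            unfolding t perm using key' [OF key [OF 3]] by (simp add: False)
        qed
      qed
    qed
  qed
qed

definition e8_jacobiator :: "'f::field_char_0 e8_alg \<Rightarrow> 'f e8_alg \<Rightarrow> 'f e8_alg \<Rightarrow> 'f e8_alg" where
  "e8_jacobiator x y z = e8_bracket x (e8_bracket y z) + e8_bracket y (e8_bracket z x)
     + e8_bracket z (e8_bracket x y)"

lemma e8_jacobiator_linear:
  "e8_jacobiator (x + x') y z = e8_jacobiator x y z + e8_jacobiator x' y z"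
  "e8_jacobiator (e8_scale c x) y z = e8_scale c (e8_jacobiator x y z)"
  by (simp_all add: e8_jacobiator_def e8_bracket_add_left e8_bracket_add_right
      e8_bracket_scale_left e8_bracket_scale_right e8.scale_right_distrib algebra_simps)

lemma e8_jacobiator_cycle: "e8_jacobiator x y z = e8_jacobiator y z x"
  by (simp add: e8_jacobiator_def add_ac)

lemma e8_jacobi: "e8_bracket x (e8_bracket y z) + e8_bracket y (e8_bracket z x)
     + e8_bracket z (e8_bracket x y) = (0 :: 'f::field_char_0 e8_alg)"
proof -
  define basic where "basic = (range e8_cartan \<union> range (\<lambda>\<alpha>. e8_vec (rt \<alpha>)) :: 'f e8_alg set)"
  have vec_cartan: "e8_bracket (e8_vec (rt \<alpha>)) (e8_cartan h)
      = (- e8_scale (e8_eval h \<alpha>) (e8_vec (rt \<alpha>)) :: 'f e8_alg)" for \<alpha> h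
    using e8_bracket_swap [of "e8_vec (rt \<alpha>)" "e8_cartan h"] by simp
  \<comment> \<open>Linearity in the first argument is enough, the other two being reached by cyclic
    symmetry.\<close>
  have slot: "e8_jacobiator x y z = 0"
    if "\<And>x. x \<in> basic \<Longrightarrow> e8_jacobiator x y z = 0" for x y z :: "'f e8_alg"
    by (induction x rule: e8_induct) (auto simp: e8_jacobiator_linear that basic_def)
  have basic3: "e8_jacobiator x y z = 0" if "x \<in> basic" "y \<in> basic" "z \<in> basic" for x y z
  proof -
    have cartan: "e8_jacobiator (e8_cartan h) y z = 0" if "y \<in> basic" "z \<in> basic" for h y z
      using that
    proof (auto simp: basic_def)
      fix \<alpha> \<beta> :: e8_root
      \<comment> \<open>A Cartan element acts as a derivation because \<open>e8_eval h\<close> is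
        additive in the root.\<close>
      have *: "e8_bracket (e8_cartan h) (e8_vec (rt \<alpha> + rt \<beta>))
          = (e8_scale (e8_eval h \<alpha> + e8_eval h \<beta>) (e8_vec (rt \<alpha> + rt \<beta>)) :: 'f e8_alg)"
      proof (cases "e8_form (rt \<alpha> + rt \<beta>) (rt \<alpha> + rt \<beta>) = 2")
        case True
        then obtain \<gamma> where \<gamma>: "rt \<alpha> + rt \<beta> = rt \<gamma>"
          by (metis rt_Abs)
        then have "e8_eval h \<gamma> = e8_eval h \<alpha> + e8_eval h \<beta>"
          unfolding e8_eval_def by (simp add: e8_form_add algebra_simps sum.distrib flip: \<gamma>)
        with \<gamma> show ?thesis
          by simp
      qed (simp add: e8_vec_not_root)
      have **: "e8_eval h \<beta> = - e8_eval h \<alpha>" if "rt \<alpha> + rt \<beta> = 0"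
      proof -
        have "rt \<beta> = - rt \<alpha>"
          using that by (simp add: eq_neg_iff_add_eq_0 add.commute)
        then show ?thesis
          unfolding e8_eval_def by (simp add: e8_form_minus sum_negf)
      qed
      show "e8_jacobiator (e8_cartan h) (e8_vec (rt \<alpha>)) (e8_vec (rt \<beta>)) = 0"
        using * ** e8_bracket_swap [of "e8_vec (rt \<alpha>) :: 'f e8_alg" "e8_vec (rt \<beta>)"]
        by (cases "rt \<alpha> + rt \<beta> = 0")
          (simp_all add: e8_jacobiator_def vec_cartan e8_bracket_vec_vec e8_bracket_minus_right
            e8_bracket_scale_right coroot_def e8.scale_left_distrib mult.commute
            e8.scale_minus_left algebra_simps)
    next
      fix \<alpha> h'
      show "e8_jacobiator (e8_cartan h) (e8_cartan h') (e8_vec (rt \<alpha>)) = 0"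
        by (simp add: e8_jacobiator_def vec_cartan e8_bracket_minus_right e8_bracket_scale_right mult.commute)
      show "e8_jacobiator (e8_cartan h) (e8_vec (rt \<alpha>)) (e8_cartan h') = 0"
        by (simp add: e8_jacobiator_def vec_cartan e8_bracket_minus_right e8_bracket_scale_right mult.commute)
    qed (simp add: e8_jacobiator_def)
    show ?thesis
    proof (cases "\<exists>\<alpha> \<beta> \<gamma>. x = e8_vec (rt \<alpha>) \<and> y = e8_vec (rt \<beta>) \<and> z = e8_vec (rt \<gamma>)")
      case True
      then show ?thesis
        by (auto simp: e8_jacobiator_def intro!: e8_jacobi_vec)
    next
      case False
      with that obtain h where "x = e8_cartan h \<or> y = e8_cartan h \<or> z = e8_cartan h"
        unfolding basic_def by blast
      moreover have "e8_jacobiator x y z = e8_jacobiator y z x" "e8_jacobiator x y z = e8_jacobiator z x y"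
        by (simp_all add: e8_jacobiator_def add_ac)
      ultimately show ?thesis
        using cartan [OF that(2,3)] cartan [OF that(3,1)] cartan [OF that(1,2)] by auto
    qed
  qed
  have 1: "e8_jacobiator x y z = 0" if "y \<in> basic" "z \<in> basic" for x y z
    by (rule slot) (rule basic3 [OF _ that])
  have 2: "e8_jacobiator y z x = 0" if "z \<in> basic" for x y z
    by (rule slot, subst e8_jacobiator_cycle [symmetric]) (rule 1 [OF _ that])
  have "e8_jacobiator x y z = 0"
    by (rule slot, subst e8_jacobiator_cycle [symmetric]) (rule 2)
  then show ?thesis
    unfolding e8_jacobiator_def .
qed

lemma e8_bracket_jacobi:
  fixes x y z :: "'f::field_char_0 e8_alg"
  shows "e8_bracket (e8_bracket x y) z = e8_bracket x (e8_bracket y z) - e8_bracket y (e8_bracket x z)"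
    and "e8_bracket z (e8_bracket x y) = e8_bracket (e8_bracket z x) y + e8_bracket x (e8_bracket z y)"
proof -
  have sw: "e8_bracket (e8_bracket x y) z = - e8_bracket z (e8_bracket x y)"
    "e8_bracket z x = - e8_bracket x z" "e8_bracket z y = - e8_bracket y z"
    "e8_bracket (e8_bracket x z) y = - e8_bracket y (e8_bracket x z)"
    by (rule e8_bracket_swap)+
  have "e8_bracket x (e8_bracket y z) - e8_bracket y (e8_bracket x z) + e8_bracket z (e8_bracket x y) = 0"
    using e8_jacobi [of x y z] by (simp add: sw(2) e8_bracket_minus_right)
  then have *: "e8_bracket z (e8_bracket x y) = e8_bracket y (e8_bracket x z) - e8_bracket x (e8_bracket y z)"
    by (metis add.commute eq_neg_iff_add_eq_0 minus_diff_eq)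
  show "e8_bracket (e8_bracket x y) z = e8_bracket x (e8_bracket y z) - e8_bracket y (e8_bracket x z)"
    unfolding sw(1) * by simp
  show "e8_bracket z (e8_bracket x y) = e8_bracket (e8_bracket z x) y + e8_bracket x (e8_bracket z y)"
    unfolding * sw(2,3) e8_bracket_minus_left e8_bracket_minus_right sw(4) by simp
qed

subsection \<open>The invariant form\<close>

definition e8_neg :: "e8_root \<Rightarrow> e8_root" where
  "e8_neg \<alpha> = Abs_e8_root (- rt \<alpha>)"

lemma rt_neg [simp]: "rt (e8_neg \<alpha>) = - rt \<alpha>"
  unfolding e8_neg_def by (rule rt_Abs) (simp add: e8_form_minus)

lemma e8_neg_neg [simp]: "e8_neg (e8_neg \<alpha>) = \<alpha>"
  by (metis minus_minus rt_inject rt_neg)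

text \<open>Once the Cartan part is the form of the lattice, invariance forces the value -1 on
  opposite root vectors, because their bracket is minus a coroot. This explains the sign before the
  second sum.\<close>

definition e8_inv_form :: "'f::field e8_alg \<Rightarrow> 'f e8_alg \<Rightarrow> 'f" where
  "e8_inv_form x y = (\<Sum>i\<in>UNIV. \<Sum>j\<in>UNIV. fst x $ i * fst y $ j * of_int (e8_form (axis i 1) (axis j 1)))
     - (\<Sum>\<alpha>\<in>UNIV. snd x $ \<alpha> * snd y $ e8_neg \<alpha>)"

lemma e8_inv_form_add:
  "e8_inv_form (x + y) z = e8_inv_form x z + e8_inv_form y z"
  "e8_inv_form z (x + y) = e8_inv_form z x + e8_inv_form z y"
  by (simp_all add: e8_inv_form_def distrib_left distrib_right sum.distrib)

lemma e8_inv_form_scale: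
  "e8_inv_form (e8_scale c x) z = c * e8_inv_form x z"
  "e8_inv_form z (e8_scale c x) = c * e8_inv_form z x"
  by (simp_all add: e8_inv_form_def right_diff_distrib sum_distrib_left mult_ac)

lemma e8_inv_form_sym: "e8_inv_form x y = e8_inv_form y x"
proof -
  have "(\<Sum>\<alpha>\<in>UNIV. snd x $ \<alpha> * snd y $ e8_neg \<alpha>) = (\<Sum>\<alpha>\<in>UNIV. snd y $ \<alpha> * snd x $ e8_neg \<alpha>)"
    by (rule sum.reindex_bij_witness [where i = e8_neg and j = e8_neg]) auto
  moreover have "(\<Sum>i\<in>UNIV. \<Sum>j\<in>UNIV. fst x $ i * fst y $ j * of_int (e8_form (axis i 1) (axis j 1)))
      = (\<Sum>i\<in>UNIV. \<Sum>j\<in>UNIV. fst y $ i * fst x $ j * of_int (e8_form (axis i 1) (axis j 1)))"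
    by (subst sum.swap) (simp add: e8_form_sym mult.commute)
  ultimately show ?thesis
    by (simp add: e8_inv_form_def)
qed

lemma e8_inv_form_cartan_coroot:
  "e8_inv_form (e8_cartan h) (coroot (rt \<alpha>)) = e8_eval h \<alpha>"
proof -
  have "of_int (e8_form (axis i 1) (rt \<alpha>))
      = (\<Sum>j\<in>UNIV. of_int (rt \<alpha> $ j) * of_int (e8_form (axis i 1) (axis j 1)) :: 'a)" for i
    by (subst e8_form_sym, subst e8_form_expand) (simp add: e8_form_sym)
  then show ?thesis
    by (simp add: e8_inv_form_def e8_cartan_def coroot_def e8_eval_def sum_distrib_left mult_ac)
qed

lemma e8_inv_form_cartan_vec [simp]:
  "e8_inv_form (e8_cartan h) (e8_vec a) = 0" "e8_inv_form (e8_vec a) (e8_cartan h) = 0"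
  by (simp_all add: e8_inv_form_def e8_cartan_def e8_vec_def)

lemma e8_inv_form_vec_vec:
  "e8_inv_form (e8_vec (rt \<alpha>)) (e8_vec (rt \<beta>)) = (if rt \<alpha> + rt \<beta> = 0 then - 1 else 0)"
proof -
  have "e8_neg \<alpha> = \<beta> \<longleftrightarrow> rt \<alpha> + rt \<beta> = 0"
    by (metis add.right_inverse add_left_imp_eq rt_inject rt_neg)
  then show ?thesis
    by (simp add: e8_inv_form_def e8_vec_rt axis_def if_distrib [where f = "\<lambda>t. t * _"] cong: if_cong)
qed

lemma e8_inv_form_zero [simp]: "e8_inv_form 0 x = 0" "e8_inv_form x 0 = 0"
  by (simp_all add: e8_inv_form_def)

lemma e8_inv_form_minus:
  "e8_inv_form (- x) y = - e8_inv_form x y" "e8_inv_form y (- x) = - e8_inv_form y x"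
  using e8_inv_form_scale (1) [of "- 1" x y] e8_inv_form_scale(2) [of y "- 1" x] by simp_all

lemma e8_inv_form_vec:
  assumes "e8_form a a = 2" "e8_form b b = 2"
  shows "e8_inv_form (e8_vec a) (e8_vec b) = (if a + b = 0 then - 1 else 0 :: 'f::field)"
  using e8_inv_form_vec_vec [of "Abs_e8_root a" "Abs_e8_root b", where ?'a = 'f]
  by (simp add: rt_Abs [OF assms(1)] rt_Abs [OF assms(2)])

lemma e8_inv_form_invariant:
  fixes x y z :: "'f::field_char_0 e8_alg"
  shows "e8_inv_form (e8_bracket x y) z = e8_inv_form x (e8_bracket y z)"
proof -
  have vec_cartan: "e8_bracket (e8_vec (rt \<alpha>)) (e8_cartan h)
      = (- e8_scale (e8_eval h \<alpha>) (e8_vec (rt \<alpha>)) :: 'f e8_alg)" for \<alpha> h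
    using e8_bracket_swap [of "e8_vec (rt \<alpha>)" "e8_cartan h"] by simp
  have coroot_vec: "e8_inv_form (coroot a) (e8_vec b) = (0 :: 'f)"
    "e8_inv_form (e8_vec b) (coroot a) = (0 :: 'f)" for a b
    by (simp_all add: coroot_def)
  have eval_neg: "e8_eval h \<beta> = - e8_eval h \<alpha>" if "rt \<alpha> + rt \<beta> = 0" for h :: "'f ^ 8" and \<alpha> \<beta>
  proof -
    have "rt \<beta> = - rt \<alpha>"
      using that by (simp add: eq_neg_iff_add_eq_0 add.commute)
    then show ?thesis
      unfolding e8_eval_def by (simp add: e8_form_minus sum_negf)
  qed
  note simps = vec_cartan coroot_vec e8_inv_form_minus e8_inv_form_scale e8_inv_form_vec_vec
    e8_bracket_vec_vec e8_inv_form_cartan_coroot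
  \<comment> \<open>Both sides vanish unless the three roots add up to 0, and then the cocycle is
    unchanged by cyclic rotation of the roots.\<close>
  have vvv: "e8_inv_form (e8_bracket (e8_vec (rt \<alpha>)) (e8_vec (rt \<beta>))) (e8_vec (rt \<gamma>))
      = (e8_inv_form (e8_vec (rt \<alpha>)) (e8_bracket (e8_vec (rt \<beta>)) (e8_vec (rt \<gamma>))) :: 'f)"
    for \<alpha> \<beta> \<gamma>
  proof (cases "rt \<alpha> + rt \<beta> + rt \<gamma> = 0")
    case True
    then have c: "rt \<gamma> = - (rt \<alpha> + rt \<beta>)" and a: "rt \<alpha> = - (rt \<beta> + rt \<gamma>)"
      by (metis add.commute add.assoc eq_neg_iff_add_eq_0)+
    have nz: "rt \<alpha> + rt \<beta> \<noteq> 0" "rt \<beta> + rt \<gamma> \<noteq> 0"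
      using True rt_nonzero [of \<alpha>] rt_nonzero [of \<gamma>] by (metis add_0) (metis True add.assoc add_0_right rt_nonzero)
    have ab: "e8_form (rt \<alpha> + rt \<beta>) (rt \<alpha> + rt \<beta>) = 2"
      using e8_form_rt [of \<gamma>] unfolding c by (simp only: e8_form_minus minus_minus)
    have bc: "e8_form (rt \<beta> + rt \<gamma>) (rt \<beta> + rt \<gamma>) = 2"
      using e8_form_rt [of \<alpha>] unfolding a by (simp only: e8_form_minus minus_minus)
    have "e8_cocycle (rt \<beta>) (rt \<gamma>) = e8_cocycle (rt \<alpha>) (rt \<beta>)"
      using ab e8_cocycle_swap [of "rt \<beta>" "rt \<alpha>"] root_add_iff [of \<alpha> \<beta>]
      unfolding c by (simp add: e8_cocycle_minus e8_cocycle_add e8_cocycle_diff)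
    then show ?thesis
      using nz True ab bc
      by (simp add: e8_bracket_vec_vec e8_inv_form_scale e8_inv_form_vec add.assoc)
  next
    case False
    have "e8_inv_form (e8_vec (rt \<alpha> + rt \<beta>)) (e8_vec (rt \<gamma>)) = (0 :: 'f)"
      using False e8_inv_form_vec [OF _ e8_form_rt, of "rt \<alpha> + rt \<beta>", where ?'f = 'f]
      by (cases "e8_form (rt \<alpha> + rt \<beta>) (rt \<alpha> + rt \<beta>) = 2") (simp_all add: e8_vec_not_root)
    moreover have "e8_inv_form (e8_vec (rt \<alpha>)) (e8_vec (rt \<beta> + rt \<gamma>)) = (0 :: 'f)"
      using False e8_inv_form_vec [OF e8_form_rt, of "rt \<beta> + rt \<gamma>", where ?'f = 'f]
      by (cases "e8_form (rt \<beta> + rt \<gamma>) (rt \<beta> + rt \<gamma>) = 2") (simp_all add: e8_vec_not_root add.assoc)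
    ultimately show ?thesis
      by (simp add: e8_bracket_vec_vec e8_inv_form_scale e8_inv_form_minus coroot_vec)
  qed
  have "e8_inv_form (e8_vec (rt \<alpha>)) (e8_bracket y z) = e8_inv_form (e8_bracket (e8_vec (rt \<alpha>)) y) z"
    for \<alpha> and y z :: "'f e8_alg"
  proof (induction y rule: e8_induct)
    case (cartan h)
    show ?case
      by (induction z rule: e8_induct)
        (auto simp: simps e8_inv_form_add e8_bracket_add_right e8_bracket_scale_right eval_neg)
  next
    case (root \<beta>)
    show ?case
    proof (induction z rule: e8_induct)
      case (cartan h)
      have "e8_inv_form (coroot (rt \<alpha>)) (e8_cartan h) = e8_eval h \<alpha>"
        by (subst e8_inv_form_sym) (rule e8_inv_form_cartan_coroot)
      then show ?case
        by (auto simp: simps eval_neg)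
    qed (auto simp: vvv e8_inv_form_add e8_inv_form_scale e8_bracket_add_right e8_bracket_scale_right)
  qed (auto simp: e8_inv_form_add e8_inv_form_scale e8_bracket_add_right e8_bracket_add_left
      e8_bracket_scale_right e8_bracket_scale_left)
  moreover have "e8_inv_form (e8_cartan h) (e8_bracket y z) = e8_inv_form (e8_bracket (e8_cartan h) y) z"
    for h and y z :: "'f e8_alg"
  proof (induction y rule: e8_induct)
    case (cartan h)
    show ?case
      by (induction z rule: e8_induct)
        (auto simp: simps e8_inv_form_add e8_bracket_add_right e8_bracket_scale_right)
  next
    case (root \<beta>)
    show ?case
      by (induction z rule: e8_induct)
        (auto simp: simps e8_inv_form_add e8_bracket_add_right e8_bracket_scale_right)
  qed (auto simp: e8_inv_form_add e8_inv_form_scale e8_bracket_add_right e8_bracket_add_left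
      e8_bracket_scale_right e8_bracket_scale_left)
  ultimately show ?thesis
    by (induction x rule: e8_induct)
      (simp_all add: e8_inv_form_add e8_inv_form_scale e8_bracket_add_left e8_bracket_scale_left)
qed


lemma e8_inv_form_vec_right: "e8_inv_form x (e8_vec (rt \<gamma>)) = - (snd x $ e8_neg \<gamma>)"
proof -
  have "e8_neg \<alpha> = \<gamma> \<longleftrightarrow> \<alpha> = e8_neg \<gamma>" for \<alpha>
    by auto
  then show ?thesis
    by (simp add: e8_inv_form_def e8_vec_rt axis_def if_distrib [where f = "\<lambda>t. _ * t"] cong: if_cong)
qed

lemma e8_inv_form_coroot_right: "e8_inv_form x (coroot (rt \<alpha>)) = e8_eval (fst x) \<alpha>"
proof -
  have "e8_inv_form x (coroot (rt \<alpha>)) = e8_inv_form (e8_cartan (fst x)) (coroot (rt \<alpha>))"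
    by (simp add: e8_inv_form_def coroot_def e8_cartan_def)
  then show ?thesis
    by (simp add: e8_inv_form_cartan_coroot)
qed

text \<open>By invariance x is orthogonal to every bracket of \<open>e8_vec (rt \<beta>)\<close>,
  for \<beta> in S, with any y. For y the opposite root vector this kills the Cartan part on S. Any
  root \<gamma> has, after a possible change of sign of \<beta>, a negative product with some
  \<beta> in S; then the root vector of -\<gamma> is a multiple of such a bracket, and the
  coefficient of \<gamma> in x is 0.\<close>

lemma e8_centralizer_eq_0:
  fixes x :: "'f::field_char_0 e8_alg"
  assumes comm: "\<And>\<beta>. \<beta> \<in> S \<Longrightarrow> e8_bracket x (e8_vec (rt \<beta>)) = 0"
    and neg: "\<And>\<beta>. \<beta> \<in> S \<Longrightarrow> e8_neg \<beta> \<in> S"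
    and spans: "\<And>a. a \<noteq> 0 \<Longrightarrow> \<exists>\<beta>\<in>S. e8_form a (rt \<beta>) \<noteq> 0"
    and spans': "\<And>h :: 'f ^ 8. (\<forall>\<beta>\<in>S. e8_eval h \<beta> = 0) \<Longrightarrow> h = 0"
  shows "x = 0"
proof -
  have B: "e8_inv_form x (e8_bracket (e8_vec (rt \<beta>)) y) = 0" if "\<beta> \<in> S" for \<beta> y
    using e8_inv_form_invariant [of x "e8_vec (rt \<beta>)" y] comm [OF that] by simp
  have "e8_eval (fst x) \<beta> = 0" if "\<beta> \<in> S" for \<beta>
    using B [OF that, of "e8_vec (rt (e8_neg \<beta>))"]
    by (simp add: e8_bracket_vec_vec e8_inv_form_minus e8_inv_form_coroot_right del: rt_neg)
      (simp add: e8_bracket_vec_vec e8_inv_form_minus e8_inv_form_coroot_right)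
  then have "fst x = 0"
    using spans' by blast
  moreover have "snd x $ \<gamma> = 0" for \<gamma>
  proof -
    obtain \<beta> where \<beta>: "\<beta> \<in> S" "e8_form (rt \<gamma>) (rt \<beta>) < 0"
    proof -
      obtain \<beta> where \<beta>: "\<beta> \<in> S" "e8_form (rt \<gamma>) (rt \<beta>) \<noteq> 0"
        using spans [of "rt \<gamma>"] by auto
      then show ?thesis
        using that [of \<beta>] that [of "e8_neg \<beta>"] neg by (auto simp: e8_form_minus linorder_neq_iff)
    qed
    consider "e8_form (rt \<gamma>) (rt \<beta>) = - 1" | "e8_form (rt \<gamma>) (rt \<beta>) = - 2"
      using \<beta>(2) e8_form_rt_le [of \<gamma> \<beta>] by linarith
    then show ?thesis
    proof cases
      case 1
      then have d: "e8_form (rt \<gamma> + rt \<beta>) (rt \<gamma> + rt \<beta>) = 2"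
        by (simp add: root_add_iff)
      define \<delta> where "\<delta> = Abs_e8_root (- (rt \<gamma> + rt \<beta>))"
      have \<delta>: "rt \<delta> = - (rt \<gamma> + rt \<beta>)"
        unfolding \<delta>_def by (rule rt_Abs) (simp only: e8_form_minus d minus_minus)
      have "rt \<beta> + rt \<delta> = rt (e8_neg \<gamma>)"
        by (simp add: \<delta>)
      then have "of_int (e8_cocycle (rt \<beta>) (rt \<delta>)) * snd x $ \<gamma> = 0"
        using B [OF \<beta>(1), of "e8_vec (rt \<delta>)"]
        by (simp add: e8_bracket_vec_vec e8_inv_form_scale e8_inv_form_vec_right del: rt_neg)
      moreover have "e8_cocycle (rt \<beta>) (rt \<delta>) \<noteq> 0"
        by (simp add: e8_cocycle_def)
      ultimately show ?thesis
        by simp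
    next
      case 2
      then have g: "e8_neg \<beta> = \<gamma>"
        unfolding e8_form_eq_minus_2 by (metis eq_neg_iff_add_eq_0 rt_inject rt_neg)
      have "e8_bracket (e8_vec (rt \<beta>)) (coroot (rt \<beta>)) = (- e8_scale 2 (e8_vec (rt \<beta>)) :: 'f e8_alg)"
        by (simp add: e8_bracket_coroot)
      then show ?thesis
        using B [OF \<beta>(1), of "coroot (rt \<beta>)"]
        by (simp add: e8_inv_form_minus e8_inv_form_scale e8_inv_form_vec_right g)
    qed
  qed
  ultimately show ?thesis
    by (simp add: prod_eq_iff vec_eq_iff)
qed

lemma e8_form_axis [simp]: "e8_form (axis i 1) (axis i 1) = 2"
  by (auto simp: e8_form_def e8_half_def axis_def if_distrib cong: if_cong)

text \<open>Descent on the sum of the absolute values of the coordinates. The norm of a root is the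
  sum of its coordinates times its products with the simple roots; being positive, it has a positive
  term, and moving by that simple root towards 0 gives a smaller root. Absolute values treat roots
  of both signs at once.\<close>

lemma e8_generated_by_simple_roots:
  fixes M :: "'f::field_char_0 e8_alg set"
  assumes add: "\<And>x y. x \<in> M \<Longrightarrow> y \<in> M \<Longrightarrow> x + y \<in> M"
    and scale: "\<And>c x. x \<in> M \<Longrightarrow> e8_scale c x \<in> M"
    and bracket: "\<And>x y. x \<in> M \<Longrightarrow> y \<in> M \<Longrightarrow> e8_bracket x y \<in> M"
    and simple: "\<And>i. e8_vec (axis i 1) \<in> M" "\<And>i. e8_vec (- axis i 1) \<in> M"
  shows "x \<in> M"
proof -
  have step: "e8_vec (a + b) \<in> M"
    if "e8_vec a \<in> M" "e8_vec b \<in> M" "e8_form a a = 2" "e8_form b b = 2" "e8_form a b = - 1" for a b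
  proof -
    have "a + b \<noteq> 0"
      using norm2_form [OF that(3,4)] that(5) by simp
    then have "e8_scale (of_int (e8_cocycle a b)) (e8_bracket (e8_vec a) (e8_vec b)) = (e8_vec (a + b) :: 'f e8_alg)"
      using that by (simp add: e8_vec_bracket e8_cocycle_def)
    with that show ?thesis
      by (metis bracket scale)
  qed
  have roots: "e8_vec a \<in> M" if "e8_form a a = 2" for a
    using that
  proof (induction "\<Sum>i\<in>UNIV. nat \<bar>a $ i\<bar>" arbitrary: a rule: less_induct)
    case less
    have "\<exists>i. a $ i * e8_form (axis i 1) a > 0"
    proof (rule ccontr)
      assume "\<not> ?thesis"
      then have "(\<Sum>i\<in>UNIV. a $ i * e8_form (axis i 1) a) \<le> 0"
        by (intro sum_nonpos) (simp add: not_less)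
      then show False
        using less.prems e8_form_expand [of a a] by simp
    qed
    then obtain i where i: "a $ i * e8_form (axis i 1) a > 0" ..
    have smaller: "(\<Sum>j\<in>UNIV. nat \<bar>b $ j\<bar>) < (\<Sum>j\<in>UNIV. nat \<bar>a $ j\<bar>)"
      if "\<And>j. j \<noteq> i \<Longrightarrow> b $ j = a $ j" "\<bar>b $ i\<bar> < \<bar>a $ i\<bar>" for b :: root_lattice
    proof (rule sum_strict_mono_ex1)
      show "\<forall>j\<in>UNIV. nat \<bar>b $ j\<bar> \<le> nat \<bar>a $ j\<bar>"
        using that by (metis eq_iff less_imp_le nat_mono)
      show "\<exists>j\<in>UNIV. nat \<bar>b $ j\<bar> < nat \<bar>a $ j\<bar>"
        using that(2) by (intro bexI [of _ i]) auto
    qed simp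
    consider "a $ i > 0" "e8_form (axis i 1) a > 0" | "a $ i < 0" "e8_form (axis i 1) a < 0"
      using i by (auto simp: zero_less_mult_iff)
    then show ?case
    proof cases
      case 1
      show ?thesis
      proof (cases "e8_form (axis i 1) a = 2")
        case True
        then have "axis i 1 = a"
          using norm2_form [OF e8_form_axis less.prems] by simp
        then show ?thesis
          using simple(1) [of i] by simp
      next
        case False
        then have f: "e8_form (axis i 1) a = 1"
          using norm2_form(1) [OF e8_form_axis less.prems, of i] 1 by linarith
        have "e8_form (a - axis i 1) (a - axis i 1) = 2"
          using f less.prems e8_form_sym [of a "axis i 1"] by (simp add: e8_form_diff)
        moreover have "e8_form (axis i 1) (a - axis i 1) = - 1"
          using f by (simp add: e8_form_diff)
        moreover have "e8_vec (a - axis i 1) \<in> M"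
          using 1 calculation(1) by (intro less.hyps smaller) (auto simp: axis_def)
        ultimately show ?thesis
          using step [of "axis i 1" "a - axis i 1"] simple(1) [of i] by simp
      qed
    next
      case 2
      have neg2: "e8_form (- axis i 1) (- axis i 1) = 2"
        by (simp add: e8_form_minus)
      show ?thesis
      proof (cases "e8_form (axis i 1) a = - 2")
        case True
        then have "- axis i 1 = a"
          using norm2_form [OF neg2 less.prems] by (simp add: e8_form_minus)
        then show ?thesis
          using simple(2) [of i] by simp
      next
        case False
        then have f: "e8_form (axis i 1) a = - 1"
          using norm2_form(2) [OF e8_form_axis less.prems, of i] 2 by linarith
        have "e8_form (a + axis i 1) (a + axis i 1) = 2"
          using f less.prems e8_form_sym [of a "axis i 1"] by (simp add: e8_form_add)
        moreover have "e8_form (- axis i 1) (a + axis i 1) = - 1"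
          using f by (simp add: e8_form_add e8_form_minus)
        moreover have "e8_vec (a + axis i 1) \<in> M"
          using 2 calculation(1) by (intro less.hyps smaller) (auto simp: axis_def)
        ultimately show ?thesis
          using step [of "- axis i 1" "a + axis i 1"] simple(2) [of i] neg2 by simp
      qed
    qed
  qed
  show ?thesis
  proof (induction x rule: e8_induct)
    case (cartan h)
    have co: "coroot (axis i 1) \<in> M" for i
    proof -
      have "e8_scale (- 1) (e8_bracket (e8_vec (axis i 1)) (e8_vec (- axis i 1))) = (coroot (axis i 1) :: 'f e8_alg)"
        by (simp add: e8_vec_bracket e8_form_minus e8.scale_minus_left)
      then show ?thesis
        by (metis bracket scale simple)
    qed
    have "(\<Sum>i\<in>S. e8_scale (h $ i) (coroot (axis i 1))) \<in> M" if "finite S" for S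
      using that
    proof (induction S rule: finite_induct)
      case empty
      show ?case using scale [OF co, of 0] by simp
    qed (auto intro: add scale co)
    moreover have "e8_cartan h = (\<Sum>i\<in>UNIV. e8_scale (h $ i) (coroot (axis i 1)))"
      by (simp add: coroot_def e8_cartan_def prod_eq_iff fst_sum snd_sum vec_eq_iff axis_def
          if_distrib [where f = of_int] if_distrib [where f = "\<lambda>t. _ * t"] cong: if_cong)
    ultimately show ?case
      by simp
  qed (auto intro: add scale roots)
qed


subsection \<open>A weight basis of the octonions and the roots of the off-diagonal matrices\<close>

text \<open>
  With \<open>w\<^sup>2 = \<ell>\<^sup>2\<close>, the pair \<open>(x, s)\<close> stands for the null octonion \<open>(x \<plusminus> x\<ell>/w)/2\<close>, the sign being
  \<open>+\<close> iff \<open>s\<close>.  These are weight vectors for the Cartan subalgebra spanned by the diagonal matrices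
  of subscripts \<open>\<ell>\<close> and \<open>x, x\<ell>\<close>.  \<open>wt_mul m n = (c, k)\<close> says that the conjugate of the product
  of \<open>m\<close> and \<open>n\<close> is \<open>c\<close> times \<open>k\<close>.
\<close>

type_synonym wt = "qunit \<times> bool"

definition qsign :: "qunit \<Rightarrow> qunit \<Rightarrow> int" where
  "qsign x y = (if (x, y) \<in> {(Qi, Qj), (Qj, Qk), (Qk, Qi)} then 1 else - 1)"

definition wt_mul :: "wt \<Rightarrow> wt \<Rightarrow> int \<times> wt" where
  "wt_mul = (\<lambda>(x, s) (y, t).
     if y = Q1 then (if s \<noteq> t then 0 else if x = Q1 then 1 else - 1, if x = Q1 then (Q1, \<not> s) else (x, s))
     else if x = Q1 then (if s = t then 0 else - 1, (y, t))
     else if x = y then (if s = t then 0 else - 1, (Q1, \<not> t))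
     else (if s = t then - qsign x y else 0, (snd (qmul x y), \<not> s)))"

text \<open>
  The weight of \<open>(x, s)\<close> in the off-diagonal matrices of type \<open>l\<close> is \<open>\<plusminus>rootK l x / 2\<close> for the first algebra
  and \<open>\<plusminus>rootL l x / 2\<close> for the second, in coordinates with respect to the simple roots.  The simple roots
  were chosen so that they are all roots of off-diagonal matrices.
\<close>

fun rootK :: "lang \<Rightarrow> qunit \<Rightarrow> int list" where
  "rootK LD Q1 = [2, 3, 5, 7, 5, 3, 2, 1]"
| "rootK LD Qi = [0, 1, 1, 1, 1, 1, 0, 1]"
| "rootK LD Qj = [0, - 1, - 1, - 3, - 3, - 3, - 2, - 1]"
| "rootK LD Qk = [2, 3, 3, 5, 3, 3, 2, 1]"
| "rootK LE Q1 = [- 2, - 3, - 4, - 5, - 3, - 2, - 1, - 1]"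
| "rootK LE Qi = [0, 1, 2, 3, 3, 2, 1, 1]"
| "rootK LE Qj = [0, - 1, 0, - 1, - 1, - 2, - 1, - 1]"
| "rootK LE Qk = [2, 3, 4, 7, 5, 4, 3, 1]"
| "rootK LF Q1 = [0, 0, - 1, - 2, - 2, - 1, - 1, 0]"
| "rootK LF Qi = [- 2, - 2, - 3, - 4, - 2, - 1, - 1, 0]"
| "rootK LF Qj = [- 2, - 4, - 5, - 8, - 6, - 5, - 3, - 2]"
| "rootK LF Qk = [0, 0, - 1, 0, 0, 1, 1, 0]"

fun rootL :: "lang \<Rightarrow> qunit \<Rightarrow> int list" where
  "rootL LD Q1 = [0, 1, 1, 1, 1, 1, 2, 1]"
| "rootL LD Qi = [0, - 1, - 1, - 1, - 1, - 1, 0, 1]"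
| "rootL LD Qj = [2, 1, 3, 3, 3, 3, 2, 1]"
| "rootL LD Qk = [- 2, - 3, - 3, - 5, - 5, - 3, - 2, - 1]"
| "rootL LE Q1 = [0, 1, 0, 1, 1, 0, - 1, - 1]"
| "rootL LE Qi = [0, 1, 0, 1, 1, 0, 1, 1]"
| "rootL LE Qj = [2, 3, 4, 5, 5, 4, 3, 1]"
| "rootL LE Qk = [- 2, - 1, - 2, - 3, - 3, - 2, - 1, - 1]"
| "rootL LF Q1 = [0, - 2, - 1, - 2, - 2, - 1, - 1, 0]"
| "rootL LF Qi = [0, 0, - 1, 0, 0, - 1, - 1, 0]"
| "rootL LF Qj = [2, 2, 3, 4, 4, 3, 1, 0]"
| "rootL LF Qk = [- 2, - 2, - 3, - 4, - 4, - 3, - 3, - 2]"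


text \<open>
  The signs solve the linear system over the field with two elements that expresses
  \<open>off_rule_check\<close> below; the table argument says whether both weights have equal signs.
\<close>

fun root_sign_table :: "lang \<Rightarrow> bool \<Rightarrow> int list list" where
  "root_sign_table LD True = [[1, - 1, 1, 1], [- 1, 1, - 1, 1], [1, 1, - 1, - 1], [1, - 1, 1, 1]]"
| "root_sign_table LD False = [[1, - 1, 1, 1], [1, - 1, 1, - 1], [- 1, - 1, 1, 1], [1, - 1, 1, 1]]"
| "root_sign_table LE True = [[- 1, 1, 1, - 1], [1, 1, 1, 1], [1, - 1, - 1, 1], [- 1, 1, 1, - 1]]"
| "root_sign_table LE False = [[1, 1, 1, 1], [1, - 1, - 1, 1], [1, 1, 1, 1], [1, 1, 1, 1]]"
| "root_sign_table LF True = [[1, 1, - 1, - 1], [1, - 1, 1, 1], [- 1, - 1, 1, - 1], [- 1, 1, - 1, 1]]"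
| "root_sign_table LF False = [[- 1, 1, - 1, 1], [- 1, - 1, 1, - 1], [1, - 1, 1, 1], [1, 1, - 1, - 1]]"

fun qindex :: "qunit \<Rightarrow> nat" where
  "qindex Q1 = 0" | "qindex Qi = 1" | "qindex Qj = 2" | "qindex Qk = 3"

definition root_sign :: "lang \<Rightarrow> wt \<Rightarrow> wt \<Rightarrow> int" where
  "root_sign l m n = root_sign_table l (snd m = snd n) ! qindex (fst m) ! qindex (fst n)"

abbreviation pm :: "bool \<Rightarrow> int" where
  "pm s \<equiv> (if s then 1 else - 1)"

text \<open>The division is exact: the last conjunct of \<open>root_list_check\<close> certifies
  that doubling the list returns the undivided sum.\<close>

definition root_list :: "lang \<Rightarrow> wt \<Rightarrow> wt \<Rightarrow> int list" where
  "root_list l m n = map2 (\<lambda>p q. (pm (snd m) * p + pm (snd n) * q) div 2) (rootK l (fst m)) (rootL l (fst n))"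

text \<open>The lattice form on coordinate lists, on which the finite checks below can be run by
  evaluation.\<close>

fun half_list :: "int list \<Rightarrow> int list \<Rightarrow> int" where
  "half_list [a1, a2, a3, a4, a5, a6, a7, a8] [b1, b2, b3, b4, b5, b6, b7, b8] =
     a1 * b1 + a2 * b2 + a3 * b3 + a4 * b4 + a5 * b5 + a6 * b6 + a7 * b7 + a8 * b8
     - (a1 * b3 + a3 * b4 + a2 * b4 + a4 * b5 + a5 * b6 + a6 * b7 + a7 * b8)"
| "half_list _ _ = 0"

fun next_lang :: "lang \<Rightarrow> lang" where
  "next_lang LD = LE" | "next_lang LE = LF" | "next_lang LF = LD"

definition qunits :: "qunit list" where
  "qunits = [Q1, Qi, Qj, Qk]"

definition wts :: "wt list" where
  "wts = List.product qunits [True, False]"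

text \<open>If the product of the null octonions vanishes, the two roots must have nonnegative
  product, which excludes that their sum is a root or 0. Otherwise the sum must be the root attached
  to the conjugated product, and the three signs together with the cocycle must give minus its
  coefficient; the minus sign is that of the matrix commutator of two consecutive types.\<close>

definition off_rule_check :: "lang \<Rightarrow> wt \<Rightarrow> wt \<Rightarrow> wt \<Rightarrow> wt \<Rightarrow> bool" where
  "off_rule_check l m n m' n' = (let a = root_list l m n; b = root_list (next_lang l) m' n';
      (c, k) = wt_mul m m'; (d, k') = wt_mul n n'; h = half_list a b
    in if c * d = 0 then h + half_list b a > - 1
       else map2 (+) a b = root_list (next_lang (next_lang l)) k k' \<and>
         root_sign l m n * root_sign (next_lang l) m' n' * root_sign (next_lang (next_lang l)) k k'
           * (if even h then 1 else - 1) = - c * d)"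

definition root_list_check :: "lang \<Rightarrow> wt \<Rightarrow> wt \<Rightarrow> bool" where
  "root_list_check l m n \<longleftrightarrow> (let a = root_list l m n; m' = (fst m, \<not> snd m); n' = (fst n, \<not> snd n) in
     half_list a a = 1 \<and> root_sign l m n * root_sign l m' n' = 1 \<and> map uminus a = root_list l m' n' \<and>
     map (\<lambda>p. p + p) a = map2 (\<lambda>p q. pm (snd m) * p + pm (snd n) * q) (rootK l (fst m)) (rootL l (fst n)))"

text \<open>The eight half weights of each type are mutually orthogonal of norm 4, so that they form a tight frame.\<close>

definition frame_check :: "lang \<Rightarrow> bool" where
  "frame_check l \<longleftrightarrow> (let ps = map (rootK l) qunits @ map (rootL l) qunits;
       e = (\<lambda>i. map (\<lambda>j. if j = i then 1 else 0) [0..<8])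
     in list_all (\<lambda>i. foldr (map2 (+)) (map (\<lambda>p. map ((*) (half_list (e i) p + half_list p (e i))) p) ps)
         (replicate 8 0) = map ((*) 4) (e i)) [0..<8])"

text \<open>There are 8^4 quadruples of weights for each type, and each type is decided by its own
  evaluation.\<close>

lemma off_rule_check_LD:
  "list_all (\<lambda>m. list_all (\<lambda>n. list_all (\<lambda>m'. list_all (off_rule_check LD m n m') wts) wts) wts) wts"
  by code_simp

lemma off_rule_check_LE:
  "list_all (\<lambda>m. list_all (\<lambda>n. list_all (\<lambda>m'. list_all (off_rule_check LE m n m') wts) wts) wts) wts"
  by code_simp

lemma off_rule_check_LF:
  "list_all (\<lambda>m. list_all (\<lambda>n. list_all (\<lambda>m'. list_all (off_rule_check LF m n m') wts) wts) wts) wts"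
  by code_simp

lemma root_list_checks: "list_all (\<lambda>l. list_all (\<lambda>m. list_all (root_list_check l m) wts) wts) [LD, LE, LF]"
  by code_simp

lemma root_list_distinct:
  "list_all (\<lambda>l. distinct (map (\<lambda>(m, n). root_list l m n) (List.product wts wts))) [LD, LE, LF]"
  by code_simp

lemma frame_checks: "list_all frame_check [LD, LE, LF]"
  by code_simp


section \<open>Transfer of the finite checks from lists to the root lattice\<close>

lemma lang_exhaust_next: "l \<noteq> m \<Longrightarrow> m = next_lang l \<or> m = next_lang (next_lang l)"
  by (cases l; cases m) auto

lemma next_lang_3 [simp]: "next_lang (next_lang (next_lang l)) = l"
  by (cases l) auto

lemma next_lang_neq [simp]: "next_lang l \<noteq> l" "l \<noteq> next_lang l"
    "next_lang (next_lang l) \<noteq> l" "l \<noteq> next_lang (next_lang l)"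
    "next_lang (next_lang l) \<noteq> next_lang l" "next_lang l \<noteq> next_lang (next_lang l)"
  by (cases l; simp)+

lemma UNIV_qunit: "UNIV = {Q1, Qi, Qj, Qk}"
  using qunit.exhaust by auto

lemma list_all_wts: "list_all P wts \<longleftrightarrow> (\<forall>m. P m)"
proof -
  have "set wts = UNIV"
    by (auto simp: wts_def qunits_def UNIV_qunit UNIV_Times_UNIV [symmetric] UNIV_bool simp del: UNIV_Times_UNIV)
  then show ?thesis
    by (simp add: list_all_iff)
qed

lemma list_all_langs: "list_all P [LD, LE, LF] \<longleftrightarrow> (\<forall>l. P l)"
  by (auto intro: lang.induct)

text \<open>The default branch belongs to 8, which is the zero of the numeral type.\<close>

definition index8 :: "8 \<Rightarrow> nat" where
  "index8 i = (if i = 1 then 0 else if i = 2 then 1 else if i = 3 then 2 else if i = 4 then 3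
     else if i = 5 then 4 else if i = 6 then 5 else if i = 7 then 6 else 7)"

definition vec8 :: "int list \<Rightarrow> root_lattice" where
  "vec8 xs = (\<chi> i. xs ! index8 i)"

lemma length_8_cases:
  assumes "length xs = 8"
  obtains a1 a2 a3 a4 a5 a6 a7 a8 where "xs = [a1, a2, a3, a4, a5, a6, a7, a8]"
  using assms by (auto simp: length_Suc_conv eval_nat_numeral)

lemma index8_simps [simp]: "index8 1 = 0" "index8 2 = 1" "index8 3 = 2" "index8 4 = 3" "index8 5 = 4"
  "index8 6 = 5" "index8 7 = 6" "index8 8 = 7"
  by (simp_all add: index8_def)

lemma forall_8: "(\<forall>i::8. P i) \<longleftrightarrow> P 1 \<and> P 2 \<and> P 3 \<and> P 4 \<and> P 5 \<and> P 6 \<and> P 7 \<and> P 8"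
proof -
  have "(\<forall>i::8. P i) \<longleftrightarrow> (\<forall>i\<in>{1, 2, 3, 4, 5, 6, 7, 8}. P i)"
    unfolding UNIV_8 [symmetric] by simp
  then show ?thesis
    by simp
qed

lemma index8_less: "index8 i < 8"
  by (simp add: index8_def)

lemma sum_8: "(\<Sum>i\<in>(UNIV :: 8 set). f i) = f 1 + f 2 + f 3 + f 4 + f 5 + f 6 + f 7 + f 8"
  unfolding UNIV_8 by (simp add: add.assoc)

lemma e8_half_vec8:
  assumes "length xs = 8" "length ys = 8"
  shows "e8_half (vec8 xs) (vec8 ys) = half_list xs ys"
  by (rule length_8_cases [OF assms(1)], rule length_8_cases [OF assms(2)])
    (simp add: e8_half_def sum_8 vec8_def)

lemma e8_form_vec8:
  assumes "length xs = 8" "length ys = 8"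
  shows "e8_form (vec8 xs) (vec8 ys) = half_list xs ys + half_list ys xs"
  by (simp add: e8_form_def e8_half_vec8 assms)

lemma vec8_inject: "length xs = 8 \<Longrightarrow> length ys = 8 \<Longrightarrow> vec8 xs = vec8 ys \<longleftrightarrow> xs = ys"
  by (erule length_8_cases, erule length_8_cases) (simp add: vec_eq_iff forall_8 vec8_def)

lemma vec8_map2: "length xs = 8 \<Longrightarrow> length ys = 8 \<Longrightarrow> vec8 (map2 f xs ys) = (\<chi> i. f (vec8 xs $ i) (vec8 ys $ i))"
  by (simp add: vec8_def vec_eq_iff index8_less)

lemma vec8_map: "length xs = 8 \<Longrightarrow> vec8 (map f xs) = (\<chi> i. f (vec8 xs $ i))"
  by (simp add: vec8_def vec_eq_iff index8_less)

lemma length_half_weights [simp]: "length (rootK l x) = 8" "length (rootL l x) = 8"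
  by (cases l; cases x; simp)+

lemma length_root_list [simp]: "length (root_list l m n) = 8"
  by (simp add: root_list_def)

definition root_vec :: "lang \<Rightarrow> wt \<Rightarrow> wt \<Rightarrow> root_lattice" where
  "root_vec l m n = vec8 (root_list l m n)"

abbreviation wt_neg :: "wt \<Rightarrow> wt" where
  "wt_neg m \<equiv> (fst m, \<not> snd m)"

lemma root_list_checked: "root_list_check l m n"
  using root_list_checks unfolding list_all_wts list_all_langs by blast

lemma e8_form_root_vec [simp]: "e8_form (root_vec l m n) (root_vec l m n) = 2"
  and root_sign_neg: "root_sign l m n * root_sign l (wt_neg m) (wt_neg n) = 1"
  and root_vec_neg: "root_vec l (wt_neg m) (wt_neg n) = - root_vec l m n"
  and root_vec_double: "root_vec l m n + root_vec l m n
    = (\<chi> i. pm (snd m) * vec8 (rootK l (fst m)) $ i + pm (snd n) * vec8 (rootL l (fst n)) $ i)"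
proof -
  note chk = root_list_checked [of l m n, unfolded root_list_check_def Let_def]
  show "e8_form (root_vec l m n) (root_vec l m n) = 2"
    using chk by (simp add: root_vec_def e8_form_def e8_half_vec8)
  show "root_sign l m n * root_sign l (wt_neg m) (wt_neg n) = 1"
    using chk by blast
  have "vec8 (map uminus (root_list l m n)) = root_vec l (wt_neg m) (wt_neg n)"
    using chk by (simp add: root_vec_def)
  then show "root_vec l (wt_neg m) (wt_neg n) = - root_vec l m n"
    by (simp add: vec8_map root_vec_def vec_eq_iff)
  have "vec8 (map (\<lambda>p. p + p) (root_list l m n)) =
     vec8 (map2 (\<lambda>p q. pm (snd m) * p + pm (snd n) * q) (rootK l (fst m)) (rootL l (fst n)))"
    using chk by metis
  then show "root_vec l m n + root_vec l m n
    = (\<chi> i. pm (snd m) * vec8 (rootK l (fst m)) $ i + pm (snd n) * vec8 (rootL l (fst n)) $ i)"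
    unfolding vec8_map2 [OF length_half_weights] vec8_map [OF length_root_list]
    by (simp add: root_vec_def vec_eq_iff)
qed

lemma root_sign_square: "root_sign l m n * root_sign l m n = 1"
  using root_sign_neg [of l m n] by (auto simp: zmult_eq_1_iff)

lemma root_vec_nonzero [simp]: "root_vec l m n \<noteq> 0"
  using e8_form_root_vec [of l m n] by (intro notI) simp

lemma root_vec_inject: "root_vec l m n = root_vec l m' n' \<longleftrightarrow> m = m' \<and> n = n'"
proof
  have "distinct (map (\<lambda>(m, n). root_list l m n) (List.product wts wts))"
    using root_list_distinct unfolding list_all_langs by blast
  moreover have "set (List.product wts wts) = UNIV"
    using list_all_wts [of "\<lambda>m. m \<in> set wts"] by (auto simp: list_all_iff)
  ultimately have "inj (\<lambda>(m, n). root_list l m n)"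
    by (simp add: distinct_map)
  moreover assume "root_vec l m n = root_vec l m' n'"
  then have "root_list l m n = root_list l m' n'"
    by (simp add: root_vec_def vec8_inject)
  ultimately show "m = m' \<and> n = n'"
    by (auto dest: injD [where x = "(m, n)" and y = "(m', n')"])
qed simp

lemma off_rule_checked: "off_rule_check l m n m' n'"
  using off_rule_check_LD off_rule_check_LE off_rule_check_LF
  unfolding list_all_wts by (cases l) blast+

lemma root_vec_add:
  assumes "fst (wt_mul m m') * fst (wt_mul n n') \<noteq> 0"
  shows "root_vec l m n + root_vec (next_lang l) m' n'
      = root_vec (next_lang (next_lang l)) (snd (wt_mul m m')) (snd (wt_mul n n'))"
    and "root_sign l m n * root_sign (next_lang l) m' n' * e8_cocycle (root_vec l m n) (root_vec (next_lang l) m' n')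
      = - (fst (wt_mul m m') * fst (wt_mul n n'))
        * root_sign (next_lang (next_lang l)) (snd (wt_mul m m')) (snd (wt_mul n n'))"
proof -
  note chk = off_rule_checked [of l m n m' n', unfolded off_rule_check_def Let_def case_prod_unfold]
  have "vec8 (map2 (+) (root_list l m n) (root_list (next_lang l) m' n'))
      = root_vec (next_lang (next_lang l)) (snd (wt_mul m m')) (snd (wt_mul n n'))"
    using chk assms by (simp add: root_vec_def case_prod_unfold)
  then show "root_vec l m n + root_vec (next_lang l) m' n'
      = root_vec (next_lang (next_lang l)) (snd (wt_mul m m')) (snd (wt_mul n n'))"
    by (simp add: vec8_map2 root_vec_def vec_eq_iff)
  show "root_sign l m n * root_sign (next_lang l) m' n' * e8_cocycle (root_vec l m n) (root_vec (next_lang l) m' n')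
      = - (fst (wt_mul m m') * fst (wt_mul n n'))
        * root_sign (next_lang (next_lang l)) (snd (wt_mul m m')) (snd (wt_mul n n'))"
  proof -
    have mult: "a * b * e = - (p * q) * c" if "a * b * c * e = - p * q" "c * c = 1" for a b c e p q :: int
    proof -
      have "a * b * e * (c * c) = (a * b * c * e) * c"
        by (simp add: mult_ac)
      then show ?thesis
        using that by simp
    qed
    show ?thesis
      by (rule mult [OF _ root_sign_square]) (use chk assms in \<open>simp add: e8_cocycle_def root_vec_def e8_half_vec8\<close>)
  qed
qed

lemma root_vec_no_add:
  assumes "fst (wt_mul m m') * fst (wt_mul n n') = 0"
  shows "e8_form (root_vec l m n) (root_vec (next_lang l) m' n') > - 1"
  using off_rule_checked [of l m n m' n', unfolded off_rule_check_def Let_def case_prod_unfold] assms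
  by (simp add: root_vec_def e8_form_vec8)

lemma nth_foldr_map2:
  assumes "\<And>xs. xs \<in> set xss \<Longrightarrow> length xs = k" "j < k"
  shows "foldr (map2 (+)) xss (replicate k 0) ! j = (\<Sum>xs\<leftarrow>xss. xs ! j :: int)"
proof -
  have "length (foldr (map2 (+)) xss (replicate k 0)) = k
      \<and> foldr (map2 (+)) xss (replicate k 0) ! j = (\<Sum>xs\<leftarrow>xss. xs ! j :: int)"
    using assms by (induction xss) auto
  then show ?thesis ..
qed

text \<open>The tight frame identity in coordinates: for an orthogonal system of eight vectors p of
  norm 4, the sum of (e|p) p is 4 e. It recovers a linear form on the lattice from its values on the
  half weights.\<close>

lemma half_weight_frame:
  "(\<Sum>x\<in>UNIV. e8_form (axis i 1) (vec8 (rootK l x)) * vec8 (rootK l x) $ j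
     + e8_form (axis i 1) (vec8 (rootL l x)) * vec8 (rootL l x) $ j) = (if i = j then 4 else 0)"
proof -
  define e where "e = map (\<lambda>j. if j = index8 i then 1 else 0 :: int) [0..<8]"
  have inj: "index8 j = index8 i \<longleftrightarrow> j = i" for j
  proof -
    have "\<forall>i j. index8 j = index8 i \<longleftrightarrow> j = i"
      unfolding forall_8 by simp
    then show ?thesis by blast
  qed
  have e: "axis i 1 = vec8 e"
    unfolding vec_eq_iff vec8_def e_def using index8_less by (simp add: axis_def inj)
  have [simp]: "length e = 8"
    by (simp add: e_def)
  define ps where "ps = map (rootK l) qunits @ map (rootL l) qunits"
  have len: "p \<in> set ps \<Longrightarrow> length p = 8" for p
    by (auto simp: ps_def)
  have "frame_check l"
    using frame_checks unfolding list_all_langs by blast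
  then have "foldr (map2 (+)) (map (\<lambda>p. map ((*) (half_list e p + half_list p e)) p) ps) (replicate 8 0)
      = map ((*) 4) e"
    using index8_less [of i] unfolding frame_check_def Let_def list_all_iff ps_def e_def by simp
  then have "map ((*) 4) e ! index8 j
      = (\<Sum>xs\<leftarrow>map (\<lambda>p. map ((*) (half_list e p + half_list p e)) p) ps. xs ! index8 j)"
    using index8_less [of j] len by (subst nth_foldr_map2 [where k = 8, symmetric]) auto
  also have "\<dots> = (\<Sum>p\<leftarrow>ps. (half_list e p + half_list p e) * p ! index8 j)"
    using index8_less [of j] len by (simp add: comp_def cong: map_cong)
  also have "\<dots> = (\<Sum>p\<leftarrow>ps. e8_form (axis i 1) (vec8 p) * vec8 p $ j)"
    using len by (intro arg_cong [where f = sum_list] map_cong) (simp_all add: e e8_form_vec8, simp add: vec8_def)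
  also have "\<dots> = (\<Sum>x\<in>UNIV. e8_form (axis i 1) (vec8 (rootK l x)) * vec8 (rootK l x) $ j
     + e8_form (axis i 1) (vec8 (rootL l x)) * vec8 (rootL l x) $ j)"
    by (simp add: ps_def qunits_def UNIV_qunit)
  finally show ?thesis
    using index8_less [of j] by (auto simp: e_def inj split: if_splits)
qed

section \<open>Root vectors with octonion structure constants\<close>

definition wt_root :: "lang \<Rightarrow> wt \<Rightarrow> wt \<Rightarrow> e8_root" where
  "wt_root l m n = Abs_e8_root (root_vec l m n)"

lemma rt_wt_root [simp]: "rt (wt_root l m n) = root_vec l m n"
  unfolding wt_root_def by (rule rt_Abs) simp

text \<open>The signs absorb the cocycle, so that root vectors of consecutive types multiply by the
  coefficients of \<open>wt_mul\<close> alone.\<close>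

definition off_vec :: "lang \<Rightarrow> wt \<Rightarrow> wt \<Rightarrow> 'f::field e8_alg" where
  "off_vec l m n = e8_scale (of_int (root_sign l m n)) (e8_vec (root_vec l m n))"

lemma off_vec_bracket:
  "e8_bracket (off_vec l m n) (off_vec (next_lang l) m' n') =
    e8_scale (- of_int (fst (wt_mul m m') * fst (wt_mul n n')))
      (off_vec (next_lang (next_lang l)) (snd (wt_mul m m')) (snd (wt_mul n n')) :: 'f::field_char_0 e8_alg)"
proof (cases "fst (wt_mul m m') * fst (wt_mul n n') = 0")
  case True
  have f: "e8_form (root_vec l m n) (root_vec (next_lang l) m' n') > - 1"
    by (rule root_vec_no_add [OF True])
  then have "root_vec l m n + root_vec (next_lang l) m' n' \<noteq> 0"
    using norm2_form(4) [of "root_vec l m n" "root_vec (next_lang l) m' n'"] by auto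
  moreover have "e8_vec (root_vec l m n + root_vec (next_lang l) m' n') = (0 :: 'f e8_alg)"
    using f norm2_form(5) [of "root_vec l m n" "root_vec (next_lang l) m' n'"]
    by (intro e8_vec_not_root) auto
  ultimately show ?thesis
    unfolding True by (simp add: off_vec_def e8_vec_bracket e8_bracket_scale_left e8_bracket_scale_right)
next
  case False
  note r = root_vec_add [OF False, of l]
  have "root_vec l m n + root_vec (next_lang l) m' n' \<noteq> 0"
    unfolding r by simp
  then have "e8_bracket (off_vec l m n) (off_vec (next_lang l) m' n') =
    (e8_scale (of_int (root_sign l m n * root_sign (next_lang l) m' n'
      * e8_cocycle (root_vec l m n) (root_vec (next_lang l) m' n')))
      (e8_vec (root_vec (next_lang (next_lang l)) (snd (wt_mul m m')) (snd (wt_mul n n')))) :: 'f e8_alg)"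
    by (simp add: off_vec_def e8_vec_bracket e8_bracket_scale_left e8_bracket_scale_right r(1) mult_ac)
  then show ?thesis
    unfolding r(2) by (simp add: off_vec_def)
qed

lemma e8_inv_form_off_vec:
  "e8_inv_form (off_vec l m n) (off_vec l m' n') = (if m' = wt_neg m \<and> n' = wt_neg n then - 1 else 0 :: 'f::field_char_0)"
proof -
  have "root_vec l m n + root_vec l m' n' = 0 \<longleftrightarrow> root_vec l m' n' = root_vec l (wt_neg m) (wt_neg n)"
    unfolding root_vec_neg by (metis add.commute eq_neg_iff_add_eq_0)
  then have "e8_inv_form (e8_vec (root_vec l m n)) (e8_vec (root_vec l m' n'))
      = (if m' = wt_neg m \<and> n' = wt_neg n then - 1 else 0 :: 'f)"
    unfolding root_vec_inject by (simp add: e8_inv_form_vec)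
  moreover have "of_int (root_sign l m n) * of_int (root_sign l (wt_neg m) (wt_neg n)) = (1 :: 'f)"
    using root_sign_neg [of l m n] by (metis of_int_1 of_int_mult)
  ultimately show ?thesis
    by (auto simp: off_vec_def e8_inv_form_scale mult.commute)
qed

lemma e8_inv_form_off_vec_next:
  "e8_inv_form (off_vec l m n) (off_vec (next_lang l) m' n') = (0 :: 'f::field_char_0)"
proof -
  have "root_vec l m n + root_vec (next_lang l) m' n' \<noteq> 0"
  proof (cases "fst (wt_mul m m') * fst (wt_mul n n') = 0")
    case True
    then show ?thesis
      using root_vec_no_add [OF True, of l] norm2_form(4) [of "root_vec l m n" "root_vec (next_lang l) m' n'"]
      by auto
  next
    case False
    show ?thesis
      unfolding root_vec_add [OF False, of l] by simp
  qed
  then show ?thesis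
    by (simp add: off_vec_def e8_inv_form_scale e8_inv_form_vec)
qed

text \<open>Sums and differences of roots with equal and with opposite signs isolate the half
  weights of either algebra, and the tight frame then gives 4 h = 0.\<close>

lemma root_vec_spans:
  fixes h :: "'f::field_char_0 ^ 8"
  assumes "\<And>m n. (\<Sum>i\<in>UNIV. h $ i * of_int (e8_form (axis i 1) (root_vec l m n))) = 0"
  shows "h = 0"
proof -
  define ev where "ev a = (\<Sum>i\<in>UNIV. h $ i * of_int (e8_form (axis i 1) a))" for a
  have ev_add: "ev (a + b) = ev a + ev b" for a b
    by (simp add: ev_def e8_form_add distrib_left sum.distrib)
  have ev_minus: "ev (- a) = - ev a" for a
    by (simp add: ev_def e8_form_minus sum_negf)
  have comb: "ev (vec8 (rootK l x)) = 0 \<and> ev (vec8 (rootL l y)) = 0" for x y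
  proof -
    have 1: "root_vec l (x, True) (y, True) + root_vec l (x, True) (y, True)
        = vec8 (rootK l x) + vec8 (rootL l y)"
      unfolding root_vec_double by (simp add: vec_eq_iff)
    have 2: "root_vec l (x, True) (y, False) + root_vec l (x, True) (y, False)
        = vec8 (rootK l x) + - vec8 (rootL l y)"
      unfolding root_vec_double by (simp add: vec_eq_iff)
    have z: "ev (root_vec l m n + root_vec l m n) = 0" for m n
      unfolding ev_add using assms by (simp add: ev_def)
    have "ev (vec8 (rootK l x)) + ev (vec8 (rootL l y)) = 0" "ev (vec8 (rootK l x)) - ev (vec8 (rootL l y)) = 0"
      using z [of "(x, True)" "(y, True)", unfolded 1] z [of "(x, True)" "(y, False)", unfolded 2 ev_add ev_minus]
      by (simp_all add: ev_add)
    then have "2 * ev (vec8 (rootK l x)) = 0" "ev (vec8 (rootK l x)) = ev (vec8 (rootL l y))"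
      by (simp_all add: add_eq_0_iff)
    then show ?thesis
      by simp
  qed
  have "4 * h $ j = 0" for j
  proof -
    have "4 * h $ j = (\<Sum>i\<in>UNIV. h $ i * of_int (if i = j then 4 else 0))"
      by (simp add: if_distrib [where f = of_int] if_distrib [where f = "\<lambda>t. _ * t"] cong: if_cong)
    also have "\<dots> = (\<Sum>i\<in>UNIV. \<Sum>x\<in>UNIV. h $ i * of_int (e8_form (axis i 1) (vec8 (rootK l x))) * of_int (vec8 (rootK l x) $ j)
        + h $ i * of_int (e8_form (axis i 1) (vec8 (rootL l x))) * of_int (vec8 (rootL l x) $ j))"
      unfolding half_weight_frame [symmetric, of _ j l]
      by (simp add: sum_distrib_left distrib_left mult.assoc)
    also have "\<dots> = (\<Sum>x\<in>UNIV. ev (vec8 (rootK l x)) * of_int (vec8 (rootK l x) $ j)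
        + ev (vec8 (rootL l x)) * of_int (vec8 (rootL l x) $ j))"
      by (subst sum.swap) (simp add: ev_def sum.distrib sum_distrib_right)
    also have "\<dots> = 0"
      using comb by simp
    finally show ?thesis .
  qed
  then show ?thesis
    by (simp add: vec_eq_iff)
qed

text \<open>The 64 roots of a single type are closed under negation and already span the Cartan
  subalgebra, as \<open>e8_centralizer_eq_0\<close> requires.\<close>

lemma off_vec_centralizer_eq_0:
  fixes x :: "'f::field_char_0 e8_alg"
  assumes "\<And>m n. e8_bracket x (off_vec l m n) = 0"
  shows "x = 0"
proof (rule e8_centralizer_eq_0 [where S = "range (\<lambda>(m, n). wt_root l m n)"])
  fix \<beta>
  assume "\<beta> \<in> range (\<lambda>(m, n). wt_root l m n)"
  then obtain m n where \<beta>: "\<beta> = wt_root l m n" by auto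
  have "of_int (root_sign l m n) \<noteq> (0 :: 'f)"
    using root_sign_neg [of l m n] by auto
  then show "e8_bracket x (e8_vec (rt \<beta>)) = 0"
    using assms [of m n] by (simp add: \<beta> off_vec_def e8_bracket_scale_right)
  have "e8_neg \<beta> = wt_root l (wt_neg m) (wt_neg n)"
    unfolding rt_inject [symmetric] by (simp add: \<beta> root_vec_neg)
  then show "e8_neg \<beta> \<in> range (\<lambda>(m, n). wt_root l m n)"
    by (auto intro: range_eqI [where x = "(wt_neg m, wt_neg n)"])
next
  fix a :: root_lattice
  assume a: "a \<noteq> 0"
  show "\<exists>\<beta>\<in>range (\<lambda>(m, n). wt_root l m n). e8_form a (rt \<beta>) \<noteq> 0"
  proof (rule ccontr)
    assume n: "\<not> ?thesis"
    have z: "e8_form a (root_vec l m n) = 0" for m n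
    proof -
      have "wt_root l m n \<in> range (\<lambda>(m, n). wt_root l m n)"
        by (rule range_eqI [where x = "(m, n)"]) simp
      with n show ?thesis
        by (metis rt_wt_root)
    qed
    have "(\<Sum>i\<in>UNIV. of_int (a $ i) * of_int (e8_form (axis i 1) (root_vec l m n))) = (0 :: real)" for m n
      using arg_cong [OF z [of m n, unfolded e8_form_expand [of a]], where f = "of_int :: int \<Rightarrow> real"] by simp
    then have "(\<chi> i. of_int (a $ i)) = (0 :: real ^ 8)"
      by (intro root_vec_spans [of _ l]) simp
    with a show False
      by (simp add: vec_eq_iff)
  qed
next
  fix h :: "'f ^ 8"
  assume "\<forall>\<beta>\<in>range (\<lambda>(m, n). wt_root l m n). e8_eval h \<beta> = 0"
  then show "h = 0"
    by (intro root_vec_spans [of h l]) (force simp: e8_eval_def)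
qed


subsection \<open>The off-diagonal matrices as elements of E8\<close>

text \<open>Coefficients of a unit in the basis of null octonions: x is the sum of (x, +) and (x,
  -), and x\<ell> is w times their difference.\<close>

fun emb :: "'f::field \<Rightarrow> 'k ounit \<Rightarrow> wt \<Rightarrow> 'f" where
  "emb w (Quat x) m = (if fst m = x then 1 else 0)"
| "emb w (Ell x) m = (if fst m = x then if snd m then w else - w else 0)"

lemma UNIV_ounit: "(UNIV :: 'k ounit set) = Quat ` {Q1, Qi, Qj, Qk} \<union> Ell ` {Q1, Qi, Qj, Qk}"
proof -
  have "a \<in> range Quat \<union> range Ell" for a :: "'k ounit"
    by (cases a) auto
  then show ?thesis
    unfolding UNIV_qunit [symmetric] by blast
qed

lemma forall_ounit: "(\<forall>a. P a) \<longleftrightarrow> (\<forall>x\<in>{Q1, Qi, Qj, Qk}. P (Quat x) \<and> P (Ell x))"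
  using ounit.exhaust unfolding UNIV_qunit [symmetric] by (metis UNIV_I)

lemma sum_wt: "(\<Sum>m\<in>UNIV. f m) = (\<Sum>x\<in>{Q1, Qi, Qj, Qk}. f (x, True) + f (x, False))"
proof -
  have "(\<Sum>m\<in>UNIV. f m) = (\<Sum>x\<in>UNIV. \<Sum>s\<in>UNIV. f (x, s))"
    by (simp add: sum.cartesian_product)
  then show ?thesis
    by (simp add: UNIV_qunit UNIV_bool add.commute)
qed

text \<open>Certifies the table \<open>wt_mul\<close> against octonion multiplication, conjugation
  included. The hypothesis on w enters in the products of two units of the form x\<ell>.\<close>

lemma emb_umul:
  fixes w :: "'f::real_field" and a b :: "'k::oct_alg ounit"
  assumes w: "w * w = of_real (ell_sq TYPE('k))"
  shows "(\<Sum>m\<in>UNIV. \<Sum>m'\<in>UNIV. if snd (wt_mul m m') = k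
        then emb w a m * emb w b m' * of_int (fst (wt_mul m m')) else 0)
    = of_real (uconj (snd (umul a b)) * fst (umul a b)) * emb w (snd (umul a b)) k"
proof -
  obtain z u where k: "k = (z, u)" by force
  show ?thesis
    unfolding k
    by (cases a; cases b; rename_tac x y; case_tac x; case_tac y; cases z; cases u)
      (simp_all add: sum_wt wt_mul_def qsign_def uconj_def qconj_def w)
qed


section \<open>Linearity of the tensor operations\<close>

lemma tensor_induct [case_names add scale tens]:
  fixes t :: "('k, 'l) tensor"
  assumes add: "\<And>s t. P s \<Longrightarrow> P t \<Longrightarrow> P (s + t)"
    and scale: "\<And>c t. P t \<Longrightarrow> P (c *\<^sub>R t)"
    and tens: "\<And>a A. P (tens a A)"
  shows "P t"
proof -
  have 0: "P 0"
    using scale [OF tens, of 0] by simp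
  have *: "P (\<Sum>u\<in>S. t $ u *\<^sub>R tens (fst u) (snd u))" if "finite S" for S
    using that by (induction S rule: finite_induct) (auto intro: 0 add scale tens)
  have "(\<Sum>u\<in>UNIV. t $ u *\<^sub>R tens (fst u) (snd u)) = t"
    by (simp add: tens_def vec_eq_iff axis_def if_distrib [where f = "\<lambda>x. _ * x"] cong: if_cong)
  then show ?thesis
    using * [OF finite] by metis
qed

lemma tmul_add: "tmul (s + s') t = tmul s t + tmul s' t" "tmul t (s + s') = tmul t s + tmul t s'"
  by (simp_all add: tmul_def case_prod_unfold distrib_left distrib_right scaleR_add_left sum.distrib)

lemma tmul_scaleR: "tmul (c *\<^sub>R s) t = c *\<^sub>R tmul s t" "tmul t (c *\<^sub>R s) = c *\<^sub>R tmul t s"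
  by (simp_all add: tmul_def case_prod_unfold scaleR_right.sum mult_ac)

lemma tmul_tens: "tmul (tens a A) (tens b B)
    = (fst (umul a b) * fst (umul A B)) *\<^sub>R tens (snd (umul a b)) (snd (umul A B))"
proof -
  have "(\<Sum>p\<in>UNIV. \<Sum>q\<in>UNIV. (tens a A $ p * tens b B $ q * fst (umul (fst p) (fst q)) * fst (umul (snd p) (snd q)))
       *\<^sub>R tens (snd (umul (fst p) (fst q))) (snd (umul (snd p) (snd q))))
    = (\<Sum>p\<in>UNIV. \<Sum>q\<in>UNIV. if p = (a, A) then if q = (b, B) then 
        (fst (umul a b) * fst (umul A B)) *\<^sub>R tens (snd (umul a b)) (snd (umul A B)) else 0 else 0)"
    by (intro sum.cong refl) (auto simp: tens_def axis_def)
  also have "\<dots> = (\<Sum>p\<in>UNIV. if p = (a, A) then \<Sum>q\<in>UNIV. if q = (b, B) then 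
        (fst (umul a b) * fst (umul A B)) *\<^sub>R tens (snd (umul a b)) (snd (umul A B)) else 0 else 0)"
    by (intro sum.cong refl) simp
  also have "\<dots> = (fst (umul a b) * fst (umul A B)) *\<^sub>R tens (snd (umul a b)) (snd (umul A B))"
    by simp
  finally show ?thesis
    by (simp add: tmul_def case_prod_unfold)
qed

lemma tconj_add: "tconj (s + t) = tconj s + tconj t"
  by (simp add: tconj_def vec_eq_iff distrib_left)

lemma tconj_scaleR: "tconj (c *\<^sub>R t) = c *\<^sub>R tconj t"
  by (simp add: tconj_def vec_eq_iff)

lemma tconj_tens: "tconj (tens a A) = (uconj a * uconj A) *\<^sub>R tens a A"
  by (auto simp: tconj_def vec_eq_iff tens_def axis_def)

lemma tmul_zero [simp]: "tmul 0 t = 0" "tmul t 0 = 0"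
  using tmul_scaleR(1) [of 0 0 t] tmul_scaleR(2) [of t 0 0] by simp_all

lemma tmul_minus: "tmul (- s) t = - tmul s t" "tmul t (- s) = - tmul t s"
  using tmul_scaleR(1) [of "- 1" s t] tmul_scaleR(2) [of t "- 1" s] by simp_all

lemma tconj_zero [simp]: "tconj 0 = 0"
  using tconj_scaleR [of 0 0] by simp

lemma tconj_minus: "tconj (- t) = - tconj t"
  using tconj_scaleR [of "- 1" t] by simp

lemma tconj_tconj [simp]: "tconj (tconj t) = t"
  by (simp add: tconj_def vec_eq_iff uconj_def)

lemma scaleR_eq_e8_scale: "r *\<^sub>R x = e8_scale (of_real r) (x :: 'f::real_field e8_alg)"
  by (simp add: prod_eq_iff vec_eq_iff scaleR_conv_of_real [of r "_ :: 'f"])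

lemma e8_bracket_scaleR: "e8_bracket (r *\<^sub>R x) y = r *\<^sub>R e8_bracket x (y :: 'f::real_field e8_alg)"
  "e8_bracket y (r *\<^sub>R x) = r *\<^sub>R e8_bracket y x"
  by (simp_all add: scaleR_eq_e8_scale e8_bracket_scale_left e8_bracket_scale_right)

text \<open>Collects the terms of an expanded product that have the same target weight, which brings
  the coefficients into the shape of \<open>emb_umul\<close>.\<close>

lemma e8_scale_group:
  assumes "finite S"
  shows "(\<Sum>p\<in>S. e8_scale (f p) (V (\<kappa> p))) = (\<Sum>k\<in>UNIV. e8_scale (\<Sum>p\<in>S. if \<kappa> p = k then f p else 0) (V (k :: wt)))"
proof -
  have "(\<Sum>k\<in>UNIV. e8_scale (\<Sum>p\<in>S. if \<kappa> p = k then f p else 0) (V k))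
      = (\<Sum>p\<in>S. \<Sum>k\<in>UNIV. if k = \<kappa> p then e8_scale (f p) (V k) else 0)"
    unfolding e8.scale_sum_left by (subst sum.swap) (intro sum.cong refl; simp)
  then show ?thesis
    by simp
qed

lemma sum_reorder4:
  "(\<Sum>i\<in>A. \<Sum>j\<in>B. \<Sum>k\<in>C. \<Sum>l\<in>D. f i j k l) = (\<Sum>k\<in>C. \<Sum>i\<in>A. \<Sum>l\<in>D. \<Sum>j\<in>B. f i j k l)"
proof -
  have "(\<Sum>i\<in>A. \<Sum>j\<in>B. \<Sum>k\<in>C. \<Sum>l\<in>D. f i j k l) = (\<Sum>i\<in>A. \<Sum>k\<in>C. \<Sum>j\<in>B. \<Sum>l\<in>D. f i j k l)"
    by (intro sum.cong refl) (rule sum.swap)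
  also have "\<dots> = (\<Sum>k\<in>C. \<Sum>i\<in>A. \<Sum>j\<in>B. \<Sum>l\<in>D. f i j k l)"
    by (rule sum.swap)
  also have "\<dots> = (\<Sum>k\<in>C. \<Sum>i\<in>A. \<Sum>l\<in>D. \<Sum>j\<in>B. f i j k l)"
    by (intro sum.cong refl) (rule sum.swap)
  finally show ?thesis .
qed

text \<open>The field is abstract in order to cover the complex numbers, where w and v exist for
  either sign of \<ell>^2, and the reals with w = v = 1 in the split case.\<close>

locale e8_model =
  fixes w v :: "'f::real_field" and tK :: "'k::oct_alg itself" and tL :: "'l::oct_alg itself"
  assumes w: "w * w = of_real (ell_sq TYPE('k))" and v: "v * v = of_real (ell_sq TYPE('l))"
begin

definition off_elt :: "lang \<Rightarrow> 'k ounit \<Rightarrow> 'l ounit \<Rightarrow> 'f e8_alg" where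
  "off_elt l a A = (\<Sum>m\<in>UNIV. e8_scale (emb w a m) (\<Sum>n\<in>UNIV. e8_scale (emb v A n) (off_vec l m n)))"

definition off_map :: "lang \<Rightarrow> ('k, 'l) tensor \<Rightarrow> 'f e8_alg" where
  "off_map l t = (\<Sum>u\<in>UNIV. t $ u *\<^sub>R off_elt l (fst u) (snd u))"

lemma off_map_add: "off_map l (s + t) = off_map l s + off_map l t"
  by (simp add: off_map_def scaleR_add_left sum.distrib)

lemma off_map_scaleR: "off_map l (c *\<^sub>R t) = c *\<^sub>R off_map l t"
  by (simp add: off_map_def scaleR_right.sum)

lemma off_map_zero [simp]: "off_map l 0 = 0"
  by (simp add: off_map_def)

lemma off_map_minus: "off_map l (- t) = - off_map l t"
  using off_map_scaleR [of l "- 1" t] by simp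

lemma off_map_diff: "off_map l (s - t) = off_map l s - off_map l t"
  using off_map_add [of l s "- t"] by (simp add: off_map_minus)

lemma off_map_tens: "off_map l (tens a A) = off_elt l a A"
proof -
  have "off_map l (tens a A) = (\<Sum>u\<in>UNIV. if u = (a, A) then off_elt l a A else 0)"
    unfolding off_map_def by (intro sum.cong refl) (auto simp: tens_def axis_def)
  then show ?thesis
    by simp
qed

lemma off_elt_bracket:
  "e8_bracket (off_elt l a A) (off_elt (next_lang l) b B)
    = - off_map (next_lang (next_lang l)) (tconj (tmul (tens a A) (tens b B)))"
proof -
  let ?V = "off_vec (next_lang (next_lang l)) :: _ \<Rightarrow> _ \<Rightarrow> 'f e8_alg"
  define fK where "fK p = emb w a (fst p) * emb w b (snd p) * of_int (fst (wt_mul (fst p) (snd p)))" for p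
  define fL where "fL p = emb v A (fst p) * emb v B (snd p) * of_int (fst (wt_mul (fst p) (snd p)))" for p
  define sK where "sK = uconj (snd (umul a b)) * fst (umul a b)"
  define sL where "sL = uconj (snd (umul A B)) * fst (umul A B)"
  have K: "(\<Sum>p\<in>UNIV. if case_prod (\<lambda>m n. snd (wt_mul m n)) p = k then fK p else 0)
      = of_real sK * emb w (snd (umul a b)) k" for k
    unfolding sK_def emb_umul [OF w, symmetric]
    unfolding fK_def by (simp add: sum.cartesian_product case_prod_unfold)
  have L: "(\<Sum>p\<in>UNIV. if case_prod (\<lambda>m n. snd (wt_mul m n)) p = k then fL p else 0)
      = of_real sL * emb v (snd (umul A B)) k" for k
    unfolding sL_def emb_umul [OF v, symmetric]
    unfolding fL_def by (simp add: sum.cartesian_product case_prod_unfold)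
  \<comment> \<open>The coefficients in \<open>off_vec_bracket\<close> factor into one part for each
    algebra, so the fourfold sum becomes two nested sums that are grouped separately.\<close>
  have "e8_bracket (off_elt l a A) (off_elt (next_lang l) b B)
      = - (\<Sum>m\<in>UNIV. \<Sum>m'\<in>UNIV. e8_scale (fK (m, m'))
          (\<Sum>n\<in>UNIV. \<Sum>n'\<in>UNIV. e8_scale (fL (n, n')) (?V (snd (wt_mul m m')) (snd (wt_mul n n')))))"
    unfolding off_elt_def e8_bracket_sum_left e8_bracket_scale_left e8_bracket_sum_right
      e8_bracket_scale_right off_vec_bracket sum_negf [symmetric] e8.scale_sum_right
    by (subst sum_reorder4, intro sum.cong refl)
      (simp add: fK_def fL_def mult_ac e8.scale_minus_left e8.scale_sum_right)
  also have "\<dots> = - (\<Sum>p\<in>UNIV. e8_scale (fK p) (\<Sum>q\<in>UNIV. e8_scale (fL q)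
      (?V (case_prod (\<lambda>m n. snd (wt_mul m n)) p) (case_prod (\<lambda>m n. snd (wt_mul m n)) q))))"
    by (simp add: sum.cartesian_product case_prod_unfold)
  also have "\<dots> = - (\<Sum>k\<in>UNIV. e8_scale (of_real sK * emb w (snd (umul a b)) k)
      (\<Sum>k'\<in>UNIV. e8_scale (of_real sL * emb v (snd (umul A B)) k') (?V k k')))"
    unfolding e8_scale_group [OF finite, where \<kappa> = "case_prod (\<lambda>m n. snd (wt_mul m n))" and f = fL] L
    unfolding e8_scale_group [OF finite, where \<kappa> = "case_prod (\<lambda>m n. snd (wt_mul m n))" and f = fK
        and V = "\<lambda>k. \<Sum>k'\<in>UNIV. e8_scale (of_real sL * emb v (snd (umul A B)) k') (?V k k')"] K
    ..
  also have "\<dots> = - ((sK * sL) *\<^sub>R off_elt (next_lang (next_lang l)) (snd (umul a b)) (snd (umul A B)))"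
    by (simp add: off_elt_def scaleR_eq_e8_scale e8.scale_sum_right mult_ac)
  finally show ?thesis
    by (simp add: tmul_tens tconj_scaleR tconj_tens off_map_scaleR off_map_tens sK_def sL_def mult_ac)
qed

lemma off_map_bracket:
  "e8_bracket (off_map l s) (off_map (next_lang l) t) = - off_map (next_lang (next_lang l)) (tconj (tmul s t))"
proof (induction s rule: tensor_induct)
  case (tens a A)
  show ?case
    by (induction t rule: tensor_induct)
      (simp_all add: off_map_add off_map_scaleR e8_bracket_add_right e8_bracket_scaleR tmul_add
        tmul_scaleR tconj_add tconj_scaleR off_map_tens off_elt_bracket)
qed (simp_all add: off_map_add off_map_scaleR e8_bracket_add_left e8_bracket_scaleR tmul_add
        tmul_scaleR tconj_add tconj_scaleR)

lemma off_map_bracket':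
  "e8_bracket (off_map (next_lang l) t) (off_map l s) = off_map (next_lang (next_lang l)) (tconj (tmul s t))"
  by (subst e8_bracket_swap) (simp add: off_map_bracket)

end


subsection \<open>Identities for octonion units\<close>

abbreviation usgn :: "'u::oct_alg ounit \<Rightarrow> 'u ounit \<Rightarrow> real" where
  "usgn a b \<equiv> fst (umul a b)"

abbreviation utimes :: "'u::oct_alg ounit \<Rightarrow> 'u ounit \<Rightarrow> 'u ounit" where
  "utimes a b \<equiv> snd (umul a b)"

lemma ell_sq_square [simp]: "ell_sq TYPE('a::oct_alg) * ell_sq TYPE('a) = 1"
  "ell_sq TYPE('a) * (ell_sq TYPE('a) * x) = x"
  using ell_sq_cases [where 'a = 'a] by auto

lemma umul_one [simp]: "umul uone a = (1, a)" "umul a uone = (1, a)"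
proof -
  show "umul uone a = (1, a)"
    by (cases a; rename_tac x; case_tac x) simp_all
  show "umul a uone = (1, a)"
    by (cases a; rename_tac x; case_tac x) (simp_all add: qconj_def)
qed

named_theorems unit_defs
lemmas [unit_defs] = uconj_def qconj_def

text \<open>Up to sign the units form an elementary abelian group of order eight, so what remains in
  the identities below is a matter of signs.\<close>

lemma utimes_commute: "utimes a b = utimes b a"
proof -
  have "\<forall>a b :: 'a ounit. utimes a b = utimes b a"
    unfolding forall_ounit by simp
  then show ?thesis by blast
qed

lemma utimes_assoc: "utimes (utimes a b) c = utimes a (utimes b c)"
proof -
  have "\<forall>a b c :: 'a ounit. utimes (utimes a b) c = utimes a (utimes b c)"
    unfolding forall_ounit by simp
  then show ?thesis by blast
qed

lemma utimes_left_commute: "utimes a (utimes b c) = utimes b (utimes a c)"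
  by (metis utimes_assoc utimes_commute)

lemma utimes_self [simp]: "utimes a a = uone" "utimes a (utimes a b) = b"
proof -
  show s: "utimes a a = uone"
    by (cases a; rename_tac x; case_tac x) simp_all
  show "utimes a (utimes a b) = b"
    unfolding utimes_assoc [symmetric] s by simp
qed

lemma utimes_eq_one_iff: "utimes a b = uone \<longleftrightarrow> a = b"
  by (metis snd_conv umul_one(2) utimes_self)

lemma usgn_square [simp]: "usgn a b * usgn a b = 1" "usgn a b * (usgn a b * x) = x"
proof -
  have "\<forall>a b :: 'a ounit. usgn a b * usgn a b = 1"
    unfolding forall_ounit by (simp add: unit_defs)
  then show "usgn a b * usgn a b = 1" by blast
  then show "usgn a b * (usgn a b * x) = x"
    by (simp flip: mult.assoc)
qed

lemma uconj_umul: "uconj (utimes a b) * usgn a b = uconj a * uconj b * usgn b a"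
proof -
  have "\<forall>a b :: 'a ounit. uconj (utimes a b) * usgn a b = uconj a * uconj b * usgn b a"
    unfolding forall_ounit by (simp add: unit_defs)
  then show ?thesis by blast
qed

text \<open>The norm form N(a) = conj(a) a, which takes the values 1 and -1 on units.\<close>

definition unorm :: "'u::oct_alg ounit \<Rightarrow> real" where
  "unorm a = uconj a * usgn a a"

lemma unorm_square [simp]: "unorm a * unorm a = 1"
  by (simp add: unorm_def uconj_def)

text \<open>The composition law conj(a) (a b) = N(a) b, read on signs.\<close>

lemma unit_cancel: "uconj a * (usgn a b * usgn a (utimes a b)) = unorm a"
proof -
  have "\<forall>a b :: 'a ounit. uconj a * (usgn a b * usgn a (utimes a b)) = unorm a"
    unfolding forall_ounit by (simp add: unit_defs unorm_def)
  then show ?thesis by blast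
qed

text \<open>Polarization of conj(a) (a c) = N(a) c: distinct units are orthogonal, so conj(a) (b c)
  + conj(b) (a c) = 0. This is the Clifford relation behind all later computations with nested
  octonions.\<close>

lemma unit_clifford:
  assumes "a \<noteq> b"
  shows "uconj a * (usgn b c * usgn a (utimes b c)) = - (uconj b * (usgn a c * usgn b (utimes a c)))"
    and "uconj b * (usgn b c * usgn a (utimes b c)) = - (uconj a * (usgn a c * usgn b (utimes a c)))"
proof -
  have "\<forall>a b c :: 'a ounit. a \<noteq> b \<longrightarrow>
      uconj a * (usgn b c * usgn a (utimes b c)) = - (uconj b * (usgn a c * usgn b (utimes a c)))"
    unfolding forall_ounit by (simp add: unit_defs)
  with assms show 1: "uconj a * (usgn b c * usgn a (utimes b c)) = - (uconj b * (usgn a c * usgn b (utimes a c)))"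
    by blast
  then show "uconj b * (usgn b c * usgn a (utimes b c)) = - (uconj a * (usgn a c * usgn b (utimes a c)))"
    by (cases "a = uone"; cases "b = uone"; simp add: uconj_def)
qed

lemma unit_clifford_right:
  assumes "a \<noteq> b"
  shows "uconj a * (usgn c b * usgn (utimes c b) a) = - (uconj b * (usgn c a * usgn (utimes c a) b))"
proof -
  have "\<forall>a b c :: 'a ounit. a \<noteq> b \<longrightarrow>
      uconj a * (usgn c b * usgn (utimes c b) a) = - (uconj b * (usgn c a * usgn (utimes c a) b))"
    unfolding forall_ounit by (simp add: unit_defs)
  with assms show ?thesis by blast
qed

text \<open>The associator is invariant under cyclic permutations.\<close>

lemma unit_alternative:
  "usgn q c * usgn p (utimes q c) - usgn p q * usgn c (utimes p q)
    = usgn p q * usgn (utimes p q) c - usgn c p * usgn (utimes c p) q"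
proof -
  have "\<forall>p q c :: 'a ounit. usgn q c * usgn p (utimes q c) - usgn p q * usgn c (utimes p q)
    = usgn p q * usgn (utimes p q) c - usgn c p * usgn (utimes c p) q"
    unfolding forall_ounit by (simp add: unit_defs)
  then show ?thesis by blast
qed

lemma tri_pairs_prod: "(p, q) \<in> tri_pairs r \<Longrightarrow> utimes p q = r \<and> usgn p q = - 1 \<and> p \<in> imag_units \<and> q \<in> imag_units"
  by (auto simp: tri_pairs_def)

text \<open>Triality rests on this sum: multiplying on the right by p and then by q, over the three
  pairs, adds up to a combination of left and right multiplication by r. Which order of a pair
  belongs to \<open>tri_pairs r\<close> depends on the sign of \<ell>^2, so the sum is doubled to
  one over both orders, which can be tabulated uniformly.\<close>

lemma tri_pairs_sum:
  assumes "r \<in> imag_units"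
  shows "(\<Sum>(p, q)\<in>tri_pairs r. usgn c p * usgn (utimes c p) q) = - usgn c r - 2 * usgn r c"
proof -
  define S where "S = (\<lambda>p. (p, utimes p r)) ` (UNIV - {uone, r})"
  define F where "F = (\<lambda>(p, q). usgn c p * usgn (utimes c p) q)"
  \<comment> \<open>The sign makes \<open>G\<close> invariant under exchange of two distinct
    imaginary units, and equal to \<open>F\<close> on \<open>tri_pairs r\<close>.\<close>
  define G where "G = (\<lambda>(p, q). - (usgn p q * F (p, q)))"
  have swap_sgn: "usgn q p = - usgn p q" if "p \<noteq> uone" "q \<noteq> uone" "p \<noteq> q" for p q :: "'a ounit"
    using uconj_umul [of p q] that by (simp add: uconj_def utimes_eq_one_iff)
  have "S = tri_pairs r \<union> prod.swap ` tri_pairs r"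
  proof
    show "S \<subseteq> tri_pairs r \<union> prod.swap ` tri_pairs r"
    proof
      fix x assume "x \<in> S"
      then obtain p where x: "x = (p, utimes p r)" and p: "p \<noteq> uone" "p \<noteq> r"
        by (auto simp: S_def)
      have q: "utimes p r \<noteq> uone" "utimes p r \<noteq> p"
        using p assms by (auto simp: utimes_eq_one_iff imag_units_def) (metis utimes_self(2) utimes_self(1))
      have "usgn p (utimes p r) = - 1 \<or> usgn (utimes p r) p = - 1"
        using swap_sgn [of p "utimes p r"] p q square_eq_1_iff [of "usgn p (utimes p r)"]
        by (simp, metis minus_minus)
      moreover have "utimes p (utimes p r) = r" "utimes (utimes p r) p = r"
        by (simp_all add: utimes_commute [of _ p])
      ultimately have "(p, utimes p r) \<in> tri_pairs r \<or> (utimes p r, p) \<in> tri_pairs r"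
        using p q by (simp add: tri_pairs_def imag_units_def prod_eq_iff)
      then show "x \<in> tri_pairs r \<union> prod.swap ` tri_pairs r"
        unfolding x by force
    qed
    have *: "p \<notin> {uone, r} \<and> q = utimes p r \<and> q \<notin> {uone, r} \<and> p = utimes q r" if "(p, q) \<in> tri_pairs r" for p q
      using tri_pairs_prod [OF that] by (auto simp: imag_units_def utimes_commute [of _ p])
        (metis utimes_self umul_one snd_conv utimes_commute)+
    then show "tri_pairs r \<union> prod.swap ` tri_pairs r \<subseteq> S"
      by (auto simp: S_def image_iff)
  qed
  moreover have "tri_pairs r \<inter> prod.swap ` tri_pairs r = {}"
  proof -
    have False if "(p, q) \<in> tri_pairs r" "(q, p) \<in> tri_pairs r" for p q
    proof -
      have "p \<noteq> q"
        using tri_pairs_prod [OF that(1)] assms by (auto simp: imag_units_def)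
      then show ?thesis
        using tri_pairs_prod [OF that(1)] tri_pairs_prod [OF that(2)] swap_sgn [of p q]
        by (simp add: imag_units_def)
    qed
    then show ?thesis by auto
  qed
  ultimately have "sum G S = sum G (tri_pairs r) + sum G (prod.swap ` tri_pairs r)"
    by (simp add: sum.union_disjoint)
  also have "sum G (prod.swap ` tri_pairs r) = sum F (tri_pairs r)"
  proof -
    have "G (prod.swap x) = F x" if "x \<in> tri_pairs r" for x
    proof -
      obtain p q where x: "x = (p, q)" by force
      have "p \<noteq> q" "p \<noteq> uone" "q \<noteq> uone" "usgn p q = - 1"
        using tri_pairs_prod [of p q r] that assms unfolding x by (auto simp: imag_units_def)
      then show ?thesis
        using swap_sgn [of p q] unit_clifford_right [of p q c] unfolding x
        by (simp add: G_def F_def uconj_def)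
    qed
    then show ?thesis
      by (subst sum.reindex) (auto simp: comp_def)
  qed
  also have "sum G (tri_pairs r) = sum F (tri_pairs r)"
    using tri_pairs_prod by (intro sum.cong refl) (force simp: G_def)
  finally have "2 * sum F (tri_pairs r) = sum G S"
    by simp
  also have "\<dots> = (\<Sum>p\<in>UNIV - {uone, r}. G (p, utimes p r))"
    unfolding S_def by (subst sum.reindex) (auto simp: inj_on_def)
  \<comment> \<open>The terms p = 1 and p = r are included to sum over all units, and subtracted
    again.\<close>
  also have "\<dots> = (\<Sum>p\<in>UNIV. G (p, utimes p r)) - G (uone, r) - G (r, uone)"
    using assms by (subst sum_diff) (auto simp: imag_units_def)
  also have "(\<Sum>p\<in>UNIV. G (p, utimes p r)) = (\<Sum>p\<leftarrow>[Quat Q1, Quat Qi, Quat Qj, Quat Qk, Ell Q1, Ell Qi, Ell Qj, Ell Qk].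
      - (usgn p (utimes p r) * (usgn c p * usgn (utimes c p) (utimes p r))))"
    unfolding UNIV_ounit G_def F_def by simp
  also have "\<dots> = - 2 * usgn c r - 4 * usgn r c + G (uone, r) + G (r, uone)"
  proof -
    have "\<forall>r c :: 'a ounit. r \<noteq> uone \<longrightarrow>
       (\<Sum>p\<leftarrow>[Quat Q1, Quat Qi, Quat Qj, Quat Qk, Ell Q1, Ell Qi, Ell Qj, Ell Qk].
        - (usgn p (utimes p r) * (usgn c p * usgn (utimes c p) (utimes p r))))
      = - 2 * usgn c r - 4 * usgn r c + - usgn c r + - (usgn c r)"
      unfolding forall_ounit by (simp add: unit_defs)
    with assms show ?thesis
      by (simp add: imag_units_def G_def F_def)
  qed
  finally show ?thesis
    by (simp add: F_def case_prod_unfold)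
qed

lemma tconj_tmul: "tconj (tmul s t) = tmul (tconj t) (tconj s)"
proof (induction s rule: tensor_induct)
  case (tens a A)
  show ?case
  proof (induction t rule: tensor_induct)
    case (tens b B)
    have "uconj (utimes a b) * usgn a b * (uconj (utimes A B) * usgn A B)
        = uconj a * uconj b * usgn b a * (uconj A * uconj B * usgn B A)"
      by (simp only: uconj_umul)
    then show ?case
      by (simp add: tmul_tens tconj_tens tconj_scaleR tmul_scaleR utimes_commute mult_ac)
  qed (simp_all add: tconj_add tmul_add tconj_scaleR tmul_scaleR)
qed (simp_all add: tconj_add tmul_add tconj_scaleR tmul_scaleR)

subsection \<open>Entries and matrices\<close>

lemma lact_add: "lact (x + y) t = lact x t + lact y t" "lact x (s + t) = lact x s + lact x t"
  by (simp_all add: lact_def case_prod_unfold tmul_add scaleR_add_left scaleR_add_right sum.distrib)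

lemma lact_scaleR: "lact (c *\<^sub>R x) t = c *\<^sub>R lact x t" "lact x (c *\<^sub>R t) = c *\<^sub>R lact x t"
  by (simp_all add: lact_def case_prod_unfold tmul_scaleR scaleR_add_right scaleR_right.sum mult_ac)

lemma lact_zero [simp]: "lact 0 t = 0" "lact x 0 = 0"
  using lact_scaleR(1) [of 0 0 t] lact_scaleR(2) [of x 0 0] by simp_all

lemma lact_minus: "lact (- x) t = - lact x t" "lact x (- t) = - lact x t"
  using lact_scaleR(1) [of "- 1" x t] lact_scaleR(2) [of x "- 1" t] by simp_all

lemma lact_ten [simp]: "lact (ten_entry s) t = tmul s t"
  by (simp add: lact_def ten_entry_def case_prod_unfold)

lemma ract_ten [simp]: "ract t (ten_entry s) = tmul t s"
  by (simp add: ract_def ten_entry_def case_prod_unfold)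

lemma ract_zero [simp]: "ract t 0 = 0" "ract 0 x = 0"
  by (simp_all add: ract_def case_prod_unfold)

lemma ten_entry_add: "ten_entry (s + t) = ten_entry s + ten_entry t"
  by (simp add: ten_entry_def)

lemma ten_entry_scaleR: "ten_entry (c *\<^sub>R s) = c *\<^sub>R ten_entry s"
  by (simp add: ten_entry_def)

lemma ten_entry_minus: "ten_entry (- s) = - ten_entry s"
  by (simp add: ten_entry_def)

lemma ten_entry_zero [simp]: "ten_entry 0 = 0"
  by (simp add: ten_entry_def zero_prod_def)

lemma fst_ten_entry [simp]: "fst (ten_entry t) = t" "snd (ten_entry t) = 0"
  by (simp_all add: ten_entry_def zero_prod_def)

text \<open>Type l occupies the entry \<open>(pos l, pos2 l)\<close> and, up to sign and
  conjugation, \<open>(pos2 l, pos l)\<close>. Numbering rows from l onwards exposes the cyclic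
  symmetry of X, Y and Z, so that one computation relative to l covers all three types.\<close>

fun pos :: "lang \<Rightarrow> 3" where
  "pos LD = 1" | "pos LE = 2" | "pos LF = 3"

abbreviation pos2 :: "lang \<Rightarrow> 3" where
  "pos2 l \<equiv> pos (next_lang l)"

abbreviation pos3 :: "lang \<Rightarrow> 3" where
  "pos3 l \<equiv> pos (next_lang (next_lang l))"

lemma pos_inject [simp]: "pos l = pos m \<longleftrightarrow> l = m"
  by (cases l; cases m) simp_all

lemma forall_pos: "(\<forall>r. P r) \<longleftrightarrow> P (pos l) \<and> P (pos2 l) \<and> P (pos3 l)"
  by (cases l) (auto simp: forall_3)

lemma sum_pos: "(\<Sum>r\<in>UNIV. f r) = f (pos l) + f (pos2 l) + f (pos3 l)"
  by (cases l) (simp_all add: sum_3 add_ac)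

lemma off_nth: "off l t $ r $ c = (if r = pos l \<and> c = pos2 l then ten_entry t
    else if r = pos2 l \<and> c = pos l then - ten_entry (tconj t) else 0)"
proof -
  have "\<forall>r c. off l t $ r $ c = (if r = pos l \<and> c = pos2 l then ten_entry t
    else if r = pos2 l \<and> c = pos l then - ten_entry (tconj t) else 0)"
    unfolding forall_3 by (cases l) (simp_all add: vector_3)
  then show ?thesis by blast
qed

lemma sdiag_nth: "sdiag l x $ r $ c = (if r = c then if r = pos l then x else if r = pos2 l then - x else 0 else 0)"
proof -
  have "\<forall>r c. sdiag l x $ r $ c = (if r = c then if r = pos l then x else if r = pos2 l then - x else 0 else 0)"
    unfolding forall_3 by (cases l) (simp_all add: vector_3)
  then show ?thesis by blast
qed

lemma ndiag_nth: "ndiag l x $ r $ c = (if r = c then if r = pos l \<or> r = pos2 l then x else 0 else 0)"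
proof -
  have "\<forall>r c. ndiag l x $ r $ c = (if r = c then if r = pos l \<or> r = pos2 l then x else 0 else 0)"
    unfolding forall_3 by (cases l) (simp_all add: vector_3)
  then show ?thesis by blast
qed


text \<open>The null octonion (x \<plusminus> x\<ell>/w)/2 in terms of units, inverse to
  \<open>emb\<close>.\<close>

definition wt_coeff :: "'f::field \<Rightarrow> wt \<Rightarrow> 'k ounit \<Rightarrow> 'f" where
  "wt_coeff w m a = (case a of Quat x \<Rightarrow> if x = fst m then 1 / 2 else 0
     | Ell x \<Rightarrow> if x = fst m then (if snd m then 1 else - 1) / (2 * w) else 0)"

lemma wt_coeff_emb:
  fixes w :: "'f::field_char_0"
  assumes "w \<noteq> 0"
  shows "(\<Sum>a\<in>UNIV. wt_coeff w m (a :: 'k ounit) * emb w a m') = (if m = m' then 1 else 0)"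
  using assms
  by (cases m; cases m'; rename_tac x s y t; case_tac x; case_tac y; case_tac s; case_tac t)
    (simp_all add: UNIV_ounit wt_coeff_def sum.union_disjoint)

section \<open>Root vectors recovered from matrices, and brackets within one type\<close>

context e8_model
begin

lemma w_nonzero: "w \<noteq> 0" and v_nonzero: "v \<noteq> 0"
proof -
  have "of_real (ell_sq TYPE('k)) \<noteq> (0 :: 'f)" "of_real (ell_sq TYPE('l)) \<noteq> (0 :: 'f)"
    using ell_sq_cases [where 'a = 'k] ell_sq_cases [where 'a = 'l] by auto
  then show "w \<noteq> 0" "v \<noteq> 0"
    using w v by auto
qed

lemma off_vec_eq: "off_vec l m n =
   (\<Sum>a\<in>UNIV. \<Sum>A\<in>UNIV. e8_scale (wt_coeff w m a * wt_coeff v n A) (off_elt l a A))"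
proof -
  have "(\<Sum>a\<in>(UNIV :: 'k ounit set). \<Sum>A\<in>(UNIV :: 'l ounit set). e8_scale (wt_coeff w m a * wt_coeff v n A) (off_elt l a A))
    = (\<Sum>a\<in>(UNIV :: 'k ounit set). \<Sum>A\<in>(UNIV :: 'l ounit set). \<Sum>m'\<in>UNIV. \<Sum>n'\<in>UNIV.
        e8_scale ((wt_coeff w m a * emb w a m') * (wt_coeff v n A * emb v A n')) (off_vec l m' n'))"
    by (simp add: off_elt_def e8.scale_sum_right mult_ac)
  also have "\<dots> = (\<Sum>m'\<in>UNIV. \<Sum>a\<in>(UNIV :: 'k ounit set). \<Sum>n'\<in>UNIV. \<Sum>A\<in>(UNIV :: 'l ounit set).
        e8_scale ((wt_coeff w m a * emb w a m') * (wt_coeff v n A * emb v A n')) (off_vec l m' n'))"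
    by (rule sum_reorder4)
  also have "\<dots> = (\<Sum>m'\<in>UNIV. \<Sum>a\<in>(UNIV :: 'k ounit set). \<Sum>n'\<in>UNIV. e8_scale (wt_coeff w m a * emb w a m')
        (e8_scale (\<Sum>A\<in>(UNIV :: 'l ounit set). wt_coeff v n A * emb v A n') (off_vec l m' n')))"
    by (simp add: e8.scale_sum_left e8.scale_sum_right)
  also have "\<dots> = (\<Sum>m'\<in>UNIV. e8_scale (\<Sum>a\<in>(UNIV :: 'k ounit set). wt_coeff w m a * emb w a m') (off_vec l m' n))"
    unfolding wt_coeff_emb [OF v_nonzero] e8.scale_sum_left
    by (simp add: if_distrib [where f = "\<lambda>x. e8_scale x _"] if_distrib [where f = "e8_scale _"] cong: if_cong)
  also have "\<dots> = off_vec l m n"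
    unfolding wt_coeff_emb [OF w_nonzero]
    by (simp add: if_distrib [where f = "\<lambda>x. e8_scale x _"] cong: if_cong)
  finally show ?thesis ..
qed

lemma off_map_centralizer_eq_0:
  assumes "\<And>t. e8_bracket h (off_map l t) = 0"
  shows "h = 0"
proof (rule off_vec_centralizer_eq_0)
  fix m n
  show "e8_bracket h (off_vec l m n) = 0"
    unfolding off_vec_eq
    using assms by (simp add: e8_bracket_sum_right e8_bracket_scale_right flip: off_map_tens)
qed

text \<open>The Jacobi identity turns the bracket of two elements of one type, acting on another
  type, into brackets between different types, where the octonion rule applies. Its Cartan and root
  components are never computed.\<close>

lemma off_map_same_next:
  "e8_bracket (e8_bracket (off_map l s) (off_map l s')) (off_map (next_lang l) t)
    = off_map (next_lang l) (tmul (tconj s') (tmul s t) - tmul (tconj s) (tmul s' t))"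
  using off_map_bracket' [of "next_lang (next_lang l)"]
  by (simp add: e8_bracket_jacobi(1) off_map_bracket e8_bracket_minus_right off_map_diff tconj_tmul)

lemma off_map_same_prev:
  "e8_bracket (e8_bracket (off_map l s) (off_map l s')) (off_map (next_lang (next_lang l)) t)
    = off_map (next_lang (next_lang l)) (tmul (tmul t s) (tconj s') - tmul (tmul t s') (tconj s))"
  using off_map_bracket' [of "next_lang (next_lang l)"]
  by (simp add: e8_bracket_jacobi(1) off_map_bracket off_map_diff tconj_tmul)

text \<open>Every element of a type is a bracket of an element of the next type with a fixed element
  of the previous one, so a derivation is determined by its action on two types.\<close>

lemma off_map_same_prod:
  assumes "\<And>t. tmul t one = t" and "tconj one = one"
  shows "off_map l t = - e8_bracket (off_map (next_lang l) (tconj t)) (off_map (next_lang (next_lang l)) one)"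
  using off_map_bracket [of "next_lang l" "tconj t" one] by (simp add: assms)

end

text \<open>Captures what the two tensor factors have in common, so that each statement about
  diagonal matrices is proved once. Here \<open>mk b x\<close> is the pure tensor with b in the
  factor at hand and x in the other one, \<open>base\<close> is the unit of the other factor, and
  \<open>nested\<close> and \<open>idx\<close> locate the coordinates of this factor in an
  entry.\<close>

locale oct_side =
  fixes u :: "'u::oct_alg ounit \<Rightarrow> ('k::oct_alg, 'l::oct_alg) tensor"
    and mk :: "'u ounit \<Rightarrow> 'r \<Rightarrow> ('k, 'l) tensor" and base :: 'r
    and oct :: "'u ounit \<Rightarrow> ('k, 'l) entry" and nest :: "'u ounit \<Rightarrow> 'u ounit \<Rightarrow> ('k, 'l) entry"
    and nested :: "('k, 'l) entry \<Rightarrow> 'u nested" and idx :: "'u ounit \<Rightarrow> 'k ounit \<times> 'l ounit"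
  assumes u_mk: "u p = mk p base"
    and tmul_u_mk: "tmul (u p) (mk b x) = usgn p b *\<^sub>R mk (utimes p b) x"
    and tmul_mk_u: "tmul (mk b x) (u p) = usgn b p *\<^sub>R mk (utimes b p) x"
    and mk_induct: "\<And>P t. (\<And>s t. P s \<Longrightarrow> P t \<Longrightarrow> P (s + t)) \<Longrightarrow> (\<And>c t. P t \<Longrightarrow> P (c *\<^sub>R t))
      \<Longrightarrow> (\<And>b x. P (mk b x)) \<Longrightarrow> P t"
    and tconj_u: "tconj (u p) = uconj p *\<^sub>R u p"
    and u_axis: "u p = axis (idx p) 1" and idx_inject: "idx p = idx q \<longleftrightarrow> p = q"
    and oct: "oct p = ten_entry (u p)"
    and fst_nest: "fst (nest p q) = 0"
    and snd_nest: "p \<noteq> q \<Longrightarrow> snd (nest p q) \<noteq> 0"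
    and nested_nest: "nested (nest p q) = circ p q"
    and nested_add: "nested (e + e') = nested e + nested e'"
    and nested_scaleR: "nested (c *\<^sub>R e) = c *\<^sub>R nested e"
    and nested_ten: "nested (ten_entry t) = 0"
    and nest_swap: "nest q p = - nest p q"
    and lact_nest: "lact (nest p q) t = (1/2) *\<^sub>R (tmul (u p) (tmul (u q) t) - tmul (u q) (tmul (u p) t))"
    and ract_nest: "ract t (nest p q) = (1/2) *\<^sub>R (tmul (tmul t (u p)) (u q) - tmul (tmul t (u q)) (u p))"
begin

lemma tmul_u_u: "tmul (u p) (u q) = usgn p q *\<^sub>R u (utimes p q)"
  by (simp add: u_mk [of q] tmul_u_mk) (simp add: u_mk)

lemma tmul_one [simp]: "tmul (u uone) t = t" "tmul t (u uone) = t"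
  by (induction t rule: mk_induct; simp add: tmul_add tmul_scaleR tmul_u_mk tmul_mk_u)+

lemma tconj_one [simp]: "tconj (u uone) = u uone"
  by (simp add: tconj_u uconj_def)

lemma tconj_imag: "p \<in> imag_units \<Longrightarrow> tconj (u p) = - u p"
  by (simp add: tconj_u uconj_def imag_units_def)

lemma tmul_cancel:
  "tmul (tconj (u a)) (tmul (u a) t) = unorm a *\<^sub>R t" "tmul (u a) (tmul (tconj (u a)) t) = unorm a *\<^sub>R t"
proof -
  show *: "tmul (tconj (u a)) (tmul (u a) t) = unorm a *\<^sub>R t"
  proof (induction t rule: mk_induct)
    case (3 c x)
    have "uconj a * (usgn a c * usgn a (utimes a c)) = unorm a"
      by (rule unit_cancel)
    then show ?case
      by (simp add: tmul_scaleR tmul_u_mk tconj_u mult_ac)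
  qed (simp_all add: tmul_add tmul_scaleR scaleR_add_right)
  then show "tmul (u a) (tmul (tconj (u a)) t) = unorm a *\<^sub>R t"
    by (simp add: tconj_u tmul_scaleR)
qed

lemma tmul_clifford_conj:
  assumes "a \<noteq> b"
  shows "tmul (tconj (u a)) (tmul (u b) t) = - tmul (tconj (u b)) (tmul (u a) t)"
    and "tmul (u a) (tmul (tconj (u b)) t) = - tmul (u b) (tmul (tconj (u a)) t)"
proof -
  show "tmul (tconj (u a)) (tmul (u b) t) = - tmul (tconj (u b)) (tmul (u a) t)"
  proof (induction t rule: mk_induct)
    case (3 c x)
    show ?case
      using unit_clifford(1) [OF assms, of c]
      by (simp add: tmul_scaleR tmul_u_mk tconj_u utimes_left_commute [of a b] mult_ac flip: scaleR_minus_left)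
  qed (simp_all add: tmul_add tmul_scaleR)
  show "tmul (u a) (tmul (tconj (u b)) t) = - tmul (u b) (tmul (tconj (u a)) t)"
  proof (induction t rule: mk_induct)
    case (3 c x)
    show ?case
      using unit_clifford(2) [OF assms, of c]
      by (simp add: tmul_scaleR tmul_u_mk tconj_u utimes_left_commute [of a b] mult_ac flip: scaleR_minus_left)
  qed (simp_all add: tmul_add tmul_scaleR)
qed

lemma tmul_clifford:
  assumes "p \<in> imag_units" "q \<in> imag_units" "p \<noteq> q"
  shows "tmul (u p) (tmul (u q) t) = - tmul (u q) (tmul (u p) t)"
proof -
  have "- tmul (u p) (tmul (u q) t) = tmul (u q) (tmul (u p) t)"
    using tmul_clifford_conj(1) [OF assms(3), of t] by (simp add: tconj_imag assms tmul_minus)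
  then show ?thesis
    by (metis minus_minus)
qed

lemma tmul_clifford_right:
  assumes "p \<in> imag_units" "q \<in> imag_units" "p \<noteq> q"
  shows "tmul (tmul t (u p)) (u q) = - tmul (tmul t (u q)) (u p)"
proof (induction t rule: mk_induct)
  case (3 c x)
  have "utimes (utimes c p) q = utimes (utimes c q) p"
    by (simp add: utimes_assoc utimes_commute [of p])
  then show ?case
    using unit_clifford_right [OF assms(3), of c] assms
    by (simp add: tmul_scaleR tmul_mk_u imag_units_def uconj_def mult_ac flip: scaleR_minus_left)
qed (simp_all add: tmul_add tmul_scaleR)

lemma tmul_square:
  assumes "p \<in> imag_units"
  shows "tmul (u p) (tmul (u p) t) = - (unorm p *\<^sub>R t)"
proof -
  have "- tmul (u p) (tmul (u p) t) = unorm p *\<^sub>R t"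
    using tmul_cancel(1) [of p t] by (simp add: tconj_imag assms tmul_minus)
  then show ?thesis
    by (metis minus_minus)
qed

lemma tmul_alternative:
  "tmul (u p) (tmul (u q) t) - tmul t (tmul (u p) (u q)) = tmul (tmul (u p) (u q)) t - tmul (tmul t (u p)) (u q)"
proof (induction t rule: mk_induct)
  case (3 c x)
  have *: "utimes c (utimes p q) = utimes p (utimes q c)" "utimes (utimes p q) c = utimes p (utimes q c)"
      "utimes (utimes c p) q = utimes p (utimes q c)"
    by (simp_all add: utimes_assoc utimes_commute utimes_left_commute)
  show ?case
    unfolding tmul_u_u
    using unit_alternative [of q c p]
    by (simp add: tmul_scaleR tmul_mk_u tmul_u_mk * flip: scaleR_left_diff_distrib)
qed (simp_all add: tmul_add tmul_scaleR add_diff_add flip: scaleR_right_diff_distrib)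

text \<open>By the Clifford relation the two halves of the antisymmetrization in \<open>circ\<close>
  coincide.\<close>

lemma lact_nest_imag:
  assumes "p \<in> imag_units" "q \<in> imag_units" "p \<noteq> q"
  shows "lact (nest p q) t = tmul (u p) (tmul (u q) t)"
  unfolding lact_nest tmul_clifford [OF assms(2,1) assms(3) [symmetric]] by (simp flip: scaleR_2)

lemma ract_nest_imag:
  assumes "p \<in> imag_units" "q \<in> imag_units" "p \<noteq> q"
  shows "ract t (nest p q) = tmul (tmul t (u p)) (u q)"
  unfolding ract_nest tmul_clifford_right [OF assms(2,1) assms(3) [symmetric]] by (simp flip: scaleR_2)

end

section \<open>Diagonal elements of E8 and triality\<close>

locale e8_side = e8_model w v tK tL + oct_side u mk base oct nest nested idx
  for w v :: "'f::real_field" and tK :: "'k::oct_alg itself" and tL :: "'l::oct_alg itself"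
    and u :: "'u::oct_alg ounit \<Rightarrow> ('k, 'l) tensor" and mk :: "'u ounit \<Rightarrow> 'r \<Rightarrow> ('k, 'l) tensor" and base
    and oct nest nested idx
begin

text \<open>The counterparts of \<open>D_p\<close> (for a = 1 and b = p) and of
  \<open>D_{p,q}\<close>, and likewise for E and F. The factor 1/2 appears because the commutator of
  two matrices of one type is twice a diagonal generator.\<close>

definition dd :: "lang \<Rightarrow> 'u ounit \<Rightarrow> 'u ounit \<Rightarrow> 'f e8_alg" where
  "dd l a b = (1/2) *\<^sub>R e8_bracket (off_map l (u a)) (off_map l (u b))"

lemma dd_swap: "dd l b a = - dd l a b"
  unfolding dd_def by (subst e8_bracket_swap) simp

lemma dd_self [simp]: "dd l a a = 0"
  by (simp add: dd_def e8_bracket_self)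

lemma half_double: "(1/2) *\<^sub>R (x + x) = (x :: 'f e8_alg)" "(1/2) *\<^sub>R (- x - x) = - x"
proof -
  show *: "(1/2) *\<^sub>R (x + x) = x" for x :: "'f e8_alg"
    by (simp flip: scaleR_2)
  show "(1/2) *\<^sub>R (- x - x) = - x"
    using * [of "- x"] by simp
qed

lemmas dd_action = dd_def e8_bracket_scaleR off_map_same_next off_map_same_prev

text \<open>A diagonal element of language l acts on the next type by left multiplications only, on
  the previous type by right multiplications only, and on its own type by both. The centralizer
  arguments below choose the type accordingly.\<close>

lemma dd_next:
  assumes "p \<in> imag_units"
  shows "e8_bracket (dd l uone p) (off_map (next_lang l) t) = - off_map (next_lang l) (tmul (u p) t)"
  unfolding dd_action tconj_imag [OF assms] tconj_one tmul_one tmul_minus off_map_diff off_map_minus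
  by (rule half_double)

lemma dd_next_nest:
  assumes "p \<in> imag_units" "q \<in> imag_units" "p \<noteq> q"
  shows "e8_bracket (dd l p q) (off_map (next_lang l) t) = off_map (next_lang l) (tmul (u p) (tmul (u q) t))"
  unfolding dd_action tconj_imag [OF assms(1)] tconj_imag [OF assms(2)] tmul_minus off_map_diff off_map_minus
    tmul_clifford [OF assms(2,1) assms(3) [symmetric]] minus_minus diff_minus_eq_add off_map_add
  by (rule half_double)

lemma dd_prev:
  assumes "p \<in> imag_units"
  shows "e8_bracket (dd l uone p) (off_map (next_lang (next_lang l)) t)
    = - off_map (next_lang (next_lang l)) (tmul t (u p))"
  unfolding dd_action tconj_imag [OF assms] tconj_one tmul_one tmul_minus off_map_diff off_map_minus
  by (rule half_double)

lemma dd_prev_nest: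
  assumes "p \<in> imag_units" "q \<in> imag_units" "p \<noteq> q"
  shows "e8_bracket (dd l p q) (off_map (next_lang (next_lang l)) t)
    = - off_map (next_lang (next_lang l)) (tmul (tmul t (u p)) (u q))"
  unfolding dd_action tconj_imag [OF assms(1)] tconj_imag [OF assms(2)] tmul_minus off_map_diff off_map_minus
    tmul_clifford_right [OF assms(2,1) assms(3) [symmetric]] minus_minus diff_minus_eq_add
  using half_double(2) by simp

lemma off_map_prod:
  "off_map l t = - e8_bracket (off_map (next_lang l) (tconj t)) (off_map (next_lang (next_lang l)) (u uone))"
  by (rule off_map_same_prod) simp_all

text \<open>The action on type l follows from the actions on the other two types by applying the
  derivation h to the bracket in \<open>off_map_prod\<close>.\<close>

lemma dd_derivation:
  assumes "\<And>t. e8_bracket h (off_map (next_lang l) t) = off_map (next_lang l) (f t)"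
    and "\<And>t. e8_bracket h (off_map (next_lang (next_lang l)) t) = off_map (next_lang (next_lang l)) (g t)"
  shows "e8_bracket h (off_map l t) = off_map l (tconj (tmul (f (tconj t)) (u uone)) + tconj (tmul (tconj t) (g (u uone))))"
proof -
  have *: "e8_bracket (off_map (next_lang l) r) (off_map (next_lang (next_lang l)) s) = - off_map l (tconj (tmul r s))" for r s
    using off_map_bracket [of "next_lang l" r s] by simp
  show ?thesis
    unfolding off_map_prod [of l t] e8_bracket_minus_right
      e8_bracket_jacobi(2) [where z = h and x = "off_map (next_lang l) (tconj t)"]
    unfolding assms * off_map_add by simp
qed

lemma dd_same:
  assumes "p \<in> imag_units"
  shows "e8_bracket (dd l uone p) (off_map l t) = off_map l (tmul (u p) t + tmul t (u p))"
proof -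
  have "e8_bracket (dd l uone p) (off_map l t)
      = off_map l (tconj (tmul (- tmul (u p) (tconj t)) (u uone)) + tconj (tmul (tconj t) (- tmul (u uone) (u p))))"
    by (rule dd_derivation [of _ l "\<lambda>t. - tmul (u p) t" "\<lambda>t. - tmul t (u p)"])
      (simp_all add: dd_next dd_prev assms off_map_minus)
  then show ?thesis
    by (simp add: tconj_tmul tconj_imag assms tmul_minus tconj_minus add.commute)
qed

lemma dd_same_nest:
  assumes "p \<in> imag_units" "q \<in> imag_units" "p \<noteq> q"
  shows "e8_bracket (dd l p q) (off_map l t) = off_map l (tmul (u p) (tmul (u q) t) - tmul t (tmul (u p) (u q)))"
proof -
  have "e8_bracket (dd l p q) (off_map l t)
      = off_map l (tconj (tmul (tmul (u p) (tmul (u q) (tconj t))) (u uone))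
         + tconj (tmul (tconj t) (- tmul (tmul (u uone) (u p)) (u q))))"
    by (rule dd_derivation [of _ l "\<lambda>t. tmul (u p) (tmul (u q) t)" "\<lambda>t. - tmul (tmul t (u p)) (u q)"])
      (simp_all add: dd_next_nest dd_prev_nest assms off_map_minus)
  also have "tconj (tmul (tmul (u p) (tmul (u q) (tconj t))) (u uone)) = tmul (tmul t (u q)) (u p)"
    by (simp add: tconj_tmul tconj_imag assms tmul_minus)
  also have "\<dots> = - tmul (tmul t (u p)) (u q)"
    using assms by (intro tmul_clifford_right) auto
  also have "tconj (tmul (tconj t) (- tmul (tmul (u uone) (u p)) (u q))) = - tmul (tmul (u q) (u p)) t"
    by (simp add: tconj_tmul tconj_imag assms tmul_minus tconj_minus)
  also have "tmul (u q) (u p) = - tmul (u p) (u q)"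
    using tmul_clifford [of q p "u uone"] assms by simp
  finally show ?thesis
    by (simp add: tmul_alternative tmul_minus)
qed

text \<open>On the type next to l the three summands act by -L_p, L_p + R_p and -R_p.\<close>

lemma dd_sum_lang:
  assumes "p \<in> imag_units"
  shows "dd l uone p + dd (next_lang l) uone p + dd (next_lang (next_lang l)) uone p = 0"
proof (rule off_map_centralizer_eq_0 [where l = "next_lang l"])
  fix t
  show "e8_bracket (dd l uone p + dd (next_lang l) uone p + dd (next_lang (next_lang l)) uone p) (off_map (next_lang l) t) = 0"
    using dd_prev [OF assms, of "next_lang (next_lang l)" t]
    by (simp add: e8_bracket_add_left dd_next dd_same assms off_map_add)
qed

text \<open>Tested on type Z, where \<open>E_r\<close> acts by -L_r, \<open>D_r\<close> by -R_r, and
  each \<open>D_{p,q}\<close> by minus the right multiplications by p and then q; the claim becomes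
  \<open>tri_pairs_sum\<close>.\<close>

lemma dd_triality:
  assumes "r \<in> imag_units"
  shows "dd LE uone r = (1/2) *\<^sub>R (- dd LD uone r - (\<Sum>(p, q)\<in>tri_pairs r. dd LD p q))"
proof -
  have tri: "(\<Sum>(p, q)\<in>tri_pairs r. tmul (tmul t (u p)) (u q)) = - tmul t (u r) - 2 *\<^sub>R tmul (u r) t" for t
  proof (induction t rule: mk_induct)
    case (1 s t)
    then show ?case
      by (simp add: tmul_add case_prod_unfold sum.distrib scaleR_add_right)
  next
    case (2 c t)
    then show ?case
      by (simp add: tmul_scaleR case_prod_unfold scaleR_diff_right scaleR_right.sum [symmetric] mult.commute)
  next
    case (3 c x)
    have "utimes (utimes c p) q = utimes c r" if "(p, q) \<in> tri_pairs r" for p q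
      using tri_pairs_prod [OF that] by (simp add: utimes_assoc)
    then have "(\<Sum>(p, q)\<in>tri_pairs r. tmul (tmul (mk c x) (u p)) (u q))
        = (\<Sum>(p, q)\<in>tri_pairs r. usgn c p * usgn (utimes c p) q) *\<^sub>R mk (utimes c r) x"
      unfolding scaleR_sum_left
      by (intro sum.cong refl) (auto simp: tmul_mk_u tmul_scaleR)
    then show ?case
      unfolding tri_pairs_sum [OF assms]
      by (simp add: tmul_mk_u tmul_u_mk utimes_commute [of r c] scaleR_left_diff_distrib)
  qed
  have "dd LE uone r - (1/2) *\<^sub>R (- dd LD uone r - (\<Sum>(p, q)\<in>tri_pairs r. dd LD p q)) = 0"
  proof (rule off_map_centralizer_eq_0 [where l = LF])
    fix t
    have D: "e8_bracket (dd LD p q) (off_map LF t) = - off_map LF (tmul (tmul t (u p)) (u q))"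
      if "(p, q) \<in> tri_pairs r" for p q
    proof -
      have "p \<noteq> q"
        using tri_pairs_prod [OF that] assms by (auto simp: imag_units_def)
      then show ?thesis
        using dd_prev_nest [of p q LD t] tri_pairs_prod [OF that] by simp
    qed
    have "e8_bracket (\<Sum>(p, q)\<in>tri_pairs r. dd LD p q) (off_map LF t)
        = (\<Sum>(p, q)\<in>tri_pairs r. - off_map LF (tmul (tmul t (u p)) (u q)))"
      unfolding e8_bracket_sum_left by (intro sum.cong refl) (auto simp: D)
    also have "\<dots> = off_map LF (- (\<Sum>(p, q)\<in>tri_pairs r. tmul (tmul t (u p)) (u q)))"
    proof -
      have "off_map LF (sum f S) = (\<Sum>i\<in>S. off_map LF (f i))" for f and S :: "('u ounit \<times> 'u ounit) set"
        by (induction S rule: infinite_finite_induct) (auto simp: off_map_add)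
      then show ?thesis
        by (simp add: off_map_minus sum_negf case_prod_unfold)
    qed
    also have "\<dots> = off_map LF (tmul t (u r)) + 2 *\<^sub>R off_map LF (tmul (u r) t)"
      unfolding tri by (simp add: off_map_add off_map_scaleR off_map_diff off_map_minus)
    finally show "e8_bracket (dd LE uone r - (1/2) *\<^sub>R (- dd LD uone r - (\<Sum>(p, q)\<in>tri_pairs r. dd LD p q))) (off_map LF t) = 0"
      using dd_next [OF assms, of LE t] dd_prev [OF assms, of LD t]
      by (simp add: e8_bracket_diff_left e8_bracket_scaleR e8_bracket_minus_left scaleR_add_right)
  qed
  then show ?thesis
    by (simp only: right_minus_eq)
qed

text \<open>A form of the triality relations in which the sum over the other pairs has been traded
  for \<open>E_r\<close>. As p q = -r, both claims reduce to the same consequence of alternativity,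
  tested on Z for the first and on Y for the second.\<close>

lemma dd_triality_nest:
  assumes "r \<in> imag_units" "(p, q) \<in> tri_pairs r"
  shows "dd LE p q = dd LD uone r + dd LD p q + dd LE uone r"
    and "dd LF p q = dd LD p q + dd LE uone r"
proof -
  note pq = tri_pairs_prod [OF assms(2)]
  have neq: "p \<noteq> q"
    using pq assms by (auto simp: imag_units_def)
  have "tmul (u p) (u q) = - u r"
    using pq by (simp add: tmul_u_u)
  then have "tmul (u p) (tmul (u q) t) + tmul t (u r) = - tmul (u r) t - tmul (tmul t (u p)) (u q)" for t
    using tmul_alternative [of p q t] by (simp add: tmul_minus)
  from arg_cong [OF this, of "off_map _"]
  have alt: "off_map l (tmul (u p) (tmul (u q) t)) + off_map l (tmul t (u r)) + off_map l (tmul (u r) t)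
      + off_map l (tmul (tmul t (u p)) (u q)) = 0" for l t
    by (simp add: off_map_add off_map_diff off_map_minus)
  have "dd LE p q - (dd LD uone r + dd LD p q + dd LE uone r) = 0"
  proof (rule off_map_centralizer_eq_0 [where l = LF])
    fix t
    have "e8_bracket (dd LE p q - (dd LD uone r + dd LD p q + dd LE uone r)) (off_map LF t)
      = off_map LF (tmul (u p) (tmul (u q) t)) + off_map LF (tmul t (u r)) + off_map LF (tmul (u r) t)
        + off_map LF (tmul (tmul t (u p)) (u q))"
      using dd_next_nest [of p q LE t] dd_prev_nest [of p q LD t] dd_next [OF assms(1), of LE t]
        dd_prev [OF assms(1), of LD t] pq neq
      by (simp add: e8_bracket_diff_left e8_bracket_add_left)
    then show "e8_bracket (dd LE p q - (dd LD uone r + dd LD p q + dd LE uone r)) (off_map LF t) = 0"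
      unfolding alt .
  qed
  then show "dd LE p q = dd LD uone r + dd LD p q + dd LE uone r"
    by (simp only: right_minus_eq)
  have "dd LD p q + dd LE uone r - dd LF p q = 0"
  proof (rule off_map_centralizer_eq_0 [where l = LE])
    fix t
    have "e8_bracket (dd LD p q + dd LE uone r - dd LF p q) (off_map LE t)
      = off_map LE (tmul (u p) (tmul (u q) t)) + off_map LE (tmul t (u r)) + off_map LE (tmul (u r) t)
        + off_map LE (tmul (tmul t (u p)) (u q))"
      using dd_next_nest [of p q LD t] dd_prev_nest [of p q LF t] dd_same [OF assms(1), of LE t] pq neq
      by (simp add: e8_bracket_diff_left e8_bracket_add_left off_map_add)
    then show "e8_bracket (dd LD p q + dd LE uone r - dd LF p q) (off_map LE t) = 0"
      unfolding alt .
  qed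
  then show "dd LF p q = dd LD p q + dd LE uone r"
    by (simp only: right_minus_eq)
qed

end


section \<open>Commutators of matrices computed entrywise\<close>

lemma off_add: "off l (s + t) = off l s + off l t"
  by (simp add: vec_eq_iff off_nth tconj_add ten_entry_add)

lemma off_scaleR: "off l (c *\<^sub>R t) = c *\<^sub>R off l t"
  by (simp add: vec_eq_iff off_nth tconj_scaleR ten_entry_scaleR)

lemma off_minus: "off l (- t) = - off l t"
  using off_scaleR [of l "- 1" t] by simp

lemma emul_ten: "emul (ten_entry s) (ten_entry t) = ten_entry (tmul s t)"
  by (simp add: emul_def)

lemma emul_zero [simp]: "emul 0 x = 0" "emul x 0 = 0"
  by (simp_all add: emul_def)

lemma oct_comm_swap: "oct_comm W V = - oct_comm V W"
  by (simp add: oct_comm_def vec_eq_iff sum_negf [symmetric])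

lemma oct_comm_off_next:
  "oct_comm (off l s) (off (next_lang l) t) = off (next_lang (next_lang l)) (- tconj (tmul s t))"
proof -
  have "\<forall>r c. oct_comm (off l s) (off (next_lang l) t) $ r $ c
      = off (next_lang (next_lang l)) (- tconj (tmul s t)) $ r $ c"
    unfolding forall_pos [of _ l] oct_comm_def vec_lambda_beta sum_pos [of _ l] off_nth
    by (simp add: emul_ten tconj_tmul tconj_minus tmul_minus flip: ten_entry_minus)
  then show ?thesis
    by (simp add: vec_eq_iff)
qed

lemma oct_comm_off_prev:
  "oct_comm (off l s) (off (next_lang (next_lang l)) t) = off (next_lang l) (tconj (tmul t s))"
  using oct_comm_off_next [of "next_lang (next_lang l)" t s]
    oct_comm_swap [of "off l s" "off (next_lang (next_lang l)) t"]
  by (simp add: off_minus)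

definition diagonal :: "('a::zero) ^ 3 ^ 3 \<Rightarrow> bool" where
  "diagonal V \<longleftrightarrow> (\<forall>r c. r \<noteq> c \<longrightarrow> V $ r $ c = 0)"

lemma diagonal_sdiag: "diagonal (sdiag l x)" and diagonal_ndiag: "diagonal (ndiag l x)"
  by (simp_all add: diagonal_def sdiag_nth ndiag_nth)

lemma oct_comm_diagonal:
  assumes "diagonal V"
  shows "oct_comm V W $ r $ c = emul (V $ r $ r) (W $ r $ c) - emul (W $ r $ c) (V $ c $ c)"
proof -
  have "oct_comm V W $ r $ c = (\<Sum>k\<in>UNIV. (if k = r then emul (V $ r $ r) (W $ r $ c) else 0)
      - (if k = c then emul (W $ r $ c) (V $ c $ c) else 0))"
    unfolding oct_comm_def vec_lambda_beta using assms by (intro sum.cong refl) (auto simp: diagonal_def)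
  then show ?thesis
    by (simp add: sum_subtractf)
qed

lemma left_comm_diagonal:
  assumes "diagonal V" "diagonal W" "left_comm V W U"
  shows "lact (U $ r $ r) t = lact (V $ r $ r) (lact (W $ r $ r) t) - lact (W $ r $ r) (lact (V $ r $ r) t)"
proof -
  have "lact (U $ r $ r) t = (\<Sum>k\<in>UNIV. lact (V $ r $ k) (lact (W $ k $ r) t) - lact (W $ r $ k) (lact (V $ k $ r) t))"
    using assms(3) unfolding left_comm_def by blast
  also have "\<dots> = (\<Sum>k\<in>UNIV. if k = r then
      lact (V $ r $ r) (lact (W $ r $ r) t) - lact (W $ r $ r) (lact (V $ r $ r) t) else 0)"
    using assms(1,2) by (intro sum.cong refl) (auto simp: diagonal_def)
  finally have "lact (U $ r $ r) t = (\<Sum>k\<in>UNIV. if k = r then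
      lact (V $ r $ r) (lact (W $ r $ r) t) - lact (W $ r $ r) (lact (V $ r $ r) t) else 0)" .
  then show ?thesis
    by simp
qed

context oct_side
begin

lemma oct_comm_sdiag:
  assumes "p \<in> imag_units"
  shows "oct_comm (sdiag l (oct p)) (off l t) = off l (tmul (u p) t + tmul t (u p))"
    and "oct_comm (sdiag l (oct p)) (off (next_lang l) t) = off (next_lang l) (- tmul (u p) t)"
    and "oct_comm (sdiag l (oct p)) (off (next_lang (next_lang l)) t) = off (next_lang (next_lang l)) (- tmul t (u p))"
proof -
  have eq: "V = W" if "\<forall>r c. V $ r $ c = W $ r $ c" for V W :: "('k, 'l) mat"
    using that by (simp add: vec_eq_iff)
  note simps = emul_ten tconj_tmul tconj_minus tconj_add tmul_minus tconj_imag [OF assms]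
    ten_entry_minus ten_entry_add
  have minus: "- oct p = ten_entry (- u p)"
    by (simp add: oct ten_entry_minus)
  show "oct_comm (sdiag l (oct p)) (off l t) = off l (tmul (u p) t + tmul t (u p))"
    by (rule eq, unfold oct_comm_diagonal [OF diagonal_sdiag] forall_pos [of _ l] off_nth sdiag_nth minus)
      (simp add: oct emul_ten flip: ten_entry_minus, simp add: simps add.commute)
  show "oct_comm (sdiag l (oct p)) (off (next_lang l) t) = off (next_lang l) (- tmul (u p) t)"
    by (rule eq, unfold oct_comm_diagonal [OF diagonal_sdiag] forall_pos [of _ l] off_nth sdiag_nth minus)
      (simp add: oct emul_ten flip: ten_entry_minus, simp add: simps)
  show "oct_comm (sdiag l (oct p)) (off (next_lang (next_lang l)) t) = off (next_lang (next_lang l)) (- tmul t (u p))"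
    by (rule eq, unfold oct_comm_diagonal [OF diagonal_sdiag] forall_pos [of _ l] off_nth sdiag_nth minus)
      (simp add: oct emul_ten flip: ten_entry_minus, simp add: simps)
qed

lemma emul_nest:
  assumes "p \<in> imag_units" "q \<in> imag_units" "p \<noteq> q"
  shows "emul (nest p q) (ten_entry t) = ten_entry (tmul (u p) (tmul (u q) t))"
    and "emul (ten_entry t) (nest p q) = ten_entry (tmul (tmul t (u p)) (u q))"
  using snd_nest [OF assms(3)] by (simp_all add: emul_def lact_nest_imag ract_nest_imag assms)

lemma oct_comm_ndiag:
  assumes "p \<in> imag_units" "q \<in> imag_units" "p \<noteq> q"
  shows "oct_comm (ndiag l (nest p q)) (off (next_lang l) t) = off (next_lang l) (tmul (u p) (tmul (u q) t))"
    and "oct_comm (ndiag l (nest p q)) (off (next_lang (next_lang l)) t)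
      = off (next_lang (next_lang l)) (- tmul (tmul t (u p)) (u q))"
proof -
  have eq: "V = W" if "\<forall>r c. V $ r $ c = W $ r $ c" for V W :: "('k, 'l) mat"
    using that by (simp add: vec_eq_iff)
  have c: "tconj (tmul (u p) (tmul (u q) t)) = - tmul (tmul (tconj t) (u p)) (u q)"
    using tmul_clifford_right [OF assms, of "tconj t"] by (simp add: tconj_tmul tconj_imag assms tmul_minus)
  have d: "tconj (tmul (tmul t (u p)) (u q)) = - tmul (u p) (tmul (u q) (tconj t))"
    using tmul_clifford [OF assms, of "tconj t"] by (simp add: tconj_tmul tconj_imag assms tmul_minus)
  show "oct_comm (ndiag l (nest p q)) (off (next_lang l) t) = off (next_lang l) (tmul (u p) (tmul (u q) t))"
    by (rule eq, unfold oct_comm_diagonal [OF diagonal_ndiag] forall_pos [of _ l] off_nth ndiag_nth)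
      (simp add: emul_nest assms flip: ten_entry_minus, simp add: c tmul_minus)
  show "oct_comm (ndiag l (nest p q)) (off (next_lang (next_lang l)) t)
      = off (next_lang (next_lang l)) (- tmul (tmul t (u p)) (u q))"
    by (rule eq, unfold oct_comm_diagonal [OF diagonal_ndiag] forall_pos [of _ l] off_nth ndiag_nth)
      (simp add: emul_nest assms flip: ten_entry_minus, simp add: d tmul_minus tconj_minus ten_entry_minus)
qed

lemma diag_gens_cases:
  assumes "V \<in> diag_gens oct nest l"
  obtains p where "p \<in> imag_units" "V = sdiag l (oct p)"
  | p q where "p \<in> imag_units" "q \<in> imag_units" "p \<noteq> q" "V = ndiag l (nest p q)"
  using assms unfolding diag_gens_def by blast

lemma diagonal_diag_gens: "V \<in> diag_gens oct nest l \<Longrightarrow> diagonal V"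
  by (auto simp: diag_gens_def diagonal_sdiag diagonal_ndiag)

text \<open>Linear operators that move only this tensor factor, sending units to multiples of units.
  Those of the first algebra commute with those of the second, which gives the vanishing brackets
  between the two diagonal algebras.\<close>

definition side_op :: "(('k, 'l) tensor \<Rightarrow> ('k, 'l) tensor) \<Rightarrow> bool" where
  "side_op f \<longleftrightarrow> (\<forall>s t. f (s + t) = f s + f t) \<and> (\<forall>c t. f (c *\<^sub>R t) = c *\<^sub>R f t) \<and>
     (\<exists>g h. \<forall>b x. f (mk b x) = g b *\<^sub>R mk (h b) x)"

lemma side_op_mult: "side_op (\<lambda>t. tmul (u p) t)" "side_op (\<lambda>t. tmul t (u p))"
proof -
  show "side_op (\<lambda>t. tmul (u p) t)"
    unfolding side_op_def
    by (intro conjI exI [of _ "\<lambda>b. usgn p b"] exI [of _ "\<lambda>b. utimes p b"])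
      (simp_all add: tmul_add tmul_scaleR tmul_u_mk)
  show "side_op (\<lambda>t. tmul t (u p))"
    unfolding side_op_def
    by (intro conjI exI [of _ "\<lambda>b. usgn b p"] exI [of _ "\<lambda>b. utimes b p"])
      (simp_all add: tmul_add tmul_scaleR tmul_mk_u)
qed

lemma side_op_comp:
  assumes "side_op f" "side_op g"
  shows "side_op (\<lambda>t. f (g t))"
proof -
  obtain a h where f: "\<And>b x. f (mk b x) = a b *\<^sub>R mk (h b) x"
    using assms(1) unfolding side_op_def by blast
  obtain a' h' where g: "\<And>b x. g (mk b x) = a' b *\<^sub>R mk (h' b) x"
    using assms(2) unfolding side_op_def by blast
  have "f (g (mk b x)) = (a' b * a (h' b)) *\<^sub>R mk (h (h' b)) x" for b x
    using assms(1) by (simp add: f g side_op_def)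
  then show ?thesis
    using assms unfolding side_op_def
    by (intro conjI exI [of _ "\<lambda>b. a' b * a (h' b)"] exI [of _ "\<lambda>b. h (h' b)"]) simp_all
qed

lemma side_op_minus:
  assumes "side_op f"
  shows "side_op (\<lambda>t. - f t)"
proof -
  obtain g h where "\<And>b x. f (mk b x) = g b *\<^sub>R mk (h b) x"
    using assms unfolding side_op_def by blast
  then show ?thesis
    using assms unfolding side_op_def
    by (intro conjI exI [of _ "\<lambda>b. - g b"] exI [of _ h]) simp_all
qed

end

section \<open>Diagonal matrices as elements of E8\<close>

context e8_side
begin

definition oct_sum :: "lang \<Rightarrow> ('k, 'l) tensor \<Rightarrow> 'f e8_alg" where
  "oct_sum l y = (\<Sum>p\<in>UNIV. (y $ idx p) *\<^sub>R dd l uone p)"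

definition nest_sum :: "lang \<Rightarrow> 'u nested \<Rightarrow> 'f e8_alg" where
  "nest_sum l n = (\<Sum>(p, q)\<in>UNIV. (n $ (p, q)) *\<^sub>R dd l p q)"

lemma oct_sum_linear: "oct_sum l (x + y) = oct_sum l x + oct_sum l y"
    "oct_sum l (c *\<^sub>R x) = c *\<^sub>R oct_sum l x" "oct_sum l (- x) = - oct_sum l x" "oct_sum l 0 = 0"
  by (simp_all add: oct_sum_def scaleR_left_distrib sum.distrib scaleR_right.sum sum_negf)

lemma nest_sum_linear: "nest_sum l (x + y) = nest_sum l x + nest_sum l y"
    "nest_sum l (x - y) = nest_sum l x - nest_sum l y"
    "nest_sum l (c *\<^sub>R x) = c *\<^sub>R nest_sum l x" "nest_sum l 0 = 0"
  by (simp_all add: nest_sum_def scaleR_left_distrib scaleR_left_diff_distrib sum.distrib sum_subtractf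
      scaleR_right.sum case_prod_unfold)

text \<open>
  The coefficients express a diagonal matrix by \<open>D\<close> and \<open>E\<close> matrices with octonion entries and by
  \<open>D\<close>, \<open>E\<close> and \<open>F\<close> matrices with nested entries.
\<close>

definition diag_map :: "('k, 'l) mat \<Rightarrow> 'f e8_alg" where
  "diag_map V = oct_sum LD (fst (V $ 1 $ 1)) - oct_sum LE (fst (V $ 3 $ 3)) + (1/2) *\<^sub>R
     (nest_sum LD (nested (V $ 1 $ 1) + nested (V $ 2 $ 2) - nested (V $ 3 $ 3))
       + nest_sum LE (nested (V $ 2 $ 2) + nested (V $ 3 $ 3) - nested (V $ 1 $ 1))
       + nest_sum LF (nested (V $ 1 $ 1) + nested (V $ 3 $ 3) - nested (V $ 2 $ 2)))"

lemma diag_map_add: "diag_map (V + W) = diag_map V + diag_map W"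
  unfolding diag_map_def
  by (simp add: nested_add nest_sum_linear oct_sum_linear scaleR_add_right scaleR_diff_right)

lemma diag_map_scaleR: "diag_map (c *\<^sub>R V) = c *\<^sub>R diag_map V"
  unfolding diag_map_def
  by (simp add: nested_scaleR nest_sum_linear oct_sum_linear scaleR_add_right scaleR_diff_right mult.commute)

lemma nested_zero [simp]: "nested 0 = 0"
  using nested_scaleR [of 0 0] by simp

lemma nested_minus: "nested (- x) = - nested x"
  using nested_scaleR [of "- 1" x] by simp

lemma diag_map_off [simp]: "diag_map (off l t) = 0"
proof -
  have "off l t $ r $ r = 0" for r
    by (auto simp: off_nth)
  then show ?thesis
    by (simp add: diag_map_def oct_sum_linear nest_sum_linear)
qed

lemma diag_map_other:
  assumes "\<And>p. p \<in> imag_units \<Longrightarrow> fst x $ idx p = 0" "nested x = 0"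
  shows "diag_map (sdiag l x) = 0" "diag_map (ndiag l x) = 0"
proof -
  \<comment> \<open>The coordinate of the unit is shared by the two algebras, but it is multiplied
    by \<open>dd l uone uone = 0\<close>.\<close>
  have "(fst x $ idx p) *\<^sub>R dd l uone p = 0" for p l
    using assms(1) [of p] by (cases "p = uone") (auto simp: imag_units_def)
  then have "oct_sum l (fst x) = 0" for l
    unfolding oct_sum_def by (intro sum.neutral) simp
  then show "diag_map (sdiag l x) = 0" "diag_map (ndiag l x) = 0"
    using assms(2) by (simp_all add: diag_map_def sdiag_nth ndiag_nth nested_minus oct_sum_linear nest_sum_linear)
qed

text \<open>\<open>diag_map\<close> has octonion coordinates for the languages D and E only. A
  matrix of language F is read as minus the sum of the other two, which is correct by
  \<open>dd_sum_lang\<close>.\<close>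

lemma diag_map_sdiag:
  assumes "p \<in> imag_units"
  shows "diag_map (sdiag l (oct p)) = dd l uone p"
proof -
  have "oct_sum l (fst (oct p)) = (\<Sum>q\<in>UNIV. if q = p then dd l uone p else 0)" for l
    unfolding oct_sum_def by (intro sum.cong refl) (auto simp: oct u_axis axis_def idx_inject)
  then have e: "oct_sum l (fst (oct p)) = dd l uone p" for l
    by simp
  have n: "nested (oct p) = 0"
    by (simp add: oct nested_ten)
  have s: "dd LD uone p + dd LE uone p + dd LF uone p = 0"
    using dd_sum_lang [OF assms, of LD] by simp
  have "dd LF uone p = (dd LD uone p + dd LE uone p + dd LF uone p) - dd LD uone p - dd LE uone p"
    by simp
  then have "dd LF uone p = - dd LD uone p - dd LE uone p"
    unfolding s by simp
  then show ?thesis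
    by (cases l)
      (simp_all add: diag_map_def vector_3 e n nested_minus oct_sum_linear nest_sum_linear)
qed

lemma nest_sum_axis: "nest_sum l (axis (p, q) 1) = dd l p q"
proof -
  have "nest_sum l (axis (p, q) 1) = (\<Sum>x\<in>UNIV. if x = (p, q) then dd l p q else 0)"
    unfolding nest_sum_def case_prod_unfold by (intro sum.cong refl) (auto simp: axis_def)
  then show ?thesis
    by simp
qed

lemma nest_sum_circ: "nest_sum l (circ p q) = dd l p q"
  unfolding circ_def nest_sum_linear nest_sum_axis dd_swap [of l q p] diff_minus_eq_add
  by (rule half_double)

lemma diag_map_ndiag: "diag_map (ndiag l (nest p q)) = dd l p q"
  by (cases l)
    (simp_all add: diag_map_def vector_3 nested_nest fst_nest nest_sum_linear nest_sum_circ oct_sum_linear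
      flip: scaleR_2)

text \<open>Read as a left multiplication, the entry in position \<open>pos2 l\<close> is the action
  on the next type. This is why evaluating entries as left multiplications within one language
  agrees with the bracket.\<close>

lemma diag_gens_next:
  assumes "V \<in> diag_gens oct nest l"
  shows "e8_bracket (diag_map V) (off_map (next_lang l) t) = off_map (next_lang l) (lact (V $ pos2 l $ pos2 l) t)"
  using assms
proof (cases rule: diag_gens_cases)
  case (1 p)
  have "- oct p = ten_entry (- u p)"
    by (simp add: oct ten_entry_minus)
  with 1 show ?thesis
    by (simp add: diag_map_sdiag dd_next sdiag_nth tmul_minus off_map_minus)
next
  case (2 p q)
  then show ?thesis
    by (simp add: diag_map_ndiag dd_next_nest ndiag_nth lact_nest_imag)
qed

lemma diag_gens_side_op:
  assumes "V \<in> diag_gens oct nest l" "j \<noteq> l"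
  shows "\<exists>f. side_op f \<and> (\<forall>t. e8_bracket (diag_map V) (off_map j t) = off_map j (f t))"
  using assms(1)
proof (cases rule: diag_gens_cases)
  case (1 p)
  consider "j = next_lang l" | "j = next_lang (next_lang l)"
    using assms(2) lang_exhaust_next [of l j] by blast
  then show ?thesis
  proof cases
    case j: 1
    show ?thesis
      by (rule exI [of _ "\<lambda>t. - tmul (u p) t"])
        (simp add: 1 j diag_map_sdiag dd_next off_map_minus side_op_minus side_op_mult)
  next
    case j: 2
    show ?thesis
      by (rule exI [of _ "\<lambda>t. - tmul t (u p)"])
        (simp add: 1 j diag_map_sdiag dd_prev off_map_minus side_op_minus side_op_mult)
  qed
next
  case (2 p q)
  consider "j = next_lang l" | "j = next_lang (next_lang l)"
    using assms(2) lang_exhaust_next [of l j] by blast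
  then show ?thesis
  proof cases
    case j: 1
    show ?thesis
      by (rule exI [of _ "\<lambda>t. tmul (u p) (tmul (u q) t)"])
        (simp add: 2 j diag_map_ndiag dd_next_nest
          side_op_comp [of "\<lambda>t. tmul (u p) t" "\<lambda>t. tmul (u q) t"] side_op_mult)
  next
    case j: 2
    show ?thesis
      by (rule exI [of _ "\<lambda>t. - tmul (tmul t (u p)) (u q)"])
        (simp add: 2 j diag_map_ndiag dd_prev_nest off_map_minus side_op_minus
          side_op_comp [of "\<lambda>t. tmul t (u q)" "\<lambda>t. tmul t (u p)"] side_op_mult)
  qed
qed

lemma oct_comm_sdiag_bracket:
  assumes "p \<in> imag_units"
  shows "\<exists>s. oct_comm (sdiag l (oct p)) (off m t) = off m s \<and> e8_bracket (dd l uone p) (off_map m t) = off_map m s"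
proof -
  consider "m = l" | "m = next_lang l" | "m = next_lang (next_lang l)"
    using lang_exhaust_next [of l m] by blast
  then show ?thesis
    by cases (use oct_comm_sdiag [OF assms, of l t] dd_same [OF assms, of l t] dd_next [OF assms, of l t]
      dd_prev [OF assms, of l t] in \<open>auto simp: off_map_minus\<close>)
qed

lemma oct_comm_ndiag_bracket:
  assumes "p \<in> imag_units" "q \<in> imag_units" "p \<noteq> q" "l \<noteq> m"
  shows "\<exists>s. oct_comm (ndiag l (nest p q)) (off m t) = off m s \<and> e8_bracket (dd l p q) (off_map m t) = off_map m s"
proof -
  consider "m = next_lang l" | "m = next_lang (next_lang l)"
    using lang_exhaust_next [of l m] assms(4) by blast
  then show ?thesis
    by cases (use oct_comm_ndiag [OF assms(1-3), of l t] dd_next_nest [OF assms(1-3), of l t]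
      dd_prev_nest [OF assms(1-3), of l t] in \<open>auto simp: off_map_minus\<close>)
qed

lemma left_comm_ndiag_off:
  assumes "p \<in> imag_units" "q \<in> imag_units" "p \<noteq> q"
    and "left_comm (ndiag l (nest p q)) (off l s) (off l s')"
  shows "e8_bracket (dd l p q) (off_map l s) = off_map l s'"
proof -
  \<comment> \<open>Evaluation at the unit recovers s' from the left multiplication that
    \<open>left_comm\<close> prescribes.\<close>
  have "lact (off l s' $ pos l $ pos2 l) (u uone)
      = (\<Sum>k\<in>UNIV. lact (ndiag l (nest p q) $ pos l $ k) (lact (off l s $ k $ pos2 l) (u uone))
          - lact (off l s $ pos l $ k) (lact (ndiag l (nest p q) $ k $ pos2 l) (u uone)))"
    using assms(4) unfolding left_comm_def by blast
  then have "s' = tmul (u p) (tmul (u q) s) - tmul s (tmul (u p) (u q))"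
    by (simp add: sum_pos [of _ l] off_nth ndiag_nth lact_nest_imag assms)
  then show ?thesis
    by (simp add: dd_same_nest assms)
qed

end


section \<open>The two tensor factors and the map on all matrices\<close>

lemma sum_circ: "(\<Sum>u\<in>UNIV. (circ p q $ u) *\<^sub>R f u) = (1/2) *\<^sub>R (f (p, q) - f (q, p) :: 'a::real_vector)"
  for p q :: "'b ounit"
proof -
  have ax: "(\<Sum>u\<in>UNIV. (axis x (1::real) $ u) *\<^sub>R f u) = f x" for x
  proof -
    have "(\<Sum>u\<in>UNIV. (axis x (1::real) $ u) *\<^sub>R f u) = (\<Sum>u\<in>UNIV. if u = x then f x else 0)"
      by (intro sum.cong refl) (auto simp: axis_def)
    then show ?thesis by simp
  qed
  have lin: "(\<Sum>u\<in>UNIV. ((c *\<^sub>R (a - b)) $ u) *\<^sub>R f u)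
      = c *\<^sub>R ((\<Sum>u\<in>UNIV. (a $ u) *\<^sub>R f u) - (\<Sum>u\<in>UNIV. (b $ u) *\<^sub>R f u))" for c and a b :: "'b nested"
    by (simp add: right_diff_distrib scaleR_left_diff_distrib sum_subtractf scaleR_right_diff_distrib scaleR_right.sum)
  show ?thesis
    unfolding circ_def lin ax ..
qed

lemma circ_swap: "circ q p = - circ p q"
  by (simp add: circ_def flip: scaleR_minus_right)

lemma circ_nonzero: "p \<noteq> q \<Longrightarrow> circ p q \<noteq> 0"
proof
  assume "p \<noteq> q" "circ p q = 0"
  then have "circ p q $ (p, q) = 0"
    by simp
  with \<open>p \<noteq> q\<close> show False
    by (simp add: circ_def axis_def)
qed

lemma oct_side_K: "oct_side (\<lambda>p. tens p uone) tens uone (octK :: _ \<Rightarrow> ('k::oct_alg, 'l::oct_alg) entry) nestK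
    (\<lambda>e. fst (snd e)) (\<lambda>p. (p, uone))"
proof (unfold_locales, goal_cases)
  case (2 p b x)
  show ?case by (simp add: tmul_tens)
next
  case (3 b x p)
  show ?case by (simp add: tmul_tens)
next
  case (4 P t)
  then show ?case by (rule tensor_induct)
next
  case (5 p)
  show ?case by (simp add: tconj_tens uconj_def)
next
  case (6 p)
  show ?case by (rule tens_def)
next
  case (8 p)
  show ?case by (rule octK_def)
next
  case (15 q p)
  show ?case unfolding nestK_def circ_swap [of q p] by simp
qed (simp_all add: nestK_def ten_entry_def circ_nonzero
    lact_def ract_def zero_prod_def case_prod_unfold sum_circ)

lemma oct_side_L: "oct_side (\<lambda>P. tens uone P) (\<lambda>P b. tens b P) uone (octL :: _ \<Rightarrow> ('k::oct_alg, 'l::oct_alg) entry) nestL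
    (\<lambda>e. snd (snd e)) (\<lambda>P. (uone, P))"
proof (unfold_locales, goal_cases)
  case (2 p b x)
  show ?case by (simp add: tmul_tens)
next
  case (3 b x p)
  show ?case by (simp add: tmul_tens)
next
  case (4 P t)
  then show ?case by (rule tensor_induct)
next
  case (5 p)
  show ?case by (simp add: tconj_tens uconj_def)
next
  case (6 p)
  show ?case by (rule tens_def)
next
  case (8 p)
  show ?case by (rule octL_def)
next
  case (15 q p)
  show ?case unfolding nestL_def circ_swap [of q p] by simp
qed (simp_all add: nestL_def ten_entry_def circ_nonzero
    lact_def ract_def zero_prod_def case_prod_unfold sum_circ)

context oct_side
begin

lemma sdiag_in_diag_gens: "p \<in> imag_units \<Longrightarrow> sdiag l (oct p) \<in> diag_gens oct nest l"
  unfolding diag_gens_def by blast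

lemma ndiag_in_diag_gens:
  "p \<in> imag_units \<Longrightarrow> q \<in> imag_units \<Longrightarrow> p \<noteq> q \<Longrightarrow> ndiag l (nest p q) \<in> diag_gens oct nest l"
  unfolding diag_gens_def by blast

end

interpretation octK: oct_side "\<lambda>p. tens p uone" tens uone octK nestK "\<lambda>e. fst (snd e)" "\<lambda>p. (p, uone)"
  by (rule oct_side_K)

interpretation octL: oct_side "\<lambda>P. tens uone P" "\<lambda>P b. tens b P" uone octL nestL "\<lambda>e. snd (snd e)" "\<lambda>P. (uone, P)"
  by (rule oct_side_L)

lemma left_commD: "left_comm V W U \<Longrightarrow> lact (U $ r $ c) t =
     (\<Sum>k\<in>UNIV. lact (V $ r $ k) (lact (W $ k $ c) t) - lact (W $ r $ k) (lact (V $ k $ c) t))"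
  unfolding left_comm_def by blast

context e8_model
begin

sublocale K: e8_side w v tK tL "\<lambda>p. tens p uone" tens uone octK nestK "\<lambda>e. fst (snd e)" "\<lambda>p. (p, uone)"
  by (intro e8_side.intro e8_model_axioms oct_side_K)

sublocale L: e8_side w v tK tL "\<lambda>P. tens uone P" "\<lambda>P b. tens b P" uone octL nestL "\<lambda>e. snd (snd e)" "\<lambda>P. (uone, P)"
  by (intro e8_side.intro e8_model_axioms oct_side_L)

text \<open>Of the off-diagonal entries only (1,2), (2,3) and (3,1) are used, because in
  \<open>mats\<close> the opposite ones are minus their conjugates.\<close>

definition Phi :: "('k, 'l) mat \<Rightarrow> 'f e8_alg" where
  "Phi V = off_map LD (fst (V $ 1 $ 2)) + off_map LE (fst (V $ 2 $ 3)) + off_map LF (fst (V $ 3 $ 1))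
     + (K.diag_map V + L.diag_map V)"

lemma Phi_add: "Phi (V + W) = Phi V + Phi W"
  by (simp add: Phi_def off_map_add K.diag_map_add L.diag_map_add)

lemma Phi_scaleR: "Phi (c *\<^sub>R V) = c *\<^sub>R Phi V"
  by (simp add: Phi_def off_map_scaleR K.diag_map_scaleR L.diag_map_scaleR scaleR_add_right)

lemma Phi_minus: "Phi (- V) = - Phi V"
  using Phi_scaleR [of "- 1" V] by simp

lemma Phi_diff: "Phi (V - W) = Phi V - Phi W"
  using Phi_add [of V "- W"] by (simp add: Phi_minus)

lemma Phi_zero [simp]: "Phi 0 = 0"
  using Phi_scaleR [of 0 0] by simp

lemma Phi_off: "Phi (off l t) = off_map l t"
  unfolding Phi_def K.diag_map_off L.diag_map_off by (cases l) (simp_all add: vector_3)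

lemma Phi_diagonal: "diagonal V \<Longrightarrow> Phi V = K.diag_map V + L.diag_map V"
  by (simp add: Phi_def diagonal_def)

lemma Phi_diag_gens_K:
  assumes "V \<in> diag_gens octK nestK l"
  shows "Phi V = K.diag_map V"
proof -
  have "L.diag_map V = 0"
    using assms
  proof (cases rule: octK.diag_gens_cases)
    case (1 p)
    have "fst (octK p) $ (uone, P) = 0" for P
      using 1(1) by (auto simp: octK_def ten_entry_def tens_def axis_def imag_units_def)
    then show ?thesis
      unfolding 1(2) by (intro L.diag_map_other) (simp_all add: octK_def)
  next
    case (2 p q)
    then show ?thesis
      by (auto intro!: L.diag_map_other simp: nestK_def)
  qed
  then show ?thesis
    using octK.diagonal_diag_gens [OF assms] by (simp add: Phi_diagonal)
qed

lemma Phi_diag_gens_L: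
  assumes "V \<in> diag_gens octL nestL l"
  shows "Phi V = L.diag_map V"
proof -
  have "K.diag_map V = 0"
    using assms
  proof (cases rule: octL.diag_gens_cases)
    case (1 p)
    have "fst (octL p) $ (q, uone) = 0" for q
      using 1(1) by (auto simp: octL_def ten_entry_def tens_def axis_def imag_units_def)
    then show ?thesis
      unfolding 1(2) by (intro K.diag_map_other) (simp_all add: octL_def)
  next
    case (2 p q)
    then show ?thesis
      by (auto intro!: K.diag_map_other simp: nestL_def)
  qed
  then show ?thesis
    using octL.diagonal_diag_gens [OF assms] by (simp add: Phi_diagonal)
qed

lemma Phi_sdiag_nest [simp]:
  "p \<in> imag_units \<Longrightarrow> Phi (sdiag l (octK p)) = K.dd l uone p"
  "P \<in> imag_units \<Longrightarrow> Phi (sdiag l (octL P)) = L.dd l uone P"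
  "p \<in> imag_units \<Longrightarrow> q \<in> imag_units \<Longrightarrow> p \<noteq> q \<Longrightarrow> Phi (ndiag l (nestK p q)) = K.dd l p q"
  "P \<in> imag_units \<Longrightarrow> Q \<in> imag_units \<Longrightarrow> P \<noteq> Q \<Longrightarrow> Phi (ndiag l (nestL P Q)) = L.dd l P Q"
  using Phi_diag_gens_K [OF octK.sdiag_in_diag_gens, of p l] Phi_diag_gens_L [OF octL.sdiag_in_diag_gens, of P l]
    Phi_diag_gens_K [OF octK.ndiag_in_diag_gens, of p q l] Phi_diag_gens_L [OF octL.ndiag_in_diag_gens, of P Q l]
  by (simp_all add: K.diag_map_sdiag L.diag_map_sdiag K.diag_map_ndiag L.diag_map_ndiag)

lemma Phi_span_next:
  assumes "U \<in> span (diag_gens octK nestK l \<union> diag_gens octL nestL l)"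
  shows "e8_bracket (Phi U) (off_map (next_lang l) t) = off_map (next_lang l) (lact (U $ pos2 l $ pos2 l) t)"
  using assms
proof (induction U rule: span_induct_alt)
  case base
  show ?case by simp
next
  case (step c V W)
  have "e8_bracket (Phi V) (off_map (next_lang l) t) = off_map (next_lang l) (lact (V $ pos2 l $ pos2 l) t)"
    using step(1) K.diag_gens_next [of V l t] L.diag_gens_next [of V l t]
    by (auto simp: Phi_diag_gens_K Phi_diag_gens_L)
  with step show ?case
    by (simp add: Phi_add Phi_scaleR e8_bracket_add_left e8_bracket_scaleR lact_add lact_scaleR
        off_map_add off_map_scaleR)
qed

lemma Phi_diag_diag:
  assumes V: "V \<in> diag_gens octK nestK l \<union> diag_gens octL nestL l"
    and W: "W \<in> diag_gens octK nestK l \<union> diag_gens octL nestL l"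
    and U: "U \<in> span (diag_gens octK nestK l \<union> diag_gens octL nestL l)"
    and c: "left_comm V W U"
  shows "Phi U = e8_bracket (Phi V) (Phi W)"
proof -
  have d: "diagonal V" "diagonal W"
    using V W octK.diagonal_diag_gens octL.diagonal_diag_gens by auto
  have n: "e8_bracket (Phi X) (off_map (next_lang l) t) = off_map (next_lang l) (lact (X $ pos2 l $ pos2 l) t)"
    if "X \<in> {V, W, U}" for X t
    using that V W U by (intro Phi_span_next) (auto intro: span_base)
  have "Phi U - e8_bracket (Phi V) (Phi W) = 0"
    by (rule off_map_centralizer_eq_0 [where l = "next_lang l"])
      (simp add: e8_bracket_diff_left e8_bracket_jacobi(1) n left_comm_diagonal [OF d c] off_map_diff)
  then show ?thesis
    by simp
qed

lemma Phi_off_off: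
  assumes U: "U \<in> span (diag_gens octK nestK l \<union> diag_gens octL nestL l)"
    and c: "left_comm (off l s) (off l s') U"
  shows "Phi U = e8_bracket (off_map l s) (off_map l s')"
proof -
  have *: "lact (U $ pos2 l $ pos2 l) t = tmul (tconj s') (tmul s t) - tmul (tconj s) (tmul s' t)" for t
    unfolding left_commD [OF c] by (simp add: sum_pos [of _ l] off_nth lact_minus)
  have "Phi U - e8_bracket (off_map l s) (off_map l s') = 0"
    by (rule off_map_centralizer_eq_0 [where l = "next_lang l"])
      (simp add: * e8_bracket_diff_left Phi_span_next [OF U] off_map_same_next off_map_diff)
  then show ?thesis
    by simp
qed

lemma Phi_K_L:
  assumes "V \<in> diag_gens octK nestK l" "W \<in> diag_gens octL nestL m"
  shows "e8_bracket (Phi V) (Phi W) = 0"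
proof -
  \<comment> \<open>On a type different from both languages, \<open>diag_gens_side_op\<close>
    provides operators of the two tensor factors, and these commute.\<close>
  have "\<exists>j. j \<noteq> l \<and> j \<noteq> m"
    by (cases "next_lang l = m") (auto intro: exI [of _ "next_lang l"] exI [of _ "next_lang (next_lang l)"])
  then obtain j where j: "j \<noteq> l" "j \<noteq> m" by blast
  obtain f where f: "octK.side_op f" "\<And>t. e8_bracket (K.diag_map V) (off_map j t) = off_map j (f t)"
    using K.diag_gens_side_op [OF assms(1) j(1)] by blast
  obtain g where g: "octL.side_op g" "\<And>t. e8_bracket (L.diag_map W) (off_map j t) = off_map j (g t)"
    using L.diag_gens_side_op [OF assms(2) j(2)] by blast
  have fg: "f (g t) = g (f t)" for t
  proof (induction t rule: tensor_induct)
    case (tens a A)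
    obtain c h where f': "\<And>b B. f (tens b B) = c b *\<^sub>R tens (h b) B"
      using f(1) unfolding octK.side_op_def by blast
    obtain c' h' where g': "\<And>b B. g (tens b B) = c' B *\<^sub>R tens b (h' B)"
      using g(1) unfolding octL.side_op_def by blast
    show ?case
      using f(1) g(1) by (simp add: octK.side_op_def octL.side_op_def f' g')
  qed (use f(1) g(1) in \<open>simp_all add: octK.side_op_def octL.side_op_def\<close>)
  show ?thesis
    unfolding Phi_diag_gens_K [OF assms(1)] Phi_diag_gens_L [OF assms(2)]
    by (rule off_map_centralizer_eq_0 [where l = j]) (simp add: e8_bracket_jacobi(1) f(2) g(2) fg)
qed

theorem commutator_Phi: "commutator V W U \<Longrightarrow> Phi U = e8_bracket (Phi V) (Phi W)"
proof (induction rule: commutator.induct)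
  case (diag_K V l W U)
  then show ?case
    using span_mono [of "diag_gens octK nestK l" "diag_gens octK nestK l \<union> diag_gens octL nestL l"]
    by (intro Phi_diag_diag [where l = l]) auto
next
  case (diag_L V l W U)
  then show ?case
    using span_mono [of "diag_gens octL nestL l" "diag_gens octK nestK l \<union> diag_gens octL nestL l"]
    by (intro Phi_diag_diag [where l = l]) auto
next
  case (diag_K_L V l W m)
  then show ?case by (simp add: Phi_K_L)
next
  case (off_same U l a A b B)
  then show ?case by (simp add: Phi_off_off Phi_off)
next
  case (off_other l m a A b B)
  then consider "m = next_lang l" | "m = next_lang (next_lang l)"
    using lang_exhaust_next by blast
  then show ?case
  proof cases
    case 1
    then show ?thesis
      by (simp add: oct_comm_off_next Phi_off off_map_bracket off_map_minus)
  next
    case 2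
    then show ?thesis
      using off_map_bracket' [of m "tens a A" "tens b B"]
      by (simp add: oct_comm_off_prev Phi_off)
  qed
next
  case (oct_off V l m a A)
  then consider p where "p \<in> imag_units" "V = sdiag l (octK p)" | P where "P \<in> imag_units" "V = sdiag l (octL P)"
    by auto
  then show ?case
  proof cases
    case (1 p)
    then show ?thesis
      using K.oct_comm_sdiag_bracket [OF 1(1), of l m "tens a A"] by (auto simp: Phi_off)
  next
    case (2 P)
    then show ?thesis
      using L.oct_comm_sdiag_bracket [OF 2(1), of l m "tens a A"] by (auto simp: Phi_off)
  qed
next
  case (nest_off_other V l m a A)
  then consider p q where "p \<in> imag_units" "q \<in> imag_units" "p \<noteq> q" "V = ndiag l (nestK p q)"
    | P Q where "P \<in> imag_units" "Q \<in> imag_units" "P \<noteq> Q" "V = ndiag l (nestL P Q)"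
    by auto
  then show ?case
  proof cases
    case (1 p q)
    then show ?thesis
      using K.oct_comm_ndiag_bracket [OF 1(1-3) nest_off_other(2), of "tens a A"] by (auto simp: Phi_off)
  next
    case (2 P Q)
    then show ?thesis
      using L.oct_comm_ndiag_bracket [OF 2(1-3) nest_off_other(2), of "tens a A"] by (auto simp: Phi_off)
  qed
next
  case (nest_off_same V l U a A)
  then obtain s where U: "U = off l s" by auto
  from nest_off_same consider p q where "p \<in> imag_units" "q \<in> imag_units" "p \<noteq> q" "V = ndiag l (nestK p q)"
    | P Q where "P \<in> imag_units" "Q \<in> imag_units" "P \<noteq> Q" "V = ndiag l (nestL P Q)"
    by auto
  then show ?case
  proof cases
    case (1 p q)
    then show ?thesis
      using K.left_comm_ndiag_off [OF 1(1-3), of l "tens a A" s] nest_off_same(3) by (simp add: Phi_off U)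
  next
    case (2 P Q)
    then show ?thesis
      using L.left_comm_ndiag_off [OF 2(1-3), of l "tens a A" s] nest_off_same(3) by (simp add: Phi_off U)
  qed
next
  case (antisym V W U)
  show ?case
    unfolding Phi_minus antisym.IH by (rule e8_bracket_swap [symmetric])
qed (simp_all add: Phi_add Phi_scaleR e8_bracket_add_left e8_bracket_scaleR)


end


subsection \<open>Existence of commutators\<close>

lemma vec_two_mult: "2 * t = 2 *\<^sub>R (t :: real ^ 'n)"
  by (simp add: vec_eq_iff)

lemma left_comm_diagonalI:
  assumes "diagonal V" "diagonal W" "diagonal U"
    and "\<And>r t. lact (U $ r $ r) t = lact (V $ r $ r) (lact (W $ r $ r) t) - lact (W $ r $ r) (lact (V $ r $ r) t)"
  shows "left_comm V W U"
  unfolding left_comm_def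
proof (intro allI)
  fix r c t
  have "(\<Sum>k\<in>UNIV. lact (V $ r $ k) (lact (W $ k $ c) t) - lact (W $ r $ k) (lact (V $ k $ c) t))
    = (\<Sum>k\<in>UNIV. if k = r then if r = c then
      lact (V $ r $ r) (lact (W $ r $ r) t) - lact (W $ r $ r) (lact (V $ r $ r) t) else 0 else 0)"
    using assms(1,2) by (intro sum.cong refl) (auto simp: diagonal_def)
  also have "\<dots> = lact (U $ r $ c) t"
    using assms(3,4) by (auto simp: diagonal_def)
  finally show "lact (U $ r $ c) t =
      (\<Sum>k\<in>UNIV. lact (V $ r $ k) (lact (W $ k $ c) t) - lact (W $ r $ k) (lact (V $ k $ c) t))" ..
qed

lemma left_comm_minus: "left_comm V W U \<Longrightarrow> left_comm (- V) W (- U)"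
  unfolding left_comm_def by (simp add: lact_minus sum_negf [symmetric])

lemma left_comm_swap: "left_comm V W U \<Longrightarrow> left_comm W V (- U)"
  unfolding left_comm_def by (simp add: lact_minus sum_negf [symmetric])

lemma left_comm_self: "left_comm V V 0"
  unfolding left_comm_def by simp

lemma ndiag_minus: "ndiag l (- x) = - ndiag l x" and sdiag_minus: "sdiag l (- x) = - sdiag l x"
  by (simp_all add: vec_eq_iff ndiag_nth sdiag_nth)

lemma diagonal_scaleR: "diagonal V \<Longrightarrow> diagonal (c *\<^sub>R V :: ('k, 'l) mat)"
  by (simp add: diagonal_def)

lemma diagonal_minus [simp]: "diagonal (- V :: ('k, 'l) mat) \<longleftrightarrow> diagonal V"
  by (simp add: diagonal_def)

lemma diagonal_zero [simp]: "diagonal 0"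
  by (simp add: diagonal_def)

context oct_side
begin

lemma lact_oct [simp]: "lact (oct p) t = tmul (u p) t"
  by (simp add: oct)

text \<open>Passing two Clifford generators costs two signs.\<close>

lemma tmul_pass:
  assumes "p \<in> imag_units" "q \<in> imag_units" "r \<in> imag_units" "p \<noteq> q" "p \<noteq> r"
  shows "tmul (u p) (tmul (u q) (tmul (u r) t)) = tmul (u q) (tmul (u r) (tmul (u p) t))"
  using tmul_clifford [of p q "tmul (u r) t"] tmul_clifford [of p r t] assms by (simp add: tmul_minus)

lemma nest_minus_eq: "ndiag l (nest p q) = - ndiag l (nest q p)"
  by (subst nest_swap) (simp add: ndiag_minus)

lemma scale_sdiag_span: "p \<in> imag_units \<Longrightarrow> c *\<^sub>R sdiag l (oct p) \<in> span (diag_gens oct nest l)"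
  by (intro span_scale span_base sdiag_in_diag_gens)

lemma scale_ndiag_span:
  "p \<in> imag_units \<Longrightarrow> q \<in> imag_units \<Longrightarrow> p \<noteq> q \<Longrightarrow> c *\<^sub>R ndiag l (nest p q) \<in> span (diag_gens oct nest l)"
  by (intro span_scale span_base ndiag_in_diag_gens)

text \<open>The sign pattern of \<open>sdiag\<close> squares to that of \<open>ndiag\<close>, and
  \<open>sdiag\<close> times \<open>ndiag\<close> has the pattern of \<open>sdiag\<close>. Apart
  from this, the following commutators are those of the elements L_p and L_p L_q of a Clifford
  algebra.\<close>

lemma left_comm_sdiag_sdiag:
  assumes "p \<in> imag_units" "q \<in> imag_units" "p \<noteq> q"
  shows "left_comm (sdiag l (oct p)) (sdiag l (oct q)) (2 *\<^sub>R ndiag l (nest p q))"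
proof (rule left_comm_diagonalI)
  fix r t
  have "\<forall>r. lact ((2 *\<^sub>R ndiag l (nest p q)) $ r $ r) t
    = lact (sdiag l (oct p) $ r $ r) (lact (sdiag l (oct q) $ r $ r) t)
      - lact (sdiag l (oct q) $ r $ r) (lact (sdiag l (oct p) $ r $ r) t)"
    unfolding forall_pos [of _ l]
    using tmul_clifford [of q p t] assms
    by (simp add: ndiag_nth sdiag_nth lact_minus lact_scaleR lact_nest_imag vec_two_mult tmul_minus)
  then show "lact ((2 *\<^sub>R ndiag l (nest p q)) $ r $ r) t
    = lact (sdiag l (oct p) $ r $ r) (lact (sdiag l (oct q) $ r $ r) t)
      - lact (sdiag l (oct q) $ r $ r) (lact (sdiag l (oct p) $ r $ r) t)" by blast
qed (simp_all add: diagonal_sdiag diagonal_ndiag diagonal_scaleR)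

lemma left_comm_sdiag_ndiag:
  assumes "p \<in> imag_units" "q \<in> imag_units" "p \<noteq> q"
  shows "left_comm (sdiag l (oct p)) (ndiag l (nest p q)) ((- 2 * unorm p) *\<^sub>R sdiag l (oct q))"
proof (rule left_comm_diagonalI)
  fix r t
  have "\<forall>r. lact (((- 2 * unorm p) *\<^sub>R sdiag l (oct q)) $ r $ r) t
    = lact (sdiag l (oct p) $ r $ r) (lact (ndiag l (nest p q) $ r $ r) t)
      - lact (ndiag l (nest p q) $ r $ r) (lact (sdiag l (oct p) $ r $ r) t)"
    unfolding forall_pos [of _ l]
    using tmul_clifford [of q p t] assms
    by (simp add: ndiag_nth sdiag_nth lact_minus lact_scaleR lact_nest_imag tmul_minus tmul_square)
      (simp add: vec_eq_iff)
  then show "lact (((- 2 * unorm p) *\<^sub>R sdiag l (oct q)) $ r $ r) t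
    = lact (sdiag l (oct p) $ r $ r) (lact (ndiag l (nest p q) $ r $ r) t)
      - lact (ndiag l (nest p q) $ r $ r) (lact (sdiag l (oct p) $ r $ r) t)" by blast
qed (simp_all add: diagonal_sdiag diagonal_ndiag diagonal_scaleR)

lemma left_comm_sdiag_ndiag_distinct:
  assumes "p \<in> imag_units" "q \<in> imag_units" "r \<in> imag_units" "q \<noteq> r" "p \<noteq> q" "p \<noteq> r"
  shows "left_comm (sdiag l (oct p)) (ndiag l (nest q r)) 0"
proof (rule left_comm_diagonalI)
  fix i t
  have "\<forall>i. lact (0 $ i $ i) t
    = lact (sdiag l (oct p) $ i $ i) (lact (ndiag l (nest q r) $ i $ i) t)
      - lact (ndiag l (nest q r) $ i $ i) (lact (sdiag l (oct p) $ i $ i) t)"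
    unfolding forall_pos [of _ l]
    using tmul_pass [of p q r t] assms
    by (simp add: ndiag_nth sdiag_nth lact_minus lact_nest_imag tmul_minus)
  then show "lact (0 $ i $ i) t
    = lact (sdiag l (oct p) $ i $ i) (lact (ndiag l (nest q r) $ i $ i) t)
      - lact (ndiag l (nest q r) $ i $ i) (lact (sdiag l (oct p) $ i $ i) t)" by blast
qed (simp_all add: diagonal_sdiag diagonal_ndiag)

lemma left_comm_ndiag_ndiag:
  assumes "p \<in> imag_units" "q \<in> imag_units" "s \<in> imag_units" "p \<noteq> q" "q \<noteq> s" "p \<noteq> s"
  shows "left_comm (ndiag l (nest p q)) (ndiag l (nest q s)) ((- 2 * unorm q) *\<^sub>R ndiag l (nest p s))"
proof (rule left_comm_diagonalI)
  fix r t
  have 1: "tmul (u p) (tmul (u q) (tmul (u q) (tmul (u s) t))) = - (unorm q *\<^sub>R tmul (u p) (tmul (u s) t))"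
    using tmul_square [OF assms(2), of "tmul (u s) t"] by (simp add: tmul_minus tmul_scaleR)
  have 2: "tmul (u q) (tmul (u s) (tmul (u p) (tmul (u q) t))) = unorm q *\<^sub>R tmul (u p) (tmul (u s) t)"
    using tmul_pass [of q s p "tmul (u q) t"] tmul_square [OF assms(2), of t] tmul_clifford [of s p t] assms
    by (simp add: tmul_minus tmul_scaleR)
  have "\<forall>r. lact (((- 2 * unorm q) *\<^sub>R ndiag l (nest p s)) $ r $ r) t
    = lact (ndiag l (nest p q) $ r $ r) (lact (ndiag l (nest q s) $ r $ r) t)
      - lact (ndiag l (nest q s) $ r $ r) (lact (ndiag l (nest p q) $ r $ r) t)"
    unfolding forall_pos [of _ l]
    using assms
    by (simp add: ndiag_nth lact_scaleR lact_minus lact_nest_imag 1 2) (simp add: vec_eq_iff)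
  then show "lact (((- 2 * unorm q) *\<^sub>R ndiag l (nest p s)) $ r $ r) t
    = lact (ndiag l (nest p q) $ r $ r) (lact (ndiag l (nest q s) $ r $ r) t)
      - lact (ndiag l (nest q s) $ r $ r) (lact (ndiag l (nest p q) $ r $ r) t)" by blast
qed (simp_all add: diagonal_ndiag diagonal_scaleR)

lemma left_comm_ndiag_ndiag_distinct:
  assumes "p \<in> imag_units" "q \<in> imag_units" "r \<in> imag_units" "s \<in> imag_units"
    "p \<noteq> q" "r \<noteq> s" "p \<noteq> r" "p \<noteq> s" "q \<noteq> r" "q \<noteq> s"
  shows "left_comm (ndiag l (nest p q)) (ndiag l (nest r s)) 0"
proof (rule left_comm_diagonalI)
  fix i t
  have "\<forall>i. lact (0 $ i $ i) t
    = lact (ndiag l (nest p q) $ i $ i) (lact (ndiag l (nest r s) $ i $ i) t)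
      - lact (ndiag l (nest r s) $ i $ i) (lact (ndiag l (nest p q) $ i $ i) t)"
    unfolding forall_pos [of _ l]
    using tmul_pass [of q r s t] tmul_pass [of p r s "tmul (u q) t"] assms
    by (simp add: ndiag_nth lact_nest_imag)
  then show "lact (0 $ i $ i) t
    = lact (ndiag l (nest p q) $ i $ i) (lact (ndiag l (nest r s) $ i $ i) t)
      - lact (ndiag l (nest r s) $ i $ i) (lact (ndiag l (nest p q) $ i $ i) t)" by blast
qed (simp_all add: diagonal_ndiag)

text \<open>Antisymmetry of \<open>nest\<close> and of the commutator moves a common unit to the
  place where the preceding lemmas expect it.\<close>

lemma diag_left_comm_exists:
  assumes "V \<in> diag_gens oct nest l" "W \<in> diag_gens oct nest l"
  shows "\<exists>U\<in>span (diag_gens oct nest l). left_comm V W U"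
proof -
  have sn: "\<exists>U\<in>span (diag_gens oct nest l). left_comm (sdiag l (oct p)) (ndiag l (nest q r)) U"
    if "p \<in> imag_units" "q \<in> imag_units" "r \<in> imag_units" "q \<noteq> r" for p q r
  proof -
    consider "p = q" | "p = r" | "p \<noteq> q" "p \<noteq> r" by blast
    then show ?thesis
    proof cases
      case 1
      then show ?thesis
        using left_comm_sdiag_ndiag [of p r l] scale_sdiag_span [of r] that by blast
    next
      case 2
      then show ?thesis
        using left_comm_swap [OF left_comm_minus [OF left_comm_swap [OF left_comm_sdiag_ndiag [of p q l]]]]
          scale_sdiag_span [of q] that
        unfolding nest_minus_eq [of l q r] by (metis span_neg)
    next
      case 3
      then show ?thesis
        using left_comm_sdiag_ndiag_distinct [of p q r l] span_zero that by blast
    qed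
  qed
  have nn: "\<exists>U\<in>span (diag_gens oct nest l). left_comm (ndiag l (nest p q)) (ndiag l (nest r s)) U"
    if "p \<in> imag_units" "q \<in> imag_units" "r \<in> imag_units" "s \<in> imag_units" "p \<noteq> q" "r \<noteq> s" for p q r s
  proof -
    have base: "\<exists>U\<in>span (diag_gens oct nest l). left_comm (ndiag l (nest p q)) (ndiag l (nest q s)) U"
      if "p \<in> imag_units" "q \<in> imag_units" "s \<in> imag_units" "p \<noteq> q" "q \<noteq> s" for p q s
    proof (cases "p = s")
      case True
      then show ?thesis
        using left_comm_minus [OF left_comm_self [of "ndiag l (nest q s)"]] span_zero
        unfolding nest_minus_eq [of l p q] by (auto intro!: bexI [of _ 0])
    next
      case False
      then show ?thesis
        using left_comm_ndiag_ndiag [of p q s l] scale_ndiag_span [of p s] that by blast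
    qed
    have left: "\<exists>U\<in>span (diag_gens oct nest l). left_comm (ndiag l (nest p q)) W U"
      if "\<exists>U\<in>span (diag_gens oct nest l). left_comm (ndiag l (nest q p)) W U" for p q W
      using that left_comm_minus span_neg unfolding nest_minus_eq [of l p q] by blast
    have swap: "\<exists>U\<in>span (diag_gens oct nest l). left_comm V W U"
      if "\<exists>U\<in>span (diag_gens oct nest l). left_comm W V U" for V W
      using that left_comm_swap span_neg by blast
    have right: "\<exists>U\<in>span (diag_gens oct nest l). left_comm V (ndiag l (nest p q)) U"
      if "\<exists>U\<in>span (diag_gens oct nest l). left_comm V (ndiag l (nest q p)) U" for p q V
      using swap [OF left [OF swap [OF that]]] .
    consider "q = r" | "q = s" | "p = r" | "p = s" | "p \<noteq> r" "p \<noteq> s" "q \<noteq> r" "q \<noteq> s" by blast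
    then show ?thesis
    proof cases
      case 1
      then show ?thesis using base that by blast
    next
      case 2
      then show ?thesis using right [OF base [of p q r]] that by blast
    next
      case 3
      then show ?thesis using left [OF base [of q p s]] that by blast
    next
      case 4
      then show ?thesis using left [OF right [OF base [of q p r]]] that by blast
    next
      case 5
      then show ?thesis
        using left_comm_ndiag_ndiag_distinct [of p q r s l] span_zero that by blast
    qed
  qed
  show ?thesis
    using assms(1)
  proof (cases rule: diag_gens_cases)
    case V: (1 p)
    show ?thesis
      using assms(2)
    proof (cases rule: diag_gens_cases)
      case W: (1 q)
      show ?thesis
      proof (cases "p = q")
        case True
        then show ?thesis
          using left_comm_self span_zero unfolding V W by blast
      next
        case False
        then show ?thesis
          using left_comm_sdiag_sdiag [of p q l] scale_ndiag_span [of p q] V(1) W(1)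
          unfolding V(2) W(2) by blast
      qed
    next
      case W: (2 q r)
      then show ?thesis
        using sn V(1) unfolding V(2) W(4) by blast
    qed
  next
    case V: (2 p q)
    show ?thesis
      using assms(2)
    proof (cases rule: diag_gens_cases)
      case W: (1 r)
      then show ?thesis
        using sn [of r p q] V(1-3) left_comm_swap span_neg unfolding V(4) W(2) by blast
    next
      case W: (2 r s)
      then show ?thesis
        using nn [of p q r s] V(1-3) unfolding V(4) W(4) by blast
    qed
  qed
qed

text \<open>The witness is 2 D_b, -2 D_a or 2 D_{a,b} in language l, according to which of a and b
  is the unit 1.\<close>

lemma off_same_exists:
  assumes "a \<noteq> b"
  shows "\<exists>U\<in>span (diag_gens oct nest l). diagonal U \<and>
    (\<forall>t. lact (U $ pos l $ pos l) t = tmul (u b) (tmul (tconj (u a)) t) - tmul (u a) (tmul (tconj (u b)) t) \<and>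
      lact (U $ pos2 l $ pos2 l) t = tmul (tconj (u b)) (tmul (u a) t) - tmul (tconj (u a)) (tmul (u b) t) \<and>
      lact (U $ pos3 l $ pos3 l) t = 0)"
proof -
  consider "a = uone" "b \<in> imag_units" | "b = uone" "a \<in> imag_units" | "a \<in> imag_units" "b \<in> imag_units"
    using assms by (auto simp: imag_units_def)
  then show ?thesis
  proof cases
    case 1
    show ?thesis
      by (rule bexI [OF _ scale_sdiag_span [OF 1(2), of 2]])
        (simp add: 1 diagonal_sdiag diagonal_scaleR sdiag_nth lact_scaleR lact_minus tconj_imag tmul_minus vec_two_mult)
  next
    case 2
    show ?thesis
      by (rule bexI [OF _ scale_sdiag_span [OF 2(2), of "- 2"]])
        (simp add: 2 diagonal_sdiag diagonal_scaleR sdiag_nth lact_scaleR lact_minus tconj_imag tmul_minus vec_two_mult)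
  next
    case 3
    show ?thesis
      by (rule bexI [OF _ scale_ndiag_span [OF 3 assms, of 2]])
        (simp add: 3 assms diagonal_ndiag diagonal_scaleR ndiag_nth lact_scaleR lact_nest_imag tconj_imag
          tmul_minus vec_two_mult tmul_clifford [OF 3(2,1) assms [symmetric]])
  qed
qed

end


text \<open>Left multiplications by the two tensor factors commute, so the products in a commutator
  within one type separate into a part for each algebra.\<close>

lemma tmul_tens_conj_split:
  "tmul (tens b B) (tmul (tconj (tens a A)) t)
    = tmul (tens b uone) (tmul (tconj (tens a uone)) (tmul (tens uone B) (tmul (tconj (tens uone A)) t)))"
  "tmul (tconj (tens b B)) (tmul (tens a A) t)
    = tmul (tconj (tens b uone)) (tmul (tens a uone) (tmul (tconj (tens uone B)) (tmul (tens uone A) t)))"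
proof -
  have [simp]: "uconj (uone :: 'z ounit) = 1"
    by (simp add: uconj_def)
  have *: "tmul (tens b B) (tmul (tens a A) t)
    = tmul (tens b uone) (tmul (tens a uone) (tmul (tens uone B) (tmul (tens uone A) t)))"
    by (induction t rule: tensor_induct) (simp_all add: tmul_add tmul_scaleR tmul_tens mult_ac)
  show "tmul (tens b B) (tmul (tconj (tens a A)) t)
    = tmul (tens b uone) (tmul (tconj (tens a uone)) (tmul (tens uone B) (tmul (tconj (tens uone A)) t)))"
    "tmul (tconj (tens b B)) (tmul (tens a A) t)
    = tmul (tconj (tens b uone)) (tmul (tens a uone) (tmul (tconj (tens uone B)) (tmul (tens uone A) t)))"
    by (simp_all add: tconj_tens tmul_scaleR *)
qed

lemma left_comm_off_offI:
  assumes "diagonal U"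
    and "\<And>t. lact (U $ pos l $ pos l) t = tmul s' (tmul (tconj s) t) - tmul s (tmul (tconj s') t)"
    and "\<And>t. lact (U $ pos2 l $ pos2 l) t = tmul (tconj s') (tmul s t) - tmul (tconj s) (tmul s' t)"
    and "\<And>t. lact (U $ pos3 l $ pos3 l) t = 0"
  shows "left_comm (off l s) (off l s') U"
proof -
  have "\<forall>r c. \<forall>t. lact (U $ r $ c) t =
     (\<Sum>k\<in>UNIV. lact (off l s $ r $ k) (lact (off l s' $ k $ c) t) - lact (off l s' $ r $ k) (lact (off l s $ k $ c) t))"
    unfolding forall_pos [of _ l] sum_pos [of _ l] off_nth
    using assms(1) by (simp add: diagonal_def assms(2-4) lact_minus)
  then show ?thesis
    unfolding left_comm_def by blast
qed

text \<open>A factor in which the two units agree contributes only its norm, and the other factor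
  then gives a diagonal matrix by \<open>off_same_exists\<close>.\<close>

lemma off_off_left_comm_exists:
  fixes a b :: "'k::oct_alg ounit" and A B :: "'l::oct_alg ounit"
  shows "\<exists>U\<in>span (diag_gens octK nestK l \<union> diag_gens octL nestL l). left_comm (off l (tens a A)) (off l (tens b B)) U"
proof -
  let ?S = "span (diag_gens octK nestK l \<union> diag_gens octL nestL l) :: ('k, 'l) mat set"
  consider "a = b" "A = B" | "a = b" "A \<noteq> B" | "a \<noteq> b" "A = B" | "a \<noteq> b" "A \<noteq> B" by blast
  then show ?thesis
  proof cases
    case 1
    have "0 \<in> ?S"
      by (rule span_zero)
    with 1 show ?thesis
      using left_comm_self by blast
  next
    case 2
    obtain U :: "('k, 'l) mat" where U: "U \<in> span (diag_gens octL nestL l)" "diagonal U"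
      "\<And>t. lact (U $ pos l $ pos l) t = tmul (tens uone B) (tmul (tconj (tens uone A)) t) - tmul (tens uone A) (tmul (tconj (tens uone B)) t)"
      "\<And>t. lact (U $ pos2 l $ pos2 l) t = tmul (tconj (tens uone B)) (tmul (tens uone A) t) - tmul (tconj (tens uone A)) (tmul (tens uone B) t)"
      "\<And>t. lact (U $ pos3 l $ pos3 l) t = 0"
      using octL.off_same_exists [OF 2(2), of l] by blast
    have "U \<in> ?S"
      using U(1) span_mono [of "diag_gens octL nestL l" "diag_gens octK nestK l \<union> diag_gens octL nestL l"] by blast
    then have "unorm a *\<^sub>R U \<in> ?S"
      by (rule span_scale)
    moreover have "left_comm (off l (tens a A)) (off l (tens b B)) (unorm a *\<^sub>R U)"
      by (rule left_comm_off_offI, unfold tmul_tens_conj_split [of a A b B] tmul_tens_conj_split [of b B a A])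
        (simp_all add: 2(1) [symmetric] octK.tmul_cancel U diagonal_scaleR lact_scaleR scaleR_diff_right)
    ultimately show ?thesis by blast
  next
    case 3
    obtain U :: "('k, 'l) mat" where U: "U \<in> span (diag_gens octK nestK l)" "diagonal U"
      "\<And>t. lact (U $ pos l $ pos l) t = tmul (tens b uone) (tmul (tconj (tens a uone)) t) - tmul (tens a uone) (tmul (tconj (tens b uone)) t)"
      "\<And>t. lact (U $ pos2 l $ pos2 l) t = tmul (tconj (tens b uone)) (tmul (tens a uone) t) - tmul (tconj (tens a uone)) (tmul (tens b uone) t)"
      "\<And>t. lact (U $ pos3 l $ pos3 l) t = 0"
      using octK.off_same_exists [OF 3(1), of l] by blast
    have "U \<in> ?S"
      using U(1) span_mono [of "diag_gens octK nestK l" "diag_gens octK nestK l \<union> diag_gens octL nestL l"] by blast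
    then have "unorm A *\<^sub>R U \<in> ?S"
      by (rule span_scale)
    moreover have "left_comm (off l (tens a A)) (off l (tens b B)) (unorm A *\<^sub>R U)"
      by (rule left_comm_off_offI, unfold tmul_tens_conj_split [of a A b B] tmul_tens_conj_split [of b B a A])
        (simp_all add: 3(2) [symmetric] octL.tmul_cancel U diagonal_scaleR lact_scaleR scaleR_diff_right tmul_scaleR)
    ultimately show ?thesis by blast
  next
    case 4
    have z: "0 \<in> ?S"
      by (rule span_zero)
    \<comment> \<open>The units anticommute in both factors; the two signs cancel, so the matrices
      commute.\<close>
    have "left_comm (off l (tens a A)) (off l (tens b B)) 0"
      by (rule left_comm_off_offI, unfold tmul_tens_conj_split [of a A b B] tmul_tens_conj_split [of b B a A])
        (simp_all add: octK.tmul_clifford_conj [OF 4(1)] octL.tmul_clifford_conj [OF 4(2)] tmul_minus)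
    with z show ?thesis
      by blast
  qed
qed

subsection \<open>Canonical representatives\<close>

context oct_side
begin

text \<open>Distinct imaginary units anticommute, so in one of the two orders their product carries
  the sign -1.\<close>

lemma tri_pairs_total:
  assumes "p \<in> imag_units" "q \<in> imag_units" "p \<noteq> q"
  shows "\<exists>r\<in>imag_units. (p, q) \<in> tri_pairs r \<or> (q, p) \<in> tri_pairs r"
proof -
  have r: "utimes p q \<in> imag_units"
    using assms by (simp add: imag_units_def utimes_eq_one_iff)
  have "usgn q p = - usgn p q"
    using uconj_umul [of p q] assms by (simp add: uconj_def imag_units_def utimes_eq_one_iff)
  moreover have "usgn p q = 1 \<or> usgn p q = - 1"
    using usgn_square(1) [of p q] square_eq_1_iff by blast
  ultimately have "usgn p q = - 1 \<or> usgn q p = - 1"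
    by auto
  then have "(p, q) \<in> tri_pairs (utimes p q) \<or> (q, p) \<in> tri_pairs (utimes p q)"
    using assms utimes_commute [of p q] by (simp add: tri_pairs_def prod_eq_iff)
  with r show ?thesis by blast
qed

lemma tri_pairs_neq:
  assumes "r \<in> imag_units" "(p, q) \<in> tri_pairs r"
  shows "p \<in> imag_units" "q \<in> imag_units" "p \<noteq> q"
  using tri_pairs_prod [OF assms(2)] assms(1) by (auto simp: imag_units_def)

lemma sum_ndiag_span:
  assumes "r \<in> imag_units" "T \<subseteq> tri_pairs r"
  shows "(\<Sum>(p, q)\<in>T. ndiag LD (nest p q)) \<in> span (diag_gens oct nest LD)"
proof (intro span_sum, clarify)
  fix p q assume "(p, q) \<in> T"
  then have "(p, q) \<in> tri_pairs r"
    using assms(2) by blast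
  note pq = tri_pairs_neq [OF assms(1) this]
  show "ndiag LD (nest p q) \<in> span (diag_gens oct nest LD)"
    by (rule span_base, rule ndiag_in_diag_gens [OF pq])
qed

lemma sdiag_LD_span: "r \<in> imag_units \<Longrightarrow> sdiag LD (oct r) \<in> span (diag_gens oct nest LD)"
  by (rule span_base, rule sdiag_in_diag_gens)

lemma ndiag_tri_reduce:
  assumes "r \<in> imag_units" "(p, q) \<in> tri_pairs r"
  shows "\<exists>W\<in>span (diag_gens oct nest LD). ndiag l (nest p q) - W \<in> span (tri_rels oct nest)"
proof -
  note pq = tri_pairs_neq [OF assms]
  have n: "ndiag LD (nest p q) \<in> span (diag_gens oct nest LD)"
    by (rule span_base, rule ndiag_in_diag_gens [OF pq])
  have s: "(\<Sum>(p', q')\<in>tri_pairs r - {(p, q)}. ndiag LD (nest p' q')) \<in> span (diag_gens oct nest LD)"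
    by (rule sum_ndiag_span [OF assms(1)]) blast
  note d = sdiag_LD_span [OF assms(1)]
  show ?thesis
  proof (cases l)
    case LD
    with n show ?thesis
      by (intro bexI [OF _ n]) (simp add: span_zero)
  next
    case LE
    have "(1/2) *\<^sub>R (sdiag LD (oct r) + ndiag LD (nest p q)
        - (\<Sum>(p', q')\<in>tri_pairs r - {(p, q)}. ndiag LD (nest p' q'))) \<in> span (diag_gens oct nest LD)"
      by (intro span_scale span_diff span_add n s d)
    moreover have "ndiag LE (nest p q) - (1/2) *\<^sub>R (sdiag LD (oct r) + ndiag LD (nest p q)
        - (\<Sum>(p', q')\<in>tri_pairs r - {(p, q)}. ndiag LD (nest p' q'))) \<in> span (tri_rels oct nest)"
      by (rule span_base) (unfold tri_rels_def, use assms in blast)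
    ultimately show ?thesis
      unfolding LE by blast
  next
    case LF
    have "(1/2) *\<^sub>R (- sdiag LD (oct r) + ndiag LD (nest p q)
        - (\<Sum>(p', q')\<in>tri_pairs r - {(p, q)}. ndiag LD (nest p' q'))) \<in> span (diag_gens oct nest LD)"
      by (intro span_scale span_diff span_add span_neg n s d)
    moreover have "ndiag LF (nest p q) - (1/2) *\<^sub>R (- sdiag LD (oct r) + ndiag LD (nest p q)
        - (\<Sum>(p', q')\<in>tri_pairs r - {(p, q)}. ndiag LD (nest p' q'))) \<in> span (tri_rels oct nest)"
      by (rule span_base) (unfold tri_rels_def, use assms in blast)
    ultimately show ?thesis
      unfolding LF by blast
  qed
qed

lemma diag_gens_reduce:
  assumes "V \<in> diag_gens oct nest l"
  shows "\<exists>W\<in>span (diag_gens oct nest LD). V - W \<in> span (tri_rels oct nest)"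
  using assms
proof (cases rule: diag_gens_cases)
  case (1 r)
  note d = sdiag_LD_span [OF 1(1)]
  have s: "(\<Sum>(p, q)\<in>tri_pairs r. ndiag LD (nest p q)) \<in> span (diag_gens oct nest LD)"
    by (rule sum_ndiag_span [OF 1(1)]) blast
  show ?thesis
  proof (cases l)
    case LD
    then show ?thesis
      unfolding 1(2) by (intro bexI [OF _ d]) (simp add: span_zero)
  next
    case LE
    have "(1/2) *\<^sub>R (- sdiag LD (oct r) - (\<Sum>(p, q)\<in>tri_pairs r. ndiag LD (nest p q))) \<in> span (diag_gens oct nest LD)"
      by (intro span_scale span_diff span_neg s d)
    moreover have "sdiag LE (oct r) - (1/2) *\<^sub>R (- sdiag LD (oct r) - (\<Sum>(p, q)\<in>tri_pairs r. ndiag LD (nest p q)))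
        \<in> span (tri_rels oct nest)"
      by (rule span_base) (unfold tri_rels_def, use 1(1) in blast)
    ultimately show ?thesis
      unfolding LE 1(2) by blast
  next
    case LF
    have "(1/2) *\<^sub>R (- sdiag LD (oct r) + (\<Sum>(p, q)\<in>tri_pairs r. ndiag LD (nest p q))) \<in> span (diag_gens oct nest LD)"
      by (intro span_scale span_add span_neg s d)
    moreover have "sdiag LF (oct r) - (1/2) *\<^sub>R (- sdiag LD (oct r) + (\<Sum>(p, q)\<in>tri_pairs r. ndiag LD (nest p q)))
        \<in> span (tri_rels oct nest)"
      by (rule span_base) (unfold tri_rels_def, use 1(1) in blast)
    ultimately show ?thesis
      unfolding LF 1(2) by blast
  qed
next
  case (2 p q)
  obtain r where r: "r \<in> imag_units" "(p, q) \<in> tri_pairs r \<or> (q, p) \<in> tri_pairs r"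
    using tri_pairs_total [OF 2(1-3)] by blast
  show ?thesis
  proof (cases "(p, q) \<in> tri_pairs r")
    case True
    then show ?thesis
      using ndiag_tri_reduce [OF r(1)] unfolding 2(4) by blast
  next
    case False
    then have "(q, p) \<in> tri_pairs r"
      using r(2) by blast
    from ndiag_tri_reduce [OF r(1) this, of l] obtain W
      where W: "W \<in> span (diag_gens oct nest LD)" "ndiag l (nest q p) - W \<in> span (tri_rels oct nest)" by blast
    have "V - - W = - (ndiag l (nest q p) - W)"
      unfolding 2(4) nest_minus_eq [of l p q] by simp
    then have "V - - W \<in> span (tri_rels oct nest)"
      using span_neg [OF W(2)] by simp
    with span_neg [OF W(1)] show ?thesis by blast
  qed
qed

end

context e8_side
begin

text \<open>By \<open>dd_triality\<close> the sum over all pairs equals -D_r - 2 E_r. Eliminating it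
  turns the remaining relations into \<open>dd_sum_lang\<close> and \<open>dd_triality_nest\<close>.
  The function f is arbitrary because the lemma is applied on both sides to \<open>Phi\<close>,
  which combines the two.\<close>

lemma linear_tri_rels_zero:
  fixes f :: "('k, 'l) mat \<Rightarrow> 'f e8_alg"
  assumes "linear f"
    and s: "\<And>l p. p \<in> imag_units \<Longrightarrow> f (sdiag l (oct p)) = dd l uone p"
    and n: "\<And>l p q. p \<in> imag_units \<Longrightarrow> q \<in> imag_units \<Longrightarrow> p \<noteq> q \<Longrightarrow> f (ndiag l (nest p q)) = dd l p q"
    and V: "V \<in> tri_rels oct nest"
  shows "f V = 0"
proof -
  interpret f: linear f by fact
  have sum: "f (\<Sum>(p, q)\<in>T. ndiag LD (nest p q)) = (\<Sum>(p, q)\<in>T. dd LD p q)"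
    if "r \<in> imag_units" "T \<subseteq> tri_pairs r" for r T
    unfolding f.sum
  proof (intro sum.cong refl, clarify)
    fix p q assume "(p, q) \<in> T"
    then have "(p, q) \<in> tri_pairs r"
      using that by blast
    from n [OF tri_pairs_neq [OF that(1) this]] show "f (ndiag LD (nest p q)) = dd LD p q" .
  qed
  note lin = f.diff f.add f.scale f.neg
  have F: "dd LF uone r = - dd LD uone r - dd LE uone r" if "r \<in> imag_units" for r
  proof -
    have z: "dd LD uone r + dd LE uone r + dd LF uone r = 0"
      using dd_sum_lang [OF that, of LD] by simp
    have "dd LF uone r = (dd LD uone r + dd LE uone r + dd LF uone r) - dd LD uone r - dd LE uone r"
      by simp
    then show ?thesis
      unfolding z by simp
  qed
  consider r where "r \<in> imag_units" "V = sdiag LE (oct r)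
        - (1/2) *\<^sub>R (- sdiag LD (oct r) - (\<Sum>(p, q)\<in>tri_pairs r. ndiag LD (nest p q)))"
    | r where "r \<in> imag_units" "V = sdiag LF (oct r)
        - (1/2) *\<^sub>R (- sdiag LD (oct r) + (\<Sum>(p, q)\<in>tri_pairs r. ndiag LD (nest p q)))"
    | r p q where "r \<in> imag_units" "(p, q) \<in> tri_pairs r" "V = ndiag LE (nest p q)
        - (1/2) *\<^sub>R (sdiag LD (oct r) + ndiag LD (nest p q)
            - (\<Sum>(p', q')\<in>tri_pairs r - {(p, q)}. ndiag LD (nest p' q')))"
    | r p q where "r \<in> imag_units" "(p, q) \<in> tri_pairs r" "V = ndiag LF (nest p q)
        - (1/2) *\<^sub>R (- sdiag LD (oct r) + ndiag LD (nest p q)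
            - (\<Sum>(p', q')\<in>tri_pairs r - {(p, q)}. ndiag LD (nest p' q')))"
    using V unfolding tri_rels_def by blast
  then show ?thesis
  proof cases
    case (1 r)
    show ?thesis
      unfolding 1(2) lin sum [OF 1(1) subset_refl] s [OF 1(1)] using dd_triality [OF 1(1)] by simp
  next
    case (2 r)
    have S: "(\<Sum>(p, q)\<in>tri_pairs r. dd LD p q) = - dd LD uone r - 2 *\<^sub>R dd LE uone r"
      unfolding dd_triality [OF 2(1)] by simp
    have "(- dd LD uone r - dd LE uone r)
        - (1/2) *\<^sub>R (- dd LD uone r + (- dd LD uone r - 2 *\<^sub>R dd LE uone r)) = (0 :: 'f e8_alg)"
    proof -
      have "- dd LD uone r + (- dd LD uone r - 2 *\<^sub>R dd LE uone r) = 2 *\<^sub>R (- dd LD uone r - dd LE uone r)"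
        by (simp add: scaleR_diff_right scaleR_2)
      then show ?thesis by simp
    qed
    then show ?thesis
      unfolding 2(2) lin sum [OF 2(1) subset_refl] s [OF 2(1)] F [OF 2(1)] S .
  next
    case (3 r p q)
    note pq = tri_pairs_neq [OF 3(1,2)]
    have S: "(\<Sum>(p, q)\<in>tri_pairs r - {(p, q)}. dd LD p q) = - dd LD uone r - 2 *\<^sub>R dd LE uone r - dd LD p q"
      unfolding dd_triality [OF 3(1)] using 3(2) by (simp add: sum_diff1)
    have "dd LD uone r + dd LD p q - (- dd LD uone r - 2 *\<^sub>R dd LE uone r - dd LD p q)
        = 2 *\<^sub>R (dd LD uone r + dd LD p q + dd LE uone r)"
      by (simp add: scaleR_add_right scaleR_2)
    then show ?thesis
      unfolding 3(3) lin sum [OF 3(1) Diff_subset] s [OF 3(1)] n [OF pq] S dd_triality_nest(1) [OF 3(1,2)]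
      by simp
  next
    case (4 r p q)
    note pq = tri_pairs_neq [OF 4(1,2)]
    have S: "(\<Sum>(p, q)\<in>tri_pairs r - {(p, q)}. dd LD p q) = - dd LD uone r - 2 *\<^sub>R dd LE uone r - dd LD p q"
      unfolding dd_triality [OF 4(1)] using 4(2) by (simp add: sum_diff1)
    have "- dd LD uone r + dd LD p q - (- dd LD uone r - 2 *\<^sub>R dd LE uone r - dd LD p q)
        = 2 *\<^sub>R (dd LD p q + dd LE uone r)"
      by (simp add: scaleR_add_right scaleR_2)
    then show ?thesis
      unfolding 4(3) lin sum [OF 4(1) Diff_subset] s [OF 4(1)] n [OF pq] S dd_triality_nest(2) [OF 4(1,2)]
      by simp
  qed
qed

end


section \<open>Evaluated commutators of generators\<close>

context oct_side
begin

lemma oct_comm_sdiag_off: "p \<in> imag_units \<Longrightarrow> oct_comm (sdiag l (oct p)) (off m t) \<in> range (off m)"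
  using oct_comm_sdiag [of p l t] lang_exhaust_next [of l m] by (cases "m = l") auto

lemma oct_comm_ndiag_off:
  "p \<in> imag_units \<Longrightarrow> q \<in> imag_units \<Longrightarrow> p \<noteq> q \<Longrightarrow> l \<noteq> m \<Longrightarrow>
    oct_comm (ndiag l (nest p q)) (off m t) \<in> range (off m)"
  using oct_comm_ndiag [of p q l t] lang_exhaust_next [of l m] by auto

lemma left_comm_ndiag_offI:
  assumes "p \<in> imag_units" "q \<in> imag_units" "p \<noteq> q"
    and "\<And>t. tmul s' t = tmul (u p) (tmul (u q) (tmul s t)) - tmul s (tmul (u p) (tmul (u q) t))"
    and "\<And>t. tmul (tconj s') t = tmul (u p) (tmul (u q) (tmul (tconj s) t)) - tmul (tconj s) (tmul (u p) (tmul (u q) t))"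
  shows "left_comm (ndiag l (nest p q)) (off l s) (off l s')"
proof -
  have "\<forall>r c. \<forall>t. lact (off l s' $ r $ c) t = (\<Sum>k\<in>UNIV.
      lact (ndiag l (nest p q) $ r $ k) (lact (off l s $ k $ c) t) - lact (off l s $ r $ k) (lact (ndiag l (nest p q) $ k $ c) t))"
    unfolding forall_pos [of _ l] sum_pos [of _ l] off_nth ndiag_nth
    by (simp add: lact_nest_imag assms lact_minus tmul_minus)
  then show ?thesis
    unfolding left_comm_def by blast
qed

text \<open>\<open>R\<close> and \<open>R'\<close> are the multiplications by the other tensor factor and by its conjugate.\<close>

lemma left_comm_ndiag_off_exists:
  assumes pq: "p \<in> imag_units" "q \<in> imag_units" "p \<noteq> q"
    and S: "\<And>b t. tmul (S b) t = tmul (u b) (R t)" "\<And>b t. tmul (tconj (S b)) t = tmul (tconj (u b)) (R' t)"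
    and R: "\<And>b t. R (tmul (u b) t) = tmul (u b) (R t)" "\<And>b t. R' (tmul (u b) t) = tmul (u b) (R' t)"
  shows "\<exists>s'. left_comm (ndiag l (nest p q)) (off l (S a)) (off l s')"
proof -
  note cl = tmul_clifford [OF pq(2,1) pq(3) [symmetric]]
  consider "a = p" | "a = q" | "a \<noteq> p" "a \<noteq> q" by blast
  then show ?thesis
  proof cases
    case 1
    have "left_comm (ndiag l (nest p q)) (off l (S a)) (off l ((2 * unorm p) *\<^sub>R S q))"
      by (rule left_comm_ndiag_offI [OF pq])
        (simp_all add: 1 S R tconj_scaleR tmul_scaleR cl tmul_minus tmul_square pq tconj_imag vec_eq_iff)
    then show ?thesis by blast
  next
    case 2
    have "left_comm (ndiag l (nest p q)) (off l (S a)) (off l ((- 2 * unorm q) *\<^sub>R S p))"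
      by (rule left_comm_ndiag_offI [OF pq])
        (simp_all add: 2 S R tconj_scaleR tconj_minus tmul_scaleR tmul_clifford [OF pq] tmul_minus tmul_square pq tconj_imag vec_eq_iff)
    then show ?thesis by blast
  next
    case 3
    have pass: "tmul (u p) (tmul (u q) (tmul (u a) t)) = tmul (u a) (tmul (u p) (tmul (u q) t))" for t
      using tmul_pass [of a p q t] 3 pq by (cases "a = uone") (simp_all add: imag_units_def)
    have "left_comm (ndiag l (nest p q)) (off l (S a)) (off l 0)"
      by (rule left_comm_ndiag_offI [OF pq])
        (simp_all add: S R pass tconj_u tmul_scaleR)
    then show ?thesis by blast
  qed
qed

end

text \<open>With all diagonal matrices in language D, any two generators fall under one of the rules
  for evaluating commutators; two diagonal matrices over one algebra in different languages need
  not.\<close>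

definition canonical_gens :: "('k::oct_alg, 'l::oct_alg) mat set" where
  "canonical_gens = off_gens \<union> diag_gens octK nestK LD \<union> diag_gens octL nestL LD"

lemma canonical_gens_mats: "span canonical_gens \<subseteq> mats"
  unfolding mats_def canonical_gens_def by (rule span_mono) blast

lemma diag_gens_mats:
  "span (diag_gens octK nestK l \<union> diag_gens octL nestL l) \<subseteq> mats"
  unfolding mats_def by (rule span_mono) blast

lemma off_span: "off l t \<in> span off_gens"
proof (induction t rule: tensor_induct)
  case (tens a A)
  show ?case
    by (rule span_base) (auto simp: off_gens_def)
qed (simp_all add: off_add off_scaleR span_add span_scale)

lemma off_mats: "off l t \<in> mats"
  using off_span span_mono [of off_gens "off_gens \<union> (\<Union>l. diag_gens octK nestK l) \<union> (\<Union>l. diag_gens octL nestL l)"]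
  unfolding mats_def by blast

lemma off_range_mats: "V \<in> range (off l) \<Longrightarrow> V \<in> mats"
  by (erule rangeE) (simp only: off_mats)

lemma mats_reduce:
  assumes "V \<in> mats"
  shows "\<exists>W\<in>span canonical_gens. V - W \<in> triality"
  using assms unfolding mats_def
proof (induction V rule: span_induct_alt)
  case base
  show ?case
    by (intro bexI [of _ 0]) (simp_all add: span_zero triality_def)
next
  case (step c V V')
  have "\<exists>W\<in>span canonical_gens. V - W \<in> triality"
  proof -
    consider "V \<in> off_gens" | l where "V \<in> diag_gens octK nestK l" | l where "V \<in> diag_gens octL nestL l"
      using step(1) by blast
    then show ?thesis
    proof cases
      case 1
      then have "V \<in> span canonical_gens"
        by (intro span_base) (simp add: canonical_gens_def)
      then show ?thesis
        by (intro bexI [of _ V]) (simp_all add: span_zero triality_def)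
    next
      case 2
      obtain W where "W \<in> span (diag_gens octK nestK LD)" "V - W \<in> span (tri_rels octK nestK)"
        using octK.diag_gens_reduce [OF 2] by blast
      then show ?thesis
        using span_mono [of "diag_gens octK nestK LD" canonical_gens]
          span_mono [of "tri_rels octK nestK" "tri_rels octK nestK \<union> tri_rels octL nestL"]
        unfolding triality_def canonical_gens_def by blast
    next
      case 3
      obtain W where "W \<in> span (diag_gens octL nestL LD)" "V - W \<in> span (tri_rels octL nestL)"
        using octL.diag_gens_reduce [OF 3] by blast
      then show ?thesis
        using span_mono [of "diag_gens octL nestL LD" canonical_gens]
          span_mono [of "tri_rels octL nestL" "tri_rels octK nestK \<union> tri_rels octL nestL"]
        unfolding triality_def canonical_gens_def by blast
    qed
  qed
  then obtain W where W: "W \<in> span canonical_gens" "V - W \<in> triality" by blast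
  obtain W' where W': "W' \<in> span canonical_gens" "V' - W' \<in> triality"
    using step(2) by blast
  have "c *\<^sub>R (V - W) + (V' - W') \<in> triality"
    using W(2) W'(2) unfolding triality_def by (intro span_add span_scale)
  moreover have "c *\<^sub>R V + V' - (c *\<^sub>R W + W') = c *\<^sub>R (V - W) + (V' - W')"
    by (simp add: scaleR_diff_right)
  ultimately have "c *\<^sub>R V + V' - (c *\<^sub>R W + W') \<in> triality"
    by (simp only:)
  moreover have "c *\<^sub>R W + W' \<in> span canonical_gens"
    using W(1) W'(1) by (intro span_add span_scale)
  ultimately show ?case by blast
qed

lemma commutator_sdiag_off:
  assumes "V \<in> {sdiag l (octK p) |p. p \<in> imag_units} \<union> {sdiag l (octL P) |P. P \<in> imag_units}"
  shows "\<exists>U\<in>mats. commutator V (off m (tens a A)) U"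
proof -
  have "oct_comm V (off m (tens a A)) \<in> range (off m)"
    using assms octK.oct_comm_sdiag_off [of _ l m "tens a A"] octL.oct_comm_sdiag_off [of _ l m "tens a A"] by blast
  then have "oct_comm V (off m (tens a A)) \<in> mats"
    by (rule off_range_mats)
  then show ?thesis
    using commutator.oct_off [OF assms] by blast
qed

lemma commutator_ndiag_off:
  assumes "V \<in> {ndiag l (nestK p q) |p q. p \<in> imag_units \<and> q \<in> imag_units \<and> p \<noteq> q}
      \<union> {ndiag l (nestL P Q) |P Q. P \<in> imag_units \<and> Q \<in> imag_units \<and> P \<noteq> Q}"
  shows "\<exists>U\<in>mats. commutator V (off m (tens a A)) U"
proof (cases "l = m")
  case False
  then have "oct_comm V (off m (tens a A)) \<in> range (off m)"
    using assms octK.oct_comm_ndiag_off [of _ _ l m "tens a A"] octL.oct_comm_ndiag_off [of _ _ l m "tens a A"]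
    by blast
  then have "oct_comm V (off m (tens a A)) \<in> mats"
    by (rule off_range_mats)
  then show ?thesis
    using commutator.nest_off_other [OF assms False] by blast
next
  case True
  have one: "uconj (uone :: 'z ounit) = 1"
    by (simp add: uconj_def)
  \<comment> \<open>The tensor factor that is carried along acts by a left multiplication commuting
    with those of the nested octonion.\<close>
  have s1: "tmul (tens b B) t = tmul (tens b uone) (tmul (tens uone B) t)" for b B and t :: "('a, 'b) tensor"
    by (induction t rule: tensor_induct) (simp_all add: tmul_add tmul_scaleR tmul_tens mult_ac)
  have s2: "tmul (tens b B) t = tmul (tens uone B) (tmul (tens b uone) t)" for b B and t :: "('a, 'b) tensor"
    by (induction t rule: tensor_induct) (simp_all add: tmul_add tmul_scaleR tmul_tens mult_ac)
  have comm: "tmul (tens uone B) (tmul (tens b uone) t) = tmul (tens b uone) (tmul (tens uone B) t)"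
    for b B and t :: "('a, 'b) tensor"
    unfolding s1 [symmetric] s2 [symmetric] ..
  consider p q where "V = ndiag l (nestK p q)" "p \<in> imag_units" "q \<in> imag_units" "p \<noteq> q"
    | P Q where "V = ndiag l (nestL P Q)" "P \<in> imag_units" "Q \<in> imag_units" "P \<noteq> Q"
    using assms by blast
  then obtain s' where "left_comm V (off l (tens a A)) (off l s')"
  proof cases
    case (1 p q)
    have "\<exists>s'. left_comm (ndiag l (nestK p q)) (off l (tens a A)) (off l s')"
      by (rule octK.left_comm_ndiag_off_exists [OF 1(2-4), where S = "\<lambda>b. tens b A" and R = "tmul (tens uone A)"
            and R' = "tmul (tconj (tens uone A))"])
        (simp_all add: s1 [symmetric] tconj_tens tmul_scaleR comm one)
    with that show ?thesis unfolding 1(1) by blast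
  next
    case (2 P Q)
    have "\<exists>s'. left_comm (ndiag l (nestL P Q)) (off l (tens a A)) (off l s')"
      by (rule octL.left_comm_ndiag_off_exists [OF 2(2-4), where S = "\<lambda>B. tens a B" and R = "tmul (tens a uone)"
            and R' = "tmul (tconj (tens a uone))"])
        (simp_all add: s2 [symmetric] tconj_tens tmul_scaleR comm [symmetric] one)
    with that show ?thesis unfolding 2(1) by blast
  qed
  then show ?thesis
    using commutator.nest_off_same [OF assms] off_mats unfolding True by blast
qed

lemma diag_gens_split:
  "V \<in> diag_gens octK nestK l \<union> diag_gens octL nestL l \<Longrightarrow>
    V \<in> {sdiag l (octK p) |p. p \<in> imag_units} \<union> {sdiag l (octL P) |P. P \<in> imag_units} \<or>
    V \<in> {ndiag l (nestK p q) |p q. p \<in> imag_units \<and> q \<in> imag_units \<and> p \<noteq> q}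
      \<union> {ndiag l (nestL P Q) |P Q. P \<in> imag_units \<and> Q \<in> imag_units \<and> P \<noteq> Q}"
  unfolding diag_gens_def by blast

lemma mats_minus: "V \<in> mats \<Longrightarrow> - V \<in> mats"
  unfolding mats_def by (rule span_neg)

lemma commutator_exists_gens:
  fixes V W :: "('k::oct_alg, 'l::oct_alg) mat"
  assumes "V \<in> canonical_gens" "W \<in> canonical_gens"
  shows "\<exists>U\<in>mats. commutator V W U"
proof -
  have swap: "\<exists>U\<in>mats. commutator V W U" if "\<exists>U\<in>mats. commutator W V U" for V W :: "('k, 'l) mat"
    using that commutator.antisym mats_minus by blast
  have diag_off: "\<exists>U\<in>mats. commutator V W U"
    if V: "V \<in> diag_gens octK nestK LD \<union> diag_gens octL nestL LD" and W: "W \<in> off_gens" for V W :: "('k, 'l) mat"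
  proof -
    obtain m a A where "W = off m (tens a A)"
      using W by (auto simp: off_gens_def)
    with diag_gens_split [OF V] show ?thesis
      using commutator_sdiag_off [of V LD m a A] commutator_ndiag_off [of V LD m a A] by blast
  qed
  have K_mats: "U \<in> mats" if "U \<in> span (diag_gens octK nestK LD)" for U :: "('k, 'l) mat"
    using that diag_gens_mats [of LD] span_mono [of "diag_gens octK nestK LD" "diag_gens octK nestK LD \<union> diag_gens octL nestL LD"]
    by blast
  have L_mats: "U \<in> mats" if "U \<in> span (diag_gens octL nestL LD)" for U :: "('k, 'l) mat"
    using that diag_gens_mats [of LD] span_mono [of "diag_gens octL nestL LD" "diag_gens octK nestK LD \<union> diag_gens octL nestL LD"]
    by blast
  have zero: "(0 :: ('k, 'l) mat) \<in> mats"
    unfolding mats_def by (rule span_zero)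
  consider "V \<in> off_gens" "W \<in> off_gens"
    | "V \<in> off_gens" "W \<in> diag_gens octK nestK LD \<union> diag_gens octL nestL LD"
    | "V \<in> diag_gens octK nestK LD \<union> diag_gens octL nestL LD" "W \<in> off_gens"
    | "V \<in> diag_gens octK nestK LD" "W \<in> diag_gens octK nestK LD"
    | "V \<in> diag_gens octL nestL LD" "W \<in> diag_gens octL nestL LD"
    | "V \<in> diag_gens octK nestK LD" "W \<in> diag_gens octL nestL LD"
    | "V \<in> diag_gens octL nestL LD" "W \<in> diag_gens octK nestK LD"
    using assms unfolding canonical_gens_def by blast
  then show ?thesis
  proof cases
    case 1
    obtain l a A m b B where V: "V = off l (tens a A)" and W: "W = off m (tens b B)"
      using 1 by (auto simp: off_gens_def)
    show ?thesis
    proof (cases "l = m")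
      case True
      obtain U where "U \<in> span (diag_gens octK nestK l \<union> diag_gens octL nestL l)"
        "left_comm (off l (tens a A)) (off l (tens b B)) U"
        using off_off_left_comm_exists [of l a A b B] by blast
      then show ?thesis
        using commutator.off_same diag_gens_mats [of l] unfolding V W True by blast
    next
      case False
      then have "oct_comm (off l (tens a A)) (off m (tens b B)) \<in> range (off (next_lang l)) \<union> range (off (next_lang (next_lang l)))"
        using lang_exhaust_next [OF False] oct_comm_off_next [of l "tens a A" "tens b B"]
          oct_comm_off_prev [of l "tens a A" "tens b B"] by auto
      then show ?thesis
        using commutator.off_other [OF False] off_range_mats unfolding V W by blast
    qed
  next
    case 2
    then show ?thesis using swap [OF diag_off] by blast
  next
    case 3
    then show ?thesis using diag_off by blast
  next
    case 4
    then show ?thesis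
      using octK.diag_left_comm_exists [OF 4] K_mats commutator.diag_K by blast
  next
    case 5
    then show ?thesis
      using octL.diag_left_comm_exists [OF 5] L_mats commutator.diag_L by blast
  next
    case 6
    then show ?thesis using zero commutator.diag_K_L by blast
  next
    case 7
    then show ?thesis using swap zero commutator.diag_K_L by blast
  qed
qed

lemma commutator_exists:
  fixes V W :: "('k::oct_alg, 'l::oct_alg) mat"
  assumes "V \<in> span canonical_gens" "W \<in> span canonical_gens"
  shows "\<exists>U\<in>mats. commutator V W U"
proof -
  have mats: "a \<in> mats \<Longrightarrow> b \<in> mats \<Longrightarrow> c *\<^sub>R a + b \<in> mats" for a b :: "('k, 'l) mat" and c
    unfolding mats_def by (intro span_add span_scale)
  have ext: "\<exists>U\<in>mats. commutator V W U"
    if V: "V \<in> span canonical_gens" and W: "\<And>V. V \<in> canonical_gens \<Longrightarrow> \<exists>U\<in>mats. commutator V W U"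
    for V W :: "('k, 'l) mat"
    using V
  proof (induction V rule: span_induct_alt)
    case base
    \<comment> \<open>No rule of \<open>commutator\<close> starts from the matrix 0; it arises by
      scaling the commutator of some generator by 0.\<close>
    have "off LD (tens uone uone) \<in> (canonical_gens :: ('k, 'l) mat set)"
      unfolding canonical_gens_def off_gens_def by blast
    then obtain U where "commutator (off LD (tens uone uone)) W U"
      using W by blast
    from commutator.scale [OF this, of 0] have "commutator 0 W 0"
      by simp
    moreover have "(0 :: ('k, 'l) mat) \<in> mats"
      unfolding mats_def by (rule span_zero)
    ultimately show ?case by blast
  next
    case (step c X Y)
    obtain U where U: "U \<in> mats" "commutator X W U"
      using W [OF step(1)] by blast
    obtain U' where U': "U' \<in> mats" "commutator Y W U'"
      using step(2) by blast
    show ?case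
      using mats [OF U(1) U'(1), of c] commutator.add [OF commutator.scale [OF U(2), of c] U'(2)] by blast
  qed
  show ?thesis
  proof (rule ext [OF assms(1)])
    fix V :: "('k, 'l) mat"
    assume V: "V \<in> canonical_gens"
    have "\<exists>U\<in>mats. commutator W V U"
      by (rule ext [OF assms(2)]) (rule commutator_exists_gens [OF _ V])
    then show "\<exists>U\<in>mats. commutator V W U"
      using commutator.antisym mats_minus by blast
  qed
qed

lemma product_value_exists:
  fixes v w :: "('k::oct_alg, 'l::oct_alg) tri_mat"
  shows "\<exists>u. product_value v w u"
proof -
  have rep: "\<exists>V\<in>span canonical_gens. v = abs_tri_mat V" for v :: "('k, 'l) tri_mat"
  proof -
    obtain V where V: "V \<in> mats" "v = abs_tri_mat V"
      by (rule tri_mat_obtain)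
    obtain W where W: "W \<in> span canonical_gens" "V - W \<in> triality"
      using mats_reduce [OF V(1)] by blast
    then have "abs_tri_mat V = abs_tri_mat W"
      using V(1) canonical_gens_mats by (intro abs_tri_mat_eqI) (auto simp: mat_eq_def)
    with V(2) W(1) show ?thesis by auto
  qed
  obtain V W where "V \<in> span canonical_gens" "v = abs_tri_mat V" "W \<in> span canonical_gens" "w = abs_tri_mat W"
    using rep by meson
  then show ?thesis
    using commutator_exists [of V W] canonical_gens_mats unfolding product_value_def by blast
qed


subsection \<open>An orthogonal basis\<close>

lemma e8_inv_form_sum: "e8_inv_form (sum f S) y = (\<Sum>i\<in>S. e8_inv_form (f i) y)"
  "e8_inv_form y (sum f S) = (\<Sum>i\<in>S. e8_inv_form y (f i))"
  by (induction S rule: infinite_finite_induct) (simp_all add: e8_inv_form_add)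

lemma e8_inv_form_scaleR:
  fixes x y :: "'f::real_field e8_alg"
  shows "e8_inv_form (c *\<^sub>R x) y = c *\<^sub>R e8_inv_form x y" "e8_inv_form y (c *\<^sub>R x) = c *\<^sub>R e8_inv_form y x"
  by (simp_all add: scaleR_eq_e8_scale e8_inv_form_scale scaleR_conv_of_real)

text \<open>In the null basis the polarized norm pairs (x, +) with (x, -) only, and it takes twice
  the norm on the diagonal.\<close>

lemma emb_form:
  fixes w :: "'f::real_field" and a b :: "'k::oct_alg ounit"
  assumes w: "w * w = of_real (ell_sq TYPE('k))"
  shows "(\<Sum>m\<in>UNIV. emb w a m * emb w b (wt_neg m)) = (if a = b then of_real (2 * unorm a) else 0)"
  by (cases a; cases b; rename_tac x y; case_tac x; case_tac y)
    (simp_all add: sum_wt unorm_def uconj_def qconj_def w)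

text \<open>One order for each of the 28 two-element sets of units: 1 comes first, and for imaginary
  units the sign of the product decides. They index a basis of the diagonal algebra of one
  side.\<close>

definition unit_pairs :: "('u::oct_alg ounit \<times> 'u ounit) set" where
  "unit_pairs = {uone} \<times> imag_units \<union>
     {(p, q). p \<in> imag_units \<and> q \<in> imag_units \<and> p \<noteq> q \<and> usgn p q = - 1}"

lemma usgn_swap:
  assumes "p \<in> imag_units" "q \<in> imag_units" "p \<noteq> q"
  shows "usgn q p = - usgn p q"
  using uconj_umul [of p q] assms by (simp add: uconj_def imag_units_def utimes_eq_one_iff)

lemma unit_pairs_neq: "(a, b) \<in> unit_pairs \<Longrightarrow> a \<noteq> b \<and> b \<in> imag_units"
  by (auto simp: unit_pairs_def imag_units_def)

lemma unit_pairs_swap: "(a, b) \<in> unit_pairs \<Longrightarrow> (b, a) \<notin> unit_pairs"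
  using usgn_swap [of a b] by (auto simp: unit_pairs_def imag_units_def)

context e8_model
begin

text \<open>Opposite weights pair to -1, so the form is minus a product of two sums as in
  \<open>emb_form\<close>, each of which contributes a factor 2.\<close>

lemma inv_form_off_elt:
  "e8_inv_form (off_elt l a A) (off_elt l b B)
    = (if a = b \<and> A = B then of_real (- 4 * (unorm a * unorm A)) else 0)"
proof -
  define \<delta> :: "wt \<Rightarrow> wt \<Rightarrow> 'f" where "\<delta> m m' = (if m' = wt_neg m then 1 else 0)" for m m'
  have vec: "e8_inv_form (off_vec l m n) (off_vec l m' n') = - (\<delta> m m' * \<delta> n n')" for m n m' n'
    unfolding e8_inv_form_off_vec \<delta>_def by (cases "m' = wt_neg m"; cases "n' = wt_neg n") simp_all
  have delta: "(\<Sum>m'\<in>UNIV. emb w b m' * \<delta> m m') = emb w b (wt_neg m)" for m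
  proof -
    have "(\<Sum>m'\<in>UNIV. emb w b m' * \<delta> m m') = (\<Sum>m'\<in>UNIV. if m' = wt_neg m then emb w b m' else 0)"
      unfolding \<delta>_def by (intro sum.cong refl) simp
    then show ?thesis by simp
  qed
  have delta': "(\<Sum>m'\<in>UNIV. emb v B m' * \<delta> m m') = emb v B (wt_neg m)" for m
  proof -
    have "(\<Sum>m'\<in>UNIV. emb v B m' * \<delta> m m') = (\<Sum>m'\<in>UNIV. if m' = wt_neg m then emb v B m' else 0)"
      unfolding \<delta>_def by (intro sum.cong refl) simp
    then show ?thesis by simp
  qed
  have "e8_inv_form (off_elt l a A) (off_elt l b B)
    = (\<Sum>m\<in>UNIV. emb w a m * (\<Sum>n\<in>UNIV. emb v A n * e8_inv_form (off_vec l m n) (off_elt l b B)))"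
    unfolding off_elt_def [of l a A] e8_inv_form_sum(1) e8_inv_form_scale(1) ..
  also have "\<dots> = (\<Sum>m\<in>UNIV. emb w a m * (\<Sum>n\<in>UNIV. emb v A n *
      - (emb w b (wt_neg m) * emb v B (wt_neg n))))"
  proof (intro sum.cong refl arg_cong2 [where f = times])
    fix m n
    have "e8_inv_form (off_vec l m n) (off_elt l b B)
      = (\<Sum>m'\<in>UNIV. emb w b m' * (\<Sum>n'\<in>UNIV. emb v B n' * - (\<delta> m m' * \<delta> n n')))"
      unfolding off_elt_def e8_inv_form_sum(2) e8_inv_form_scale(2) vec ..
    also have "\<dots> = - (\<Sum>m'\<in>UNIV. emb w b m' * \<delta> m m' * (\<Sum>n'\<in>UNIV. emb v B n' * \<delta> n n'))"
      by (simp add: sum_negf sum_distrib_left mult_ac)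
    also have "\<dots> = - (emb w b (wt_neg m) * emb v B (wt_neg n))"
      unfolding delta' sum_distrib_right [symmetric] delta ..
    finally show "e8_inv_form (off_vec l m n) (off_elt l b B) = - (emb w b (wt_neg m) * emb v B (wt_neg n))" .
  qed
  also have "\<dots> = - ((\<Sum>m\<in>UNIV. emb w a m * emb w b (wt_neg m)) * (\<Sum>n\<in>UNIV. emb v A n * emb v B (wt_neg n)))"
    unfolding sum_product unfolding sum_distrib_left sum_negf [symmetric]
    by (intro sum.cong refl) simp
  finally show ?thesis
    unfolding emb_form [OF w] emb_form [OF v] by simp
qed

lemma inv_form_off_elt_neq:
  assumes "l \<noteq> m"
  shows "e8_inv_form (off_elt l a A) (off_elt m b B) = 0"
proof -
  have n: "e8_inv_form (off_elt l a A) (off_elt (next_lang l) b B) = 0" for l and a b :: "'k ounit" and A B :: "'l ounit"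
    by (simp add: off_elt_def e8_inv_form_sum e8_inv_form_scale e8_inv_form_off_vec_next)
  from lang_exhaust_next [OF assms] show ?thesis
  proof
    assume "m = next_lang (next_lang l)"
    then have "e8_inv_form (off_elt m b B) (off_elt l a A) = 0"
      using n [of m b B a A] by simp
    then show ?thesis
      by (subst e8_inv_form_sym)
  qed (simp add: n)
qed

lemma inv_form_off_map_neq:
  assumes "l \<noteq> m"
  shows "e8_inv_form (off_map l s) (off_map m t) = 0"
  by (simp add: off_map_def e8_inv_form_sum e8_inv_form_scaleR inv_form_off_elt_neq [OF assms])

end

context e8_side
begin

text \<open>Invariance moves a bracket to the other argument, after which only values between
  different types remain; for m = l the second argument is first written as a bracket of the other
  two types.\<close>

lemma inv_form_dd_off: "e8_inv_form (dd l a b) (off_map m t) = 0"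
proof -
  have inv: "e8_inv_form (dd l a b) x = (1/2) *\<^sub>R e8_inv_form (off_map l (u a)) (e8_bracket (off_map l (u b)) x)" for x
    by (simp add: dd_def e8_inv_form_scaleR e8_inv_form_invariant)
  consider "m = l" | "m = next_lang l" | "m = next_lang (next_lang l)"
    using lang_exhaust_next [of l m] by blast
  then show ?thesis
  proof cases
    case 1
    have "e8_inv_form (dd l a b) (off_map l t)
      = - e8_inv_form (e8_bracket (dd l a b) (off_map (next_lang l) (tconj t))) (off_map (next_lang (next_lang l)) (u uone))"
      unfolding off_map_prod [of l t] by (simp add: e8_inv_form_minus e8_inv_form_invariant)
    then show ?thesis
      unfolding 1 dd_action by (simp add: e8_inv_form_scaleR inv_form_off_map_neq)
  next
    case 2
    show ?thesis
      unfolding inv 2 off_map_bracket by (simp add: e8_inv_form_minus inv_form_off_map_neq)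
  next
    case 3
    have "e8_bracket (off_map l (u b)) (off_map (next_lang (next_lang l)) t) = off_map (next_lang l) (tconj (tmul t (u b)))"
      using off_map_bracket' [of "next_lang (next_lang l)" "u b" t] by simp
    then show ?thesis
      unfolding inv 3 by (simp add: inv_form_off_map_neq)
  qed
qed

text \<open>Up to the factor 2 this is the infinitesimal rotation in the plane of c and d for the
  norm form. Imaginary b suffice later, because the second member of a pair in
  \<open>unit_pairs\<close> is imaginary.\<close>

lemma dd_off_u:
  assumes "(c, d) \<in> unit_pairs" "b \<in> imag_units"
  shows "e8_bracket (dd l c d) (off_map l (u b))
    = (if b = c then (2 * unorm c) *\<^sub>R off_map l (u d) else if b = d then (- 2 * unorm d) *\<^sub>R off_map l (u c) else 0)"
proof -
  consider "c = uone" "d \<in> imag_units" | "c \<in> imag_units" "d \<in> imag_units" "c \<noteq> d"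
    using assms(1) by (auto simp: unit_pairs_def)
  then show ?thesis
  proof cases
    case 1
    have "tmul (u d) (u b) + tmul (u b) (u d) = (if b = d then (- 2 * unorm d) *\<^sub>R u uone else 0)"
    proof (cases "b = d")
      case True
      then show ?thesis
        using tmul_square [OF 1(2), of "u uone"] by (simp add: vec_eq_iff)
    next
      case False
      then show ?thesis
        using tmul_clifford [OF 1(2) assms(2), of "u uone"] by simp
    qed
    moreover have "b \<noteq> c"
      using assms(2) 1(1) by (auto simp: imag_units_def)
    ultimately show ?thesis
      unfolding 1(1) dd_same [OF 1(2)] by (simp add: off_map_scaleR off_map_minus)
  next
    case 2
    have "tmul (u c) (tmul (u d) (u b)) - tmul (u b) (tmul (u c) (u d))
      = (if b = c then (2 * unorm c) *\<^sub>R u d else if b = d then (- 2 * unorm d) *\<^sub>R u c else 0)"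
    proof -
      consider "b = c" | "b = d" "b \<noteq> c" | "b \<noteq> c" "b \<noteq> d" by blast
      then show ?thesis
      proof cases
        case b: 1
        have "tmul (u d) (u c) = - tmul (u c) (u d)"
          using tmul_clifford [OF 2(2,1) 2(3)[symmetric], of "u uone"] by simp
        then have "tmul (u c) (tmul (u d) (u c)) = unorm c *\<^sub>R u d" "tmul (u c) (tmul (u c) (u d)) = - (unorm c *\<^sub>R u d)"
          using tmul_square [OF 2(1), of "u d"] by (simp_all add: tmul_minus)
        then show ?thesis
          by (simp add: b vec_eq_iff)
      next
        case b: 2
        have "tmul (u c) (tmul (u d) (u d)) = - (unorm d *\<^sub>R u c)"
          using tmul_square [OF 2(2), of "u uone"] by (simp add: tmul_minus tmul_scaleR)
        moreover have "tmul (u d) (tmul (u c) (u d)) = unorm d *\<^sub>R u c"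
          using tmul_clifford [OF 2(2,1) 2(3)[symmetric], of "u d"] tmul_square [OF 2(2), of "u uone"]
          by (simp add: tmul_minus tmul_scaleR)
        ultimately show ?thesis
          using b 2(3) by (simp add: vec_eq_iff)
      next
        case b: 3
        then show ?thesis
          using tmul_pass [OF assms(2) 2(1,2), of "u uone"] by simp
      qed
    qed
    then show ?thesis
      unfolding dd_same_nest [OF 2] by (simp add: off_map_scaleR off_map_minus)
  qed
qed

lemma inv_form_dd_left:
  "e8_inv_form (dd l a b) x = (- 1/2) *\<^sub>R e8_inv_form (off_map l (u a)) (e8_bracket x (off_map l (u b)))"
  unfolding dd_def e8_inv_form_scaleR e8_inv_form_invariant
  by (subst e8_bracket_swap) (simp add: e8_inv_form_minus)

text \<open>Invariance reduces the claim to the orthogonality of units within one type, which is the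
  hypothesis \<open>off\<close>: rotations in different coordinate planes are orthogonal.\<close>

lemma inv_form_dd:
  assumes ab: "(a, b) \<in> unit_pairs" and cd: "(c, d) \<in> unit_pairs"
    and off: "\<And>p q. e8_inv_form (off_map l (u p)) (off_map l (u q)) = (if p = q then of_real (- 4 * unorm p) else 0)"
  shows "e8_inv_form (dd l a b) (dd l c d) = (if (a, b) = (c, d) then of_real (- 4 * (unorm a * unorm b)) else 0)"
proof -
  note ab' = unit_pairs_neq [OF ab] and cd' = unit_pairs_neq [OF cd]
  have "\<not> (a = d \<and> b = c)"
    using unit_pairs_swap [OF ab] cd by auto
  then show ?thesis
    unfolding inv_form_dd_left dd_off_u [OF cd conjunct2 [OF ab']]
    using ab' cd' by (auto simp: e8_inv_form_scaleR off scaleR_conv_of_real e8_inv_form_minus)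
qed

end

text \<open>
  Indices for a basis: the off-diagonal matrices, and the pairs \<open>(1, p)\<close> and \<open>(p, q)\<close>, one for each
  unordered pair, for the diagonal matrices of either algebra.
\<close>

type_synonym ('k, 'l) index =
  "lang \<times> 'k ounit \<times> 'l ounit + 'k ounit \<times> 'k ounit + 'l ounit \<times> 'l ounit"

definition index_set :: "('k::oct_alg, 'l::oct_alg) index set" where
  "index_set = UNIV <+> (unit_pairs <+> unit_pairs)"

lemma index_set_iff [simp]:
  "Inl x \<in> index_set" "Inr (Inl y) \<in> index_set \<longleftrightarrow> y \<in> unit_pairs" "Inr (Inr z) \<in> index_set \<longleftrightarrow> z \<in> unit_pairs"
  by (auto simp: index_set_def)

fun basis_mat :: "('k::oct_alg, 'l::oct_alg) index \<Rightarrow> ('k, 'l) mat" where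
  "basis_mat (Inl (l, a, A)) = off l (tens a A)"
| "basis_mat (Inr (Inl (a, b))) = (if a = uone then sdiag LD (octK b) else ndiag LD (nestK a b))"
| "basis_mat (Inr (Inr (a, b))) = (if a = uone then sdiag LD (octL b) else ndiag LD (nestL a b))"

fun basis_norm :: "('k::oct_alg, 'l::oct_alg) index \<Rightarrow> real" where
  "basis_norm (Inl (l, a, A)) = unorm a * unorm A"
| "basis_norm (Inr (Inl (a, b))) = unorm a * unorm b"
| "basis_norm (Inr (Inr (a, b))) = unorm a * unorm b"

lemma basis_norm_square [simp]: "basis_norm i * basis_norm i = 1"
  by (cases i rule: basis_norm.cases) (simp_all add: algebra_simps flip: mult.assoc)

lemma unit_pairs_cases:
  assumes "(a, b) \<in> unit_pairs"
  obtains "a = uone" "b \<in> imag_units" | "a \<noteq> uone" "a \<in> imag_units" "b \<in> imag_units" "a \<noteq> b" "usgn a b = - 1"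
  using assms by (auto simp: unit_pairs_def imag_units_def)

lemma UNIV_lang: "(UNIV :: lang set) = {LD, LE, LF}"
  using lang.exhaust by auto

instance lang :: finite
  by standard (simp add: UNIV_lang)

lemma basis_mat_canonical: "i \<in> index_set \<Longrightarrow> basis_mat i \<in> canonical_gens"
proof (induction i rule: basis_mat.induct)
  case (1 l a A)
  then show ?case
    unfolding canonical_gens_def off_gens_def basis_mat.simps by blast
next
  case (2 a b)
  then have "(a, b) \<in> unit_pairs"
    by simp
  then show ?case
    by (cases rule: unit_pairs_cases)
      (auto simp: canonical_gens_def octK.sdiag_in_diag_gens octK.ndiag_in_diag_gens simp del: sdiag.simps ndiag.simps)
next
  case (3 a b)
  then have "(a, b) \<in> unit_pairs"
    by simp
  then show ?case
    by (cases rule: unit_pairs_cases)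
      (auto simp: canonical_gens_def octL.sdiag_in_diag_gens octL.ndiag_in_diag_gens simp del: sdiag.simps ndiag.simps)
qed

lemma canonical_span: "canonical_gens \<subseteq> span (basis_mat ` index_set)"
proof
  fix V :: "('k::oct_alg, 'l::oct_alg) mat"
  assume "V \<in> canonical_gens"
  have base: "basis_mat i \<in> span (basis_mat ` index_set)" if "i \<in> index_set" for i :: "('k, 'l) index"
    using that by (intro span_base imageI)
  have pairs: "(p, q) \<in> unit_pairs \<or> (q, p) \<in> unit_pairs"
    if "p \<in> imag_units" "q \<in> imag_units" "p \<noteq> q" for p q :: "'u::oct_alg ounit"
  proof -
    have "usgn p q = 1 \<or> usgn p q = - 1"
      using usgn_square(1) [of p q] square_eq_1_iff by blast
    then show ?thesis
      using usgn_swap [OF that] that by (auto simp: unit_pairs_def)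
  qed
  consider "V \<in> off_gens" | "V \<in> diag_gens octK nestK LD" | "V \<in> diag_gens octL nestL LD"
    using \<open>V \<in> canonical_gens\<close> unfolding canonical_gens_def by blast
  then show "V \<in> span (basis_mat ` index_set)"
  proof cases
    case 1
    then obtain l a A where "V = basis_mat (Inl (l, a, A))"
      by (auto simp: off_gens_def)
    then show ?thesis
      using base [of "Inl (l, a, A)"] by (simp del: basis_mat.simps)
  next
    case 2
    then show ?thesis
    proof (cases rule: octK.diag_gens_cases)
      case (1 p)
      then show ?thesis
        using base [of "Inr (Inl (uone, p))"] by (simp add: unit_pairs_def del: sdiag.simps)
    next
      case (2 p q)
      then have "p \<noteq> uone" "q \<noteq> uone"
        by (auto simp: imag_units_def)
      with pairs [OF 2(1-3)] show ?thesis
        using base [of "Inr (Inl (p, q))"] base [of "Inr (Inl (q, p))"] span_neg [of "ndiag LD (nestK q p)"]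
        unfolding 2(4) octK.nest_minus_eq [of LD p q]
        by (auto simp: octK.nest_minus_eq [of LD p q] simp del: ndiag.simps)
    qed
  next
    case 3
    then show ?thesis
    proof (cases rule: octL.diag_gens_cases)
      case (1 p)
      then show ?thesis
        using base [of "Inr (Inr (uone, p))"] by (simp add: unit_pairs_def del: sdiag.simps)
    next
      case (2 p q)
      then have "p \<noteq> uone" "q \<noteq> uone"
        by (auto simp: imag_units_def)
      with pairs [OF 2(1-3)] show ?thesis
        using base [of "Inr (Inr (p, q))"] base [of "Inr (Inr (q, p))"] span_neg [of "ndiag LD (nestL q p)"]
        unfolding 2(4) octL.nest_minus_eq [of LD p q]
        by (auto simp: octL.nest_minus_eq [of LD p q] simp del: ndiag.simps)
    qed
  qed
qed

context e8_model
begin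

lemma Phi_basis:
  "Phi (basis_mat (Inl (l, a, A))) = off_elt l a A"
  "(p, q) \<in> unit_pairs \<Longrightarrow> Phi (basis_mat (Inr (Inl (p, q)))) = K.dd LD p q"
  "(P, Q) \<in> unit_pairs \<Longrightarrow> Phi (basis_mat (Inr (Inr (P, Q)))) = L.dd LD P Q"
  by (simp_all add: Phi_off off_map_tens del: sdiag.simps ndiag.simps off.simps)
    (erule unit_pairs_cases; simp del: sdiag.simps ndiag.simps)+

text \<open>A diagonal element of the second algebra sends the matrix X of a unit b of the first one
  to 0 or to a multiple of the matrix X of b tensor Q with Q imaginary, and the latter is orthogonal
  to all units of the first algebra.\<close>

lemma inv_form_K_L:
  assumes "(a, b) \<in> unit_pairs" "(P, Q) \<in> unit_pairs"
  shows "e8_inv_form (K.dd LD a b) (L.dd LD P Q) = 0"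
  using assms(2)
proof (cases rule: unit_pairs_cases)
  case 1
  have "tmul (tens uone Q) (tens b uone) + tmul (tens b uone) (tens uone Q) = 2 *\<^sub>R tens b Q"
    by (simp add: tmul_tens scaleR_2)
  moreover have "Q \<noteq> uone"
    using 1 by (auto simp: imag_units_def)
  ultimately show ?thesis
    unfolding K.inv_form_dd_left 1(1) L.dd_same [OF 1(2)]
    by (simp add: off_map_scaleR off_map_tens e8_inv_form_scaleR inv_form_off_elt)
next
  case 2
  have "tmul (tens uone P) (tmul (tens uone Q) (tens b uone)) - tmul (tens b uone) (tmul (tens uone P) (tens uone Q)) = 0"
    by (simp add: tmul_tens tmul_scaleR)
  then show ?thesis
    unfolding K.inv_form_dd_left L.dd_same_nest [OF 2(2-4)] by simp
qed

lemma inv_form_basis: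
  assumes "i \<in> index_set" "j \<in> index_set"
  shows "e8_inv_form (Phi (basis_mat i)) (Phi (basis_mat j)) = (if i = j then of_real (- 4 * basis_norm i) else 0)"
proof -
  have K1: "e8_inv_form (off_map LD (tens p uone)) (off_map LD (tens q uone))
      = (if p = q then of_real (- 4 * unorm p) else 0)" for p q
    by (simp add: off_map_tens inv_form_off_elt unorm_def [of uone] uconj_def)
  have L1: "e8_inv_form (off_map LD (tens uone p)) (off_map LD (tens uone q))
      = (if p = q then of_real (- 4 * unorm p) else 0)" for p q
    by (simp add: off_map_tens inv_form_off_elt unorm_def [of uone] uconj_def)
  have sym: "e8_inv_form (off_elt l a A) (K.dd LD p q) = 0" "e8_inv_form (off_elt l a A) (L.dd LD P Q) = 0"
    for l a A p q P Q
    unfolding off_map_tens [symmetric]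
    by (subst e8_inv_form_sym, rule K.inv_form_dd_off, subst e8_inv_form_sym, rule L.inv_form_dd_off)
  have dd_off: "e8_inv_form (K.dd LD p q) (off_elt l a A) = 0" "e8_inv_form (L.dd LD P Q) (off_elt l a A) = 0"
    for l a A p q P Q
    unfolding off_map_tens [symmetric] by (rule K.inv_form_dd_off L.inv_form_dd_off)+
  have LK: "e8_inv_form (L.dd LD P Q) (K.dd LD a b) = 0" if "(a, b) \<in> unit_pairs" "(P, Q) \<in> unit_pairs" for a b P Q
    by (subst e8_inv_form_sym) (rule inv_form_K_L [OF that])
  have off: "e8_inv_form (off_elt l a A) (off_elt m b B)
      = (if l = m \<and> a = b \<and> A = B then of_real (- 4 * (unorm a * unorm A)) else 0)" for l m a b A B
    using inv_form_off_elt_neq [of l m a A b B] by (cases "l = m") (simp_all add: inv_form_off_elt)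
  show ?thesis
    using assms
    by (cases i rule: basis_mat.cases; cases j rule: basis_mat.cases)
      (simp_all add: Phi_basis off sym dd_off LK inv_form_K_L K.inv_form_dd [OF _ _ K1] L.inv_form_dd [OF _ _ L1]
        del: basis_mat.simps)
qed

end


subsection \<open>The quotient space\<close>

definition basis_vec :: "('k::oct_alg, 'l::oct_alg) index \<Rightarrow> ('k, 'l) tri_mat" where
  "basis_vec i = abs_tri_mat (basis_mat i)"

lemma basis_mat_mats: "i \<in> index_set \<Longrightarrow> basis_mat i \<in> mats"
  using basis_mat_canonical canonical_gens_mats span_base by blast

lemma span_basis_vec: "span (basis_vec ` index_set) = (UNIV :: ('k::oct_alg, 'l::oct_alg) tri_mat set)"
proof -
  have "x \<in> span (basis_vec ` index_set)" for x :: "('k, 'l) tri_mat"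
  proof -
    obtain V where V: "V \<in> mats" "x = abs_tri_mat V"
      by (rule tri_mat_obtain)
    obtain W where W: "W \<in> span canonical_gens" "V - W \<in> triality"
      using mats_reduce [OF V(1)] by blast
    have "x = abs_tri_mat W"
      unfolding V(2) using V W canonical_gens_mats by (intro abs_tri_mat_eqI) (auto simp: mat_eq_def)
    have "W \<in> span (basis_mat ` index_set)"
      using W(1) canonical_span span_minimal subspace_span by blast
    then have "W \<in> mats \<and> abs_tri_mat W \<in> span (basis_vec ` index_set)"
    proof (induction W rule: span_induct_alt)
      case base
      show ?case
        using mats_closed(1) span_zero by (metis zero_tri_mat_def)
    next
      case (step c U W)
      then obtain i where i: "i \<in> index_set" "U = basis_mat i"
        by blast
      then have "c *\<^sub>R U \<in> mats"
        by (simp add: basis_mat_mats mats_closed(5))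
      moreover have "abs_tri_mat (c *\<^sub>R U + W) = c *\<^sub>R basis_vec i + abs_tri_mat W"
        using i step calculation by (simp add: basis_vec_def basis_mat_mats abs_tri_mat_simps del: basis_mat.simps)
      ultimately show ?case
        using step.IH i by (simp add: mats_closed(2) span_add span_scale span_base)
    qed
    then show ?thesis
      using \<open>x = abs_tri_mat W\<close> by simp
  qed
  then show ?thesis
    by blast
qed

context e8_model
begin

lemma Phi_triality:
  assumes "V \<in> triality"
  shows "Phi V = 0"
proof -
  have "linear Phi"
    by (rule linearI) (simp_all add: Phi_add Phi_scaleR)
  moreover from this have "Phi V = 0" if "V \<in> tri_rels octK nestK \<union> tri_rels octL nestL" for V
    using that K.linear_tri_rels_zero [of Phi V] L.linear_tri_rels_zero [of Phi V]
    by (auto simp del: sdiag.simps ndiag.simps)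
  ultimately show ?thesis
    using assms unfolding triality_def by (rule linear_eq_0_on_span)
qed

definition phi :: "('k, 'l) tri_mat \<Rightarrow> 'f e8_alg" where
  "phi x = Phi (rep_tri_mat x)"

lemma phi_abs: "V \<in> mats \<Longrightarrow> phi (abs_tri_mat V) = Phi V"
  using Phi_triality [of "rep_tri_mat (abs_tri_mat V) - V"] mat_eq_rep_abs [of V]
  by (simp add: phi_def mat_eq_def Phi_diff)

lemma phi_basis: "i \<in> index_set \<Longrightarrow> phi (basis_vec i) = Phi (basis_mat i)"
  by (simp add: basis_vec_def phi_abs basis_mat_mats del: basis_mat.simps)

lemma linear_phi: "linear phi"
proof (rule linearI)
  fix x y :: "('k, 'l) tri_mat" and c :: real
  obtain V where V: "V \<in> mats" "x = abs_tri_mat V" by (rule tri_mat_obtain)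
  obtain W where W: "W \<in> mats" "y = abs_tri_mat W" by (rule tri_mat_obtain)
  show "phi (x + y) = phi x + phi y" "phi (c *\<^sub>R x) = c *\<^sub>R phi x"
    by (simp_all add: V W abs_tri_mat_simps phi_abs mats_closed Phi_add Phi_scaleR)
qed

sublocale phi: linear phi
  by (rule linear_phi)

lemma inv_form_phi_basis:
  assumes "i \<in> index_set" "j \<in> index_set"
  shows "e8_inv_form (phi (basis_vec i)) (phi (basis_vec j)) = (if i = j then of_real (- 4 * basis_norm i) else 0)"
  using inv_form_basis [OF assms] by (simp only: phi_basis assms)

lemma basis_norm_nonzero: "basis_norm i \<noteq> 0"
  using basis_norm_square [of i] by (metis mult_zero_left zero_neq_one)

text \<open>The coefficients lie in the field of the model and not only in the reals, so that
  injectivity on the complexification follows from the same computation.\<close>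

lemma phi_basis_coeff:
  assumes "i \<in> index_set" "finite S" "S \<subseteq> index_set"
  shows "e8_inv_form (\<Sum>j\<in>S. e8_scale (c j) (phi (basis_vec j))) (phi (basis_vec i))
    = (if i \<in> S then c i * of_real (- 4 * basis_norm i) else 0)"
proof -
  have "e8_inv_form (\<Sum>j\<in>S. e8_scale (c j) (phi (basis_vec j))) (phi (basis_vec i))
    = (\<Sum>j\<in>S. if j = i then c i * of_real (- 4 * basis_norm i) else 0)"
    unfolding e8_inv_form_sum e8_inv_form_scale using assms
    by (intro sum.cong refl) (auto simp: inv_form_phi_basis)
  then show ?thesis
    using assms(2) by simp
qed

lemma basis_vec_inj: "inj_on (basis_vec :: ('k, 'l) index \<Rightarrow> _) index_set"
proof (rule inj_onI)
  fix i j :: "('k, 'l) index"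
  assume ij: "i \<in> index_set" "j \<in> index_set" "basis_vec i = basis_vec j"
  then have "e8_inv_form (phi (basis_vec i)) (phi (basis_vec j)) = of_real (- 4 * basis_norm i)"
    using inv_form_phi_basis [of i i] by simp
  then show "i = j"
    using inv_form_phi_basis [OF ij(1,2)] basis_norm_nonzero [of i] by (simp split: if_splits)
qed

end


section \<open>Linear independence, injectivity and the bracket on the quotient\<close>

context e8_model
begin

lemma phi_scaleR_sum: "phi (\<Sum>i\<in>S. c i *\<^sub>R f i) = (\<Sum>i\<in>S. e8_scale (of_real (c i)) (phi (f i)))"
  by (simp add: phi.sum phi.scaleR scaleR_eq_e8_scale)

lemma basis_coeff_eq_0:
  assumes "(\<Sum>i\<in>index_set. c i *\<^sub>R basis_vec i) = (0 :: ('k, 'l) tri_mat)" "i \<in> index_set"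
  shows "c i = 0"
proof -
  have "(\<Sum>j\<in>index_set. e8_scale (of_real (c j)) (phi (basis_vec j))) = 0"
    using assms(1) by (simp flip: phi_scaleR_sum)
  then have "of_real (c i) * of_real (- 4 * basis_norm i) = (0 :: 'f)"
    using phi_basis_coeff [OF assms(2), of index_set "\<lambda>j. of_real (c j)"] assms(2)
    by (simp add: e8_inv_form_zero)
  then show ?thesis
    using basis_norm_nonzero [of i] by simp
qed

end

text \<open>A complex model exists for any two octonion algebras, so conclusions that do not mention
  the model hold for all of them.\<close>

lemma e8_model_csqrt:
  "e8_model TYPE('k) TYPE('l)
    (csqrt (of_real (ell_sq TYPE('k::oct_alg)))) (csqrt (of_real (ell_sq TYPE('l::oct_alg))))"
  by unfold_locales (simp_all flip: power2_eq_square)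

lemma basis_vec_inj: "inj_on (basis_vec :: ('k::oct_alg, 'l::oct_alg) index \<Rightarrow> _) index_set"
  by (rule e8_model.basis_vec_inj [OF e8_model_csqrt])

lemma basis_vec_expansion:
  obtains c where "x = (\<Sum>i\<in>index_set. c i *\<^sub>R basis_vec i)"
proof -
  have "x \<in> span (basis_vec ` index_set)"
    unfolding span_basis_vec by simp
  then obtain u where "x = (\<Sum>v\<in>basis_vec ` index_set. u v *\<^sub>R v)"
    unfolding span_finite [OF finite_imageI [OF finite]] by blast
  then show ?thesis
    by (intro that [of "u \<circ> basis_vec"]) (simp add: sum.reindex basis_vec_inj)
qed

lemma independent_basis_vec: "independent (basis_vec ` index_set :: ('k::oct_alg, 'l::oct_alg) tri_mat set)"
proof (rule independent_if_scalars_zero)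
  fix f :: "('k, 'l) tri_mat \<Rightarrow> real" and x :: "('k, 'l) tri_mat"
  assume "(\<Sum>x\<in>basis_vec ` index_set. f x *\<^sub>R x) = 0" "x \<in> basis_vec ` index_set"
  then show "f x = 0"
    using e8_model.basis_coeff_eq_0 [OF e8_model_csqrt, of "f \<circ> basis_vec"]
    by (auto simp: sum.reindex basis_vec_inj)
qed simp

context e8_model
begin

lemma phi_eq_iff: "phi x = phi y \<longleftrightarrow> x = y"
proof
  obtain c where c: "x - y = (\<Sum>i\<in>index_set. c i *\<^sub>R basis_vec i)"
    by (rule basis_vec_expansion)
  assume "phi x = phi y"
  then have z: "phi (\<Sum>i\<in>index_set. c i *\<^sub>R basis_vec i) = 0"
    by (simp add: phi.diff flip: c)
  have "c i = 0" if "i \<in> index_set" for i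
    using phi_basis_coeff [OF that, of index_set "\<lambda>j. of_real (c j)"] that basis_norm_nonzero [of i] z
    by (simp add: e8_inv_form_zero phi_scaleR_sum)
  then have "x - y = 0"
    unfolding c by (simp add: sum.neutral)
  then show "x = y"
    by simp
qed simp

lemma product_value_phi:
  assumes "product_value x y z"
  shows "phi z = e8_bracket (phi x) (phi y)"
  using assms commutator_Phi unfolding product_value_def by (auto simp: phi_abs)

lemma product_value_ex1: "\<exists>!u. product_value (x :: ('k, 'l) tri_mat) y u"
  using product_value_exists [of x y] product_value_phi [of x y] phi_eq_iff by metis

lemma phi_bracket: "phi (tri_bracket x y) = e8_bracket (phi x) (phi y)"
  unfolding tri_bracket_def by (rule product_value_phi [OF theI' [OF product_value_ex1]])

lemma lie_algebra_tri_bracket: "lie_algebra (tri_bracket :: ('k, 'l) tri_mat \<Rightarrow> _)"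
  unfolding lie_algebra_def bilinear_def
proof (intro conjI allI linearI)
  fix x y z :: "('k, 'l) tri_mat" and c :: real
  note eq = phi_eq_iff [THEN iffD1]
  note s = phi_bracket phi.add phi.scaleR phi.zero e8_bracket_add_left e8_bracket_add_right e8_bracket_scaleR
    e8_bracket_self
  show "tri_bracket x (y + z) = tri_bracket x y + tri_bracket x z"
    "tri_bracket (y + z) x = tri_bracket y x + tri_bracket z x"
    "tri_bracket x (c *\<^sub>R y) = c *\<^sub>R tri_bracket x y"
    "tri_bracket (c *\<^sub>R y) x = c *\<^sub>R tri_bracket y x"
    "tri_bracket x x = 0"
    by (rule eq, simp only: s)+
  show "tri_bracket x (tri_bracket y z) + tri_bracket y (tri_bracket z x) + tri_bracket z (tri_bracket x y) = 0"
    by (rule eq) (simp only: s e8_jacobi)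
qed

text \<open>The set M is closed under scalars of the whole field, since a null octonion has the
  coefficient 1/w.\<close>

lemma e8_generated_by_phi:
  assumes add: "\<And>x y. x \<in> M \<Longrightarrow> y \<in> M \<Longrightarrow> x + y \<in> M"
    and scale: "\<And>c x. x \<in> M \<Longrightarrow> e8_scale c x \<in> M"
    and bracket: "\<And>x y. x \<in> M \<Longrightarrow> y \<in> M \<Longrightarrow> e8_bracket x y \<in> M"
    and phi: "range phi \<subseteq> M"
  shows "x \<in> M"
proof -
  have zero: "0 \<in> M"
    using phi phi.zero by (metis rangeI subsetD)
  have sum: "sum f S \<in> M" if "\<And>s. f s \<in> M" for f :: "'s \<Rightarrow> 'f e8_alg" and S
    using zero that add by (induction S rule: infinite_finite_induct) auto
  have "off_elt l a A = phi (basis_vec (Inl (l, a, A)))" for l a A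
    by (simp only: phi_basis index_set_iff Phi_basis)
  then have "off_elt l a A \<in> M" for l a A
    using phi by (metis rangeI subsetD)
  then have "off_vec l m n \<in> M" for l m n
    unfolding off_vec_eq by (intro sum scale)
  then have "e8_scale (of_int (root_sign l m n)) (off_vec l m n) \<in> M" for l m n
    by (rule scale)
  then have root: "e8_vec (root_vec l m n) \<in> M" for l m n
    by (simp add: off_vec_def root_sign_square flip: of_int_mult)
  have simple: "\<exists>l m n. root_vec l m n = axis i 1" for i :: 8
  proof -
    \<comment> \<open>The places of the eight simple roots among the off-diagonal roots; their
      negatives are obtained by reversing both signs.\<close>
    have "root_vec LE (Qi, False) (Qk, False) = axis 1 1" "root_vec LF (Q1, True) (Q1, False) = axis 2 1"
      "root_vec LF (Qk, False) (Qi, False) = axis 3 1" "root_vec LE (Qk, True) (Qj, False) = axis 4 1"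
      "root_vec LD (Qk, False) (Qk, False) = axis 5 1" "root_vec LE (Qj, False) (Qi, False) = axis 6 1"
      "root_vec LD (Qi, False) (Q1, True) = axis 7 1" "root_vec LD (Qi, True) (Qi, True) = axis 8 1"
      by (simp_all add: root_vec_def root_list_def vec_eq_iff forall_8 vec8_def axis_def)
    then show ?thesis
      using forall_8 [of "\<lambda>i. \<exists>l m n. root_vec l m n = axis i 1"] by blast
  qed
  have vec: "e8_vec (axis i 1) \<in> M" "e8_vec (- axis i 1) \<in> M" for i :: 8
  proof -
    obtain l m n where "root_vec l m n = axis i 1"
      using simple by blast
    then show "e8_vec (axis i 1) \<in> M" "e8_vec (- axis i 1) \<in> M"
      using root [of l m n] root [of l "wt_neg m" "wt_neg n"] unfolding root_vec_neg by simp_all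
  qed
  show ?thesis
    by (rule e8_generated_by_simple_roots [of M, OF add scale bracket vec])
qed

end


subsection \<open>Complexification and the split form\<close>

lemma vector_space_cplx_scale: "vector_space (cplx_scale :: complex \<Rightarrow> 'v::real_vector \<times> 'v \<Rightarrow> _)"
  by unfold_locales (auto simp: cplx_scale_def prod_eq_iff algebra_simps)

lemma real_form_e8_tri_bracket:
  "real_form_e8 (tri_bracket :: ('k::oct_alg, 'l::oct_alg) tri_mat \<Rightarrow> _)"
proof -
  interpret e8_model "csqrt (of_real (ell_sq TYPE('k)))" "csqrt (of_real (ell_sq TYPE('l)))" "TYPE('k)" "TYPE('l)"
    by (rule e8_model_csqrt)
  define \<psi> where "\<psi> z = phi (fst z) + e8_scale \<i> (phi (snd z))" for z
  have add: "\<psi> (x + y) = \<psi> x + \<psi> y" for x y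
    by (simp add: \<psi>_def phi.add e8.scale_right_distrib)
  have scale: "\<psi> (cplx_scale c x) = e8_scale c (\<psi> x)" for c x
    by (simp add: \<psi>_def cplx_scale_def phi.add phi.diff phi.scaleR scaleR_eq_e8_scale)
      (simp add: prod_eq_iff vec_eq_iff complex_eq_iff algebra_simps)
  have lin: "Vector_Spaces.linear cplx_scale e8_scale \<psi>"
    unfolding Vector_Spaces.linear_iff using vector_space_cplx_scale e8.vector_space_axioms add scale by blast
  have bracket: "\<psi> (cplx_bracket tri_bracket x y) = e8_bracket (\<psi> x) (\<psi> y)" for x y
  proof -
    have "e8_scale \<i> (e8_scale \<i> z) = - z" for z
      by (simp add: e8_scale_def prod_eq_iff vec_eq_iff flip: mult.assoc)
    then show ?thesis
      by (simp add: \<psi>_def cplx_bracket_def phi.add phi.diff phi_bracket e8_bracket_add_left e8_bracket_add_right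
          e8_bracket_scale_left e8_bracket_scale_right e8.scale_right_distrib)
  qed
  \<comment> \<open>The images of the basis are orthogonal with nonzero norms over the complex
    numbers, so the complex coordinates of x vanish.\<close>
  have zero: "x = 0" if "\<psi> x = 0" for x
  proof -
    obtain a where a: "fst x = (\<Sum>i\<in>index_set. a i *\<^sub>R basis_vec i)" by (rule basis_vec_expansion)
    obtain b where b: "snd x = (\<Sum>i\<in>index_set. b i *\<^sub>R basis_vec i)" by (rule basis_vec_expansion)
    have "\<psi> x = (\<Sum>i\<in>index_set. e8_scale (of_real (a i) + \<i> * of_real (b i)) (phi (basis_vec i)))"
      by (simp add: \<psi>_def a b phi_scaleR_sum e8.scale_sum_right e8.scale_left_distrib sum.distrib)
    then have "(of_real (a i) + \<i> * of_real (b i)) * of_real (- 4 * basis_norm i) = (0 :: complex)" if "i \<in> index_set" for i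
      using phi_basis_coeff [OF that, of index_set "\<lambda>i. of_real (a i) + \<i> * of_real (b i)"] that \<open>\<psi> x = 0\<close>
      by (simp add: e8_inv_form_zero)
    then have "a i = 0 \<and> b i = 0" if "i \<in> index_set" for i
      using that basis_norm_nonzero [of i] by (force simp: complex_eq_iff)
    then show ?thesis
      by (simp add: prod_eq_iff a b sum.neutral)
  qed
  have "inj \<psi>"
  proof (rule injI)
    fix x y assume "\<psi> x = \<psi> y"
    then have "\<psi> (x + cplx_scale (- 1) y) = 0"
      unfolding add scale by simp
    then have "x + cplx_scale (- 1) y = 0"
      by (rule zero)
    then show "x = y"
      by (simp add: cplx_scale_def prod_eq_iff)
  qed
  \<comment> \<open>The range is a complex subalgebra containing the image of \<open>phi\<close>,
    hence everything.\<close>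
  moreover have "x \<in> range \<psi>" for x
  proof (rule e8_generated_by_phi)
    have "phi x = \<psi> (x, 0)" for x
      by (simp add: \<psi>_def)
    then show "range phi \<subseteq> range \<psi>"
      by (auto simp del: split_paired_All)
  qed (auto simp flip: add scale bracket)
  ultimately have "bij \<psi>"
    by (auto simp: bij_def)
  then show ?thesis
    unfolding real_form_e8_def lie_isomorphic_def using lie_algebra_tri_bracket lin bracket by blast
qed

lemma split_e8_tri_bracket:
  assumes "ell_sq TYPE('k::oct_alg) = 1" "ell_sq TYPE('l::oct_alg) = 1"
  shows "split_e8 (tri_bracket :: ('k, 'l) tri_mat \<Rightarrow> _)"
proof -
  interpret e8_model "1 :: real" 1 "TYPE('k)" "TYPE('l)"
    by unfold_locales (simp_all add: assms)
  have scale: "e8_scale c x = c *\<^sub>R x" for c :: real and x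
    by (simp add: scaleR_eq_e8_scale)
  have lin: "Vector_Spaces.linear (*\<^sub>R) e8_scale phi"
    unfolding Vector_Spaces.linear_iff
    by (simp add: real_vector.vector_space_axioms e8.vector_space_axioms phi.add phi.scaleR scale)
  have "x \<in> range phi" for x
    by (rule e8_generated_by_phi) (auto simp: scale simp flip: phi.add phi.scaleR phi_bracket)
  then have "bij phi"
    by (auto simp: bij_def inj_def phi_eq_iff)
  then show ?thesis
    unfolding split_e8_def lie_isomorphic_def using lie_algebra_tri_bracket lin phi_bracket by blast
qed


subsection \<open>The Killing form\<close>

text \<open>\<open>endo_trace\<close> refers to a basis C given by a choice. Expanding the images of
  C in the vectors b and exchanging the two sums expresses the trace by the coordinate functions g
  instead.\<close>

lemma endo_trace_coords:
  fixes f :: "'v::real_vector \<Rightarrow> 'v"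
  assumes "linear f" and I: "finite I" and g: "\<And>i. linear (g i)"
    and expand: "\<And>x. x = (\<Sum>i\<in>I. g i x *\<^sub>R b i)"
  shows "endo_trace f = (\<Sum>i\<in>I. g i (f (b i)))"
proof -
  interpret f: linear f by fact
  define C :: "'v set" where "C = extend_basis {}"
  have C: "independent C" "span C = UNIV"
    unfolding C_def by (simp_all add: independent_extend_basis span_extend_basis independent_empty)
  have "x \<in> span (b ` I)" for x
    by (subst expand) (intro span_sum span_scale span_base imageI)
  then have "finite C"
    using independent_span_bound [of "b ` I" C] I C(1) by blast
  have rep: "representation C (f c) c = (\<Sum>i\<in>I. g i (f c) * representation C (b i) c)" for c
    by (subst expand [of "f c"]) (simp add: representation_sum representation_scale C)
  have "endo_trace f = (\<Sum>i\<in>I. \<Sum>c\<in>C. g i (f c) * representation C (b i) c)"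
    unfolding endo_trace_def Let_def C_def [symmetric] rep by (rule sum.swap)
  also have "\<dots> = (\<Sum>i\<in>I. g i (f (\<Sum>c\<in>C. representation C (b i) c *\<^sub>R c)))"
    by (simp add: f.sum f.scaleR linear_sum [OF g] linear_scale [OF g] mult.commute)
  also have "\<dots> = (\<Sum>i\<in>I. g i (f (b i)))"
    by (simp add: sum_representation_eq C \<open>finite C\<close>)
  finally show ?thesis .
qed

text \<open>
  A Lie algebra with an invariant form \<open>H\<close> and an involutive automorphism \<open>\<theta>\<close> such that \<open>H x (\<theta> y)\<close> is an
  inner product, with an orthonormal basis of eigenvectors of \<open>\<theta>\<close>.
\<close>

locale lie_involution =
  fixes br :: "'v::real_vector \<Rightarrow> 'v \<Rightarrow> 'v" and H :: "'v \<Rightarrow> 'v \<Rightarrow> real" and \<theta> :: "'v \<Rightarrow> 'v"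
    and b :: "'i \<Rightarrow> 'v" and n :: "'i \<Rightarrow> real" and I :: "'i set"
  assumes lie: "lie_algebra br"
    and H: "bilinear H" and H_sym: "H x y = H y x" and H_inv: "H (br x y) z = H x (br y z)"
    and \<theta>: "linear \<theta>" and \<theta>_br: "\<theta> (br x y) = br (\<theta> x) (\<theta> y)"
    and \<theta>_basis: "i \<in> I \<Longrightarrow> \<theta> (b i) = n i *\<^sub>R b i"
    and H_basis: "i \<in> I \<Longrightarrow> j \<in> I \<Longrightarrow> H (b i) (b j) = (if i = j then n i else 0)"
    and n: "n i * n i = 1" and I: "finite I" and inj: "inj_on b I"
    and independent: "independent (b ` I)" and span: "span (b ` I) = UNIV"
    and center: "(\<And>y. br x y = 0) \<Longrightarrow> x = 0"
begin

sublocale \<theta>: linear \<theta>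
  by (rule \<theta>)

lemma br: "bilinear br" and br_self: "br x x = 0"
  using lie by (auto simp: lie_algebra_def)

lemma br_swap: "br y x = - br x y"
  using br_self [of "x + y", unfolded bilinear_ladd [OF br] bilinear_radd [OF br]]
  by (simp add: br_self eq_neg_iff_add_eq_0 add.commute)

lemma H_inv': "H (br x y) z = - H y (br x z)"
  unfolding br_swap [of x y] by (simp add: bilinear_lneg [OF H] H_inv)

lemma H_\<theta>: "H (\<theta> x) (\<theta> y) = H x y"
proof (rule bilinear_eq [where B = "b ` I" and C = "b ` I" and S = UNIV and T = UNIV])
  show "bilinear (\<lambda>x y. H (\<theta> x) (\<theta> y))"
    unfolding bilinear_def
    by (auto intro!: linearI simp: bilinear_ladd [OF H] bilinear_radd [OF H] bilinear_lmul [OF H]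
        bilinear_rmul [OF H] \<theta>.add \<theta>.scaleR)
qed (auto simp: H span \<theta>_basis H_basis bilinear_lmul [OF H] bilinear_rmul [OF H] n)

lemma \<theta>_\<theta> [simp]: "\<theta> (\<theta> x) = x"
proof -
  have "(\<theta> \<circ> \<theta>) x = id x"
    by (rule linear_eq_on_span [where B = "b ` I" and f = "\<theta> \<circ> \<theta>" and g = id])
      (auto simp: \<theta>_basis \<theta>.scaleR n span linear_compose \<theta> linear_id)
  then show ?thesis
    by simp
qed

lemma expand: "x = (\<Sum>i\<in>I. H x (\<theta> (b i)) *\<^sub>R b i)"
proof -
  have "(\<Sum>i\<in>I. H x (\<theta> (b i)) *\<^sub>R b i) = id x"
  proof (rule linear_eq_on_span [where B = "b ` I" and g = id])
    show "linear (\<lambda>x. \<Sum>i\<in>I. H x (\<theta> (b i)) *\<^sub>R b i)"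
      by (auto intro!: linearI simp: bilinear_ladd [OF H] bilinear_lmul [OF H] scaleR_add_left sum.distrib
          scaleR_right.sum)
  next
    fix y assume "y \<in> b ` I"
    then obtain j where j: "j \<in> I" "y = b j"
      by blast
    have "(\<Sum>i\<in>I. H y (\<theta> (b i)) *\<^sub>R b i) = (\<Sum>i\<in>I. if i = j then b j else 0)"
      using j by (intro sum.cong refl) (auto simp: \<theta>_basis bilinear_rmul [OF H] H_basis n)
    then show "(\<Sum>i\<in>I. H y (\<theta> (b i)) *\<^sub>R b i) = id y"
      using j I by simp
  qed (auto simp: span linear_id)
  then show ?thesis
    by simp
qed

text \<open>Parseval: by \<open>expand\<close> the value is the sum of the squares of the
  coordinates of x.\<close>

lemma positive:
  assumes "x \<noteq> 0"
  shows "H x (\<theta> x) > 0"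
proof -
  have "\<theta> x = (\<Sum>i\<in>I. H x (\<theta> (b i)) *\<^sub>R \<theta> (b i))"
    by (subst expand [of x]) (simp add: \<theta>.sum \<theta>.scaleR)
  then have "H x (\<theta> x) = (\<Sum>i\<in>I. H x (\<theta> (b i)) * H x (\<theta> (b i)))"
    using H by (simp add: bilinear_def linear_sum linear_scale)
  moreover obtain i where "i \<in> I" "H x (\<theta> (b i)) \<noteq> 0"
    using expand [of x] assms by (metis (no_types, lifting) scaleR_zero_left sum.neutral)
  ultimately show ?thesis
    by (simp add: sum_pos2 [OF I] flip: power2_eq_square)
qed

lemma linear_br_br: "linear (\<lambda>z. br x (br y z))"
  by (rule linearI) (simp_all add: bilinear_radd [OF br] bilinear_rmul [OF br])

lemma killing_coords: "killing br x y = (\<Sum>i\<in>I. H (br x (br y (b i))) (\<theta> (b i)))"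
  unfolding killing_def
  by (rule endo_trace_coords [OF linear_br_br I _ expand]) (use H in \<open>simp add: bilinear_def\<close>)

text \<open>The composite of ad x and ad y exchanges the two eigenspaces of \<theta>, so its
  diagonal entries in a basis of eigenvectors vanish.\<close>

lemma killing_eigen_orthogonal:
  assumes "\<theta> x = - x" "\<theta> y = y"
  shows "killing br x y = 0"
proof -
  have "H (br x (br y (b i))) (\<theta> (b i)) = - H (br x (br y (b i))) (\<theta> (b i))" if "i \<in> I" for i
  proof -
    have "H (br x (br y (b i))) (\<theta> (b i)) = H (\<theta> (br x (br y (b i)))) (\<theta> (\<theta> (b i)))"
      by (rule H_\<theta> [symmetric])
    also have "\<dots> = - H (br x (br y (\<theta> (b i)))) (b i)"
      by (simp add: \<theta>_br assms bilinear_lneg [OF br] bilinear_lneg [OF H])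
    also have "\<dots> = - H (br x (br y (b i))) (\<theta> (b i))"
      by (simp add: \<theta>_basis that bilinear_rmul [OF br] bilinear_lmul [OF H] bilinear_rmul [OF H])
    finally show ?thesis .
  qed
  then show ?thesis
    unfolding killing_coords by (intro sum.neutral) simp
qed

text \<open>By invariance ad x is skew for H. For an eigenvector x this makes the trace of its
  square equal to -e times the sum of the squared lengths of the brackets of x with the basis, and
  the trivial center makes that sum positive.\<close>

lemma killing_eigen:
  assumes "\<theta> x = e *\<^sub>R x" "e * e = 1" "x \<noteq> 0"
  shows "e * killing br x x < 0"
proof -
  have "e * H (br x (br x (b i))) (\<theta> (b i)) = - H (br x (b i)) (\<theta> (br x (b i)))" if "i \<in> I" for i
  proof -
    have "H (br x (br x (b i))) (\<theta> (b i)) = - H (br x (b i)) (br x (\<theta> (b i)))"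
      by (rule H_inv')
    moreover have "\<theta> (br x (b i)) = e *\<^sub>R br x (\<theta> (b i))"
      by (simp add: \<theta>_br assms bilinear_lmul [OF br])
    ultimately show ?thesis
      by (simp add: bilinear_rmul [OF H])
  qed
  then have "e * killing br x x = - (\<Sum>i\<in>I. H (br x (b i)) (\<theta> (br x (b i))))"
    unfolding killing_coords by (simp add: sum_distrib_left sum_negf)
  moreover have "\<exists>i\<in>I. br x (b i) \<noteq> 0"
  proof (rule ccontr)
    assume "\<not> ?thesis"
    then have "br x y = 0" for y
      using linear_eq_0_on_span [of "br x" "b ` I" y] br span by (auto simp: bilinear_def)
    then show False
      using center assms(3) by blast
  qed
  moreover have "H y (\<theta> y) \<ge> 0" for y
    using positive [of y] by (cases "y = 0") (auto simp: bilinear_lzero [OF H] \<theta>.zero)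
  ultimately show ?thesis
    using sum_pos2 [OF I, of _ "\<lambda>i. H (br x (b i)) (\<theta> (br x (b i)))"] positive by force
qed

lemma dim_eigen:
  assumes "e * e = 1"
  shows "dim {x. \<theta> x = e *\<^sub>R x} = card {i \<in> I. n i = e}"
proof (rule dim_unique)
  show "b ` {i \<in> I. n i = e} \<subseteq> {x. \<theta> x = e *\<^sub>R x}"
    by (auto simp: \<theta>_basis)
  show "independent (b ` {i \<in> I. n i = e})"
    by (rule independent_mono [OF independent]) blast
  show "card (b ` {i \<in> I. n i = e}) = card {i \<in> I. n i = e}"
    by (rule card_image) (use inj in \<open>auto intro: inj_on_subset\<close>)
  show "{x. \<theta> x = e *\<^sub>R x} \<subseteq> span (b ` {i \<in> I. n i = e})"
  proof clarify
    fix x assume x: "\<theta> x = e *\<^sub>R x"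
    have "H x (\<theta> (b i)) *\<^sub>R b i \<in> span (b ` {i \<in> I. n i = e})" if i: "i \<in> I" for i
    proof (cases "n i = e")
      case True
      then show ?thesis
        using i by (intro span_scale span_base imageI) simp
    next
      case False
      \<comment> \<open>Eigenvectors for different eigenvalues are H-orthogonal because \<theta>
        preserves H.\<close>
      have "H x (\<theta> (b i)) = e * n i * H x (\<theta> (b i))"
      proof -
        have "H x (\<theta> (b i)) = H (\<theta> x) (\<theta> (\<theta> (b i)))"
          by (rule H_\<theta> [symmetric])
        also have "\<dots> = e * n i * H x (\<theta> (b i))"
          unfolding x \<theta>_basis [OF i] \<theta>.scaleR by (simp add: bilinear_lmul [OF H] bilinear_rmul [OF H])
        finally show ?thesis .
      qed
      moreover have "e * n i \<noteq> 1"
        using False assms n [of i] by (metis mult.assoc mult.right_neutral mult.commute)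
      ultimately have "H x (\<theta> (b i)) = 0"
        by (metis mult_cancel_right1)
      then show ?thesis
        by (simp add: span_zero)
    qed
    then show "x \<in> span (b ` {i \<in> I. n i = e})"
      by (subst expand) (intro span_sum)
  qed
qed

text \<open>The eigenspaces of \<theta> supply the decomposition, since the Killing form has the
  sign opposite to the eigenvalue.\<close>

lemma has_character:
  "has_character br (int (card {i \<in> I. n i = - 1}) - int (card {i \<in> I. n i = 1}))"
proof -
  define P where "P = {x. \<theta> x = (- 1) *\<^sub>R x}"
  define N where "N = {x. \<theta> x = 1 *\<^sub>R x}"
  have half: "x = (1/2) *\<^sub>R (x - \<theta> x) + (1/2) *\<^sub>R (x + \<theta> x)" for x
    by (simp add: scaleR_add_right [symmetric] scaleR_2 [symmetric])
  have mem: "(1/2) *\<^sub>R (x - \<theta> x) \<in> P" "(1/2) *\<^sub>R (x + \<theta> x) \<in> N" for x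
    by (simp_all add: P_def N_def \<theta>.add \<theta>.diff \<theta>.scaleR add.commute flip: scaleR_minus_right)
  have "subspace P" "subspace N"
    by (auto simp: P_def N_def subspace_def \<theta>.add \<theta>.scaleR \<theta>.zero)
  moreover have "P \<inter> N = {0}"
  proof -
    have "x = 0" if "\<theta> x = x" "\<theta> x = - x" for x
      using that scaleR_2 [of x] by (metis add.right_inverse scaleR_eq_0_iff zero_neq_numeral)
    then show ?thesis
      by (auto simp: P_def N_def \<theta>.zero)
  qed
  moreover have "{x + y |x y. x \<in> P \<and> y \<in> N} = UNIV"
    using half mem by blast
  moreover have "\<forall>x\<in>P. \<forall>y\<in>N. killing br x y = 0"
    by (simp add: P_def N_def killing_eigen_orthogonal)
  moreover have "\<forall>x\<in>P. x \<noteq> 0 \<longrightarrow> killing br x x > 0"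
    using killing_eigen [where e = "- 1"] by (auto simp: P_def)
  moreover have "\<forall>x\<in>N. x \<noteq> 0 \<longrightarrow> killing br x x < 0"
    using killing_eigen [where e = 1] by (auto simp: N_def)
  moreover have "dim P = card {i \<in> I. n i = - 1}" "dim N = card {i \<in> I. n i = 1}"
    unfolding P_def N_def by (rule dim_eigen; simp)+
  ultimately show ?thesis
    unfolding has_character_def by (intro exI [of _ P] exI [of _ N] conjI) simp_all
qed

lemma killing_negative:
  assumes "\<And>i. i \<in> I \<Longrightarrow> n i = 1" "x \<noteq> 0"
  shows "killing br x x < 0"
proof -
  have "\<theta> x = id x"
    by (rule linear_eq_on_span [where B = "b ` I" and f = \<theta> and g = id]) (auto simp: \<theta>_basis assms(1) span \<theta> linear_id)
  then show ?thesis
    using killing_eigen [of x 1] assms(2) by simp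
qed

end


subsection \<open>The Cartan involution\<close>

text \<open>The units x have norm 1 and the units x\<ell> have norm -\<ell>^2, and only the latter
  involve w.\<close>

lemma emb_star:
  fixes w :: "'f::real_field" and a :: "'k::oct_alg ounit"
  shows "emb (of_real (- ell_sq TYPE('k)) * w) a m = of_real (unorm a) * emb w a m"
  by (cases a; rename_tac x; case_tac x) (simp_all add: unorm_def uconj_def qconj_def)

text \<open>
  Two embeddings of the same matrices; the second one is the first one composed with an involution
  that multiplies the basis vectors by their norms.
\<close>

locale e8_model_pair = M: e8_model w v tK tL + S: e8_model w' v' tK tL
  for w v w' v' :: "'f::real_field" and tK :: "'k::oct_alg itself" and tL :: "'l::oct_alg itself" +
  assumes emb_w': "emb w' (a :: 'k ounit) m = of_real (unorm a) * emb w a m"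
    and emb_v': "emb v' (A :: 'l ounit) m = of_real (unorm A) * emb v A m"
begin

lemma off_elt_star: "S.off_elt l a A = (unorm a * unorm A) *\<^sub>R M.off_elt l a A"
  unfolding S.off_elt_def M.off_elt_def emb_w' emb_v' scaleR_eq_e8_scale
  by (simp add: e8.scale_sum_right mult_ac)

lemma dd_star:
  "S.K.dd l p q = (unorm p * unorm q) *\<^sub>R M.K.dd l p q"
  "S.L.dd l P Q = (unorm P * unorm Q) *\<^sub>R M.L.dd l P Q"
  by (simp_all add: S.K.dd_def M.K.dd_def S.L.dd_def M.L.dd_def S.off_map_tens M.off_map_tens off_elt_star
      e8_bracket_scaleR unorm_def [of uone] uconj_def)

lemma phi_star:
  assumes "i \<in> index_set"
  shows "S.phi (basis_vec i) = basis_norm i *\<^sub>R M.phi (basis_vec i)"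
  unfolding S.phi_basis [OF assms] M.phi_basis [OF assms] using assms
  by (cases i rule: basis_mat.cases)
    (simp_all add: S.Phi_basis M.Phi_basis off_elt_star dd_star del: basis_mat.simps)

end

lemma lie_involution_tri_mat:
  "\<exists>H \<theta>. lie_involution (tri_bracket :: ('k::oct_alg, 'l::oct_alg) tri_mat \<Rightarrow> _) H \<theta> basis_vec basis_norm index_set"
proof -
  define w v where "w = csqrt (of_real (ell_sq TYPE('k)))" and "v = csqrt (of_real (ell_sq TYPE('l)))"
  have sq: "ell_sq TYPE('k) * ell_sq TYPE('k) = 1" "ell_sq TYPE('l) * ell_sq TYPE('l) = 1"
    using ell_sq_cases [where 'a = 'k] ell_sq_cases [where 'a = 'l] by auto
  have model: "e8_model TYPE('k) TYPE('l) w v"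
    unfolding w_def v_def by (rule e8_model_csqrt)
  define w' v' where "w' = of_real (- ell_sq TYPE('k)) * w" and "v' = of_real (- ell_sq TYPE('l)) * v"
  have "(of_real x * c) * (of_real x * c) = c * c" if "x * x = 1" for x and c :: complex
  proof -
    have "(of_real x * c) * (of_real x * c) = of_real (x * x) * (c * c)"
      by simp
    then show ?thesis
      by (simp only: that) simp
  qed
  then have model': "e8_model TYPE('k) TYPE('l) w' v'"
    using model sq by (simp only: e8_model_def w'_def v'_def minus_mult_minus)
  interpret e8_model_pair w v w' v' "TYPE('k)" "TYPE('l)"
    by (intro e8_model_pair.intro model model' e8_model_pair_axioms.intro)
      (unfold w'_def v'_def, rule emb_star, rule emb_star)
  \<comment> \<open>The factor -1/4 turns the values \<open>- 4 * basis_norm i\<close> of the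
    invariant form into the norms.\<close>
  define H :: "('k, 'l) tri_mat \<Rightarrow> ('k, 'l) tri_mat \<Rightarrow> real"
    where "H x y = - Re (e8_inv_form (M.phi x) (M.phi y)) / 4" for x y
  define \<theta> where "\<theta> x = (\<Sum>i\<in>index_set. H x (basis_vec i) *\<^sub>R basis_vec i)" for x
  have H: "bilinear H"
    unfolding bilinear_def H_def
    by (auto intro!: linearI simp: M.phi.add M.phi.scaleR e8_inv_form_add e8_inv_form_scaleR add_divide_distrib)
  have H_basis: "H (basis_vec i) (basis_vec j) = (if i = j then basis_norm i else 0)"
    if "i \<in> index_set" "j \<in> index_set" for i j
    unfolding H_def M.inv_form_phi_basis [OF that] by simp
  have \<theta>: "linear \<theta>"
    unfolding \<theta>_def
    by (auto intro!: linearI simp: bilinear_ladd [OF H] bilinear_lmul [OF H] scaleR_add_left sum.distrib scaleR_right.sum)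
  have \<theta>_basis: "\<theta> (basis_vec i) = basis_norm i *\<^sub>R basis_vec i" if "i \<in> index_set" for i
  proof -
    have "\<theta> (basis_vec i) = (\<Sum>j\<in>index_set. if j = i then basis_norm i *\<^sub>R basis_vec i else 0)"
      unfolding \<theta>_def using that by (intro sum.cong refl) (auto simp: H_basis)
    then show ?thesis
      using that by simp
  qed
  \<comment> \<open>Both models are homomorphisms on the same algebra and \<open>S.phi\<close> is
    injective, so this factorization makes \<theta> an automorphism.\<close>
  have star: "S.phi (\<theta> x) = M.phi x" for x
  proof -
    have "(S.phi \<circ> \<theta>) x = M.phi x"
    proof (rule linear_eq_on_span [where B = "basis_vec ` index_set"])
      fix y :: "('k, 'l) tri_mat"
      assume "y \<in> basis_vec ` index_set"
      then show "(S.phi \<circ> \<theta>) y = M.phi y"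
        by (auto simp: \<theta>_basis S.phi.scaleR phi_star)
    qed (use linear_compose [OF \<theta> S.linear_phi] in \<open>simp_all add: comp_def M.linear_phi span_basis_vec\<close>)
    then show ?thesis
      by simp
  qed
  have "lie_involution (tri_bracket :: ('k, 'l) tri_mat \<Rightarrow> _) H \<theta> basis_vec basis_norm index_set"
  proof
    show "H x y = H y x" for x y
      unfolding H_def by (subst e8_inv_form_sym) (rule refl)
    show "H (tri_bracket x y) z = H x (tri_bracket y z)" for x y z
      by (simp add: H_def M.phi_bracket e8_inv_form_invariant)
    show "\<theta> (tri_bracket x y) = tri_bracket (\<theta> x) (\<theta> y)" for x y
      by (rule S.phi_eq_iff [THEN iffD1]) (simp add: star M.phi_bracket S.phi_bracket)
    show "x = 0" if "\<And>y. tri_bracket x y = 0" for x :: "('k, 'l) tri_mat"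
    proof -
      have "e8_bracket (M.phi x) (M.off_map LD t) = 0" for t
        using M.phi_bracket [of x "abs_tri_mat (off LD t)"] that
        by (simp add: M.phi_abs off_mats M.Phi_off M.phi.zero del: off.simps)
      then have "M.phi x = 0"
        by (rule M.off_map_centralizer_eq_0)
      then show ?thesis
        using M.phi_eq_iff [of x 0] by (simp add: M.phi.zero)
    qed
  qed (simp_all add: M.lie_algebra_tri_bracket H linear_add [OF \<theta>] linear_scale [OF \<theta>] \<theta>_basis H_basis basis_vec_inj independent_basis_vec span_basis_vec)
  then show ?thesis
    by blast
qed

subsection \<open>Dimension and character\<close>

lemma card_as_sum: "card (S :: ('a::finite \<times> 'b::finite) set) = (\<Sum>x\<in>UNIV. \<Sum>y\<in>UNIV. if (x, y) \<in> S then 1 else 0)"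
  unfolding sum.cartesian_product UNIV_Times_UNIV case_prod_unfold prod.collapse by (simp add: sum.If_cases)

lemma sum_ounit: "(\<Sum>a\<in>UNIV. f a) = f (Quat Q1) + f (Quat Qi) + f (Quat Qj) + f (Quat Qk)
    + f (Ell Q1) + f (Ell Qi) + f (Ell Qj) + f (Ell Qk)"
  by (simp add: UNIV_ounit UNIV_qunit add_ac)

lemma card_unit_pairs: "card (unit_pairs :: ('u::oct_alg ounit \<times> 'u ounit) set) = 28"
  using ell_sq_cases [where 'a = 'u]
  unfolding card_as_sum sum_ounit
  by (auto simp: unit_pairs_def imag_units_def qconj_def)

text \<open>A split algebra has four units of norm 1 and four of norm -1, hence 4 times 4 pairs of
  mixed norm.\<close>

lemma card_unit_pairs_negative:
  "card {x \<in> unit_pairs. unorm (fst x) * unorm (snd x :: 'u::oct_alg ounit) = - 1}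
    = (if ell_sq TYPE('u) = 1 then 16 else 0)"
  using ell_sq_cases [where 'a = 'u]
  unfolding card_as_sum sum_ounit
  by (auto simp: unit_pairs_def imag_units_def qconj_def unorm_def uconj_def)

text \<open>With one split factor the count is 8 times 4, with two it is 4 times 4 taken
  twice.\<close>

lemma card_tensor_negative:
  "card {x. unorm (fst x :: 'k::oct_alg ounit) * unorm (snd x :: 'l::oct_alg ounit) = - 1}
    = (if ell_sq TYPE('k) = 1 \<or> ell_sq TYPE('l) = 1 then 32 else 0)"
  using ell_sq_cases [where 'a = 'k] ell_sq_cases [where 'a = 'l]
  unfolding card_as_sum sum_ounit
  by (auto simp: unorm_def uconj_def qconj_def)

lemma card_index_set: "card (index_set :: ('k::oct_alg, 'l::oct_alg) index set) = 248"
proof -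
  have "card (UNIV :: (lang \<times> 'k ounit \<times> 'l ounit) set) = card (UNIV :: lang set) *
      (card (UNIV :: 'k ounit set) * card (UNIV :: 'l ounit set))"
    by (simp add: card_cartesian_product flip: UNIV_Times_UNIV)
  moreover have "card (UNIV :: 'k ounit set) = 8" "card (UNIV :: 'l ounit set) = 8"
    using sum_ounit [of "\<lambda>_ :: 'k ounit. 1 :: nat"] sum_ounit [of "\<lambda>_ :: 'l ounit. 1 :: nat"] by simp_all
  moreover have "card (UNIV :: lang set) = 3"
    by (simp add: UNIV_lang)
  ultimately show ?thesis
    by (simp add: index_set_def card_Plus card_unit_pairs)
qed

lemma dim_tri_mat: "dim (UNIV :: ('k::oct_alg, 'l::oct_alg) tri_mat set) = 248"
  by (rule dim_unique [of "basis_vec ` index_set"])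
    (simp_all add: independent_basis_vec span_basis_vec card_image basis_vec_inj card_index_set)

lemma basis_norm_cases: "basis_norm i = 1 \<or> basis_norm i = - 1"
  using basis_norm_square [of i] square_eq_1_iff by blast

lemma card_basis_norm_negative:
  assumes "ell_sq TYPE('k::oct_alg) \<noteq> ell_sq TYPE('l::oct_alg)"
  shows "card {i \<in> index_set :: ('k, 'l) index set. basis_norm i = - 1} = 112"
proof -
  define T where "T = {x. unorm (fst x :: 'k ounit) * unorm (snd x :: 'l ounit) = - 1}"
  define S where "S = {x \<in> unit_pairs. unorm (fst x) * unorm (snd x :: 'k ounit) = - 1}"
  define S' where "S' = {x \<in> unit_pairs. unorm (fst x) * unorm (snd x :: 'l ounit) = - 1}"
  have "{i \<in> index_set :: ('k, 'l) index set. basis_norm i = - 1} = (UNIV \<times> T) <+> (S <+> S')"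
  proof (rule set_eqI)
    fix i :: "('k, 'l) index"
    show "i \<in> {i \<in> index_set. basis_norm i = - 1} \<longleftrightarrow> i \<in> (UNIV \<times> T) <+> (S <+> S')"
      by (cases i rule: basis_norm.cases) (auto simp: T_def S_def S'_def)
  qed
  \<comment> \<open>Three types with 32 tensors each; the other 16 elements are diagonal and belong
    to the split algebra.\<close>
  moreover have "card ((UNIV :: lang set) \<times> T) = 96"
    unfolding card_cartesian_product T_def card_tensor_negative
    using assms ell_sq_cases [where 'a = 'k] ell_sq_cases [where 'a = 'l] by (auto simp: UNIV_lang)
  moreover have "card S + card S' = 16"
    unfolding S_def S'_def card_unit_pairs_negative
    using assms ell_sq_cases [where 'a = 'k] ell_sq_cases [where 'a = 'l] by auto
  ultimately show ?thesis
    by (simp add: card_Plus del: Collect_case_prod)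
qed

lemma unorm_division: "ell_sq TYPE('u::oct_alg) = - 1 \<Longrightarrow> unorm (a :: 'u ounit) = 1"
  by (cases a; rename_tac x; case_tac x) (simp_all add: unorm_def uconj_def qconj_def)

lemma compact_e8_tri_bracket:
  assumes "ell_sq TYPE('k::oct_alg) = - 1" "ell_sq TYPE('l::oct_alg) = - 1"
  shows "compact_e8 (tri_bracket :: ('k, 'l) tri_mat \<Rightarrow> _)"
proof -
  obtain H \<theta> where "lie_involution (tri_bracket :: ('k, 'l) tri_mat \<Rightarrow> _) H \<theta> basis_vec basis_norm index_set"
    using lie_involution_tri_mat by blast
  then interpret lie_involution "tri_bracket :: ('k, 'l) tri_mat \<Rightarrow> _" H \<theta> basis_vec basis_norm index_set .
  have "basis_norm i = 1" for i :: "('k, 'l) index"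
    by (cases i rule: basis_norm.cases) (simp_all add: assms unorm_division)
  then show ?thesis
    unfolding compact_e8_def using real_form_e8_tri_bracket killing_negative by blast
qed

lemma e8_minus24_tri_bracket:
  assumes "ell_sq TYPE('k::oct_alg) \<noteq> ell_sq TYPE('l::oct_alg)"
  shows "e8_minus24 (tri_bracket :: ('k, 'l) tri_mat \<Rightarrow> _)"
proof -
  obtain H \<theta> where "lie_involution (tri_bracket :: ('k, 'l) tri_mat \<Rightarrow> _) H \<theta> basis_vec basis_norm index_set"
    using lie_involution_tri_mat by blast
  then interpret lie_involution "tri_bracket :: ('k, 'l) tri_mat \<Rightarrow> _" H \<theta> basis_vec basis_norm index_set .
  let ?n = "\<lambda>e. {i \<in> index_set :: ('k, 'l) index set. basis_norm i = e}"
  have "?n (- 1) \<union> ?n 1 = index_set" "?n (- 1) \<inter> ?n 1 = {}"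
    using basis_norm_cases by auto
  then have "card (?n (- 1)) + card (?n 1) = 248"
    using card_Un_disjoint [of "?n (- 1)" "?n 1"] card_index_set [where 'k = 'k and 'l = 'l] by simp
  \<comment> \<open>112 - 136 = -24.\<close>
  then have "int (card (?n (- 1))) - int (card (?n 1)) = - 24"
    unfolding card_basis_norm_negative [OF assms] by simp
  then show ?thesis
    unfolding e8_minus24_def using real_form_e8_tri_bracket has_character by metis
qed

theorem theorem4:
  shows "dim (UNIV :: ('k::oct_alg, 'l::oct_alg) tri_mat set) = 248 \<and>
    (\<forall>v w :: ('k, 'l) tri_mat. \<exists>!u. product_value v w u) \<and>
    lie_algebra (tri_bracket :: ('k, 'l) tri_mat \<Rightarrow> ('k, 'l) tri_mat \<Rightarrow> ('k, 'l) tri_mat) \<and>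
    (ell_sq TYPE('k) = - 1 \<and> ell_sq TYPE('l) = - 1 \<longrightarrow>
      compact_e8 (tri_bracket :: ('k, 'l) tri_mat \<Rightarrow> ('k, 'l) tri_mat \<Rightarrow> ('k, 'l) tri_mat)) \<and>
    (ell_sq TYPE('k) = 1 \<and> ell_sq TYPE('l) = 1 \<longrightarrow>
      split_e8 (tri_bracket :: ('k, 'l) tri_mat \<Rightarrow> ('k, 'l) tri_mat \<Rightarrow> ('k, 'l) tri_mat)) \<and>
    (ell_sq TYPE('k) \<noteq> ell_sq TYPE('l) \<longrightarrow>
      e8_minus24 (tri_bracket :: ('k, 'l) tri_mat \<Rightarrow> ('k, 'l) tri_mat \<Rightarrow> ('k, 'l) tri_mat))"
  using dim_tri_mat e8_model.product_value_ex1 [OF e8_model_csqrt] e8_model.lie_algebra_tri_bracket [OF e8_model_csqrt]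
    compact_e8_tri_bracket split_e8_tri_bracket e8_minus24_tri_bracket
  by blast

end
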